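(* Let $(E,\Phi)$ be a rank-2 trace-free co-Higgs bundle over a Hopf surface $X$. If $\Phi\neq0$ and $\iota:L\hookrightarrow E$ is an invariant sub-line bundle of $\Phi$ with torsion-free cokernel, then the eigen-variety $\mathcal{E}(\Phi)$ contains the vanishing locus $V(L)\subset\mathbb{P}(E)$ as an irreducible component, where $V(L):=\mathrm{Proj}_X(\mathrm{Sym}(\mathrm{Im}(\iota^\vee)))$ and $\iota^\vee:E^\vee\to L^\vee$ is the dual map.
   Context: A (primary) Hopf surface is a compact complex surface homeomorphic to $S^1\times S^3$. A co-Higgs bundle on $X$ is a pair $(E,\Phi)$ with $E$ a holomorphic vector bundle and $\Phi\in H^0(X,\mathcal{E}nd(E)\otimes\mathcal{T}_X)$ with $\Phi\wedge\Phi=0$ (commutator on $\mathcal{E}nd(E)$, wedge product on $\mathcal{T}_X$); it is trace-free if $\Phi$ takes values in trace-free endomorphisms $\mathcal{E}nd_0(E)\otimes\mathcal{T}_X$. $L\subset E$ is invariant if $\Phi(L)\subseteq L\otimes\mathcal{T}_X$. $\mathbb{P}(E)=\mathrm{Proj}_X(\mathrm{Sym}(E^\vee))$ is the bundle of lines in $E$; the surjection $E^\vee\to\mathrm{Im}(\iota^\vee)$ embeds $V(L)$ in $\mathbb{P}(E)$. The eigen-variety is $$\mathcal{E}(\Phi):=\{(x,[v])\in\mathbb{P}(E):\Phi_x(v)\wedge v=0\in\wedge^2E_x\otimes\mathcal{T}_{X,x}\}.$$ *)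

theory Defs
  imports "HOL-Analysis.Analysis"
begin

section \<open>Complex manifolds\<close>

text \<open>
  \<^term>\<open>(*s)\<close> is the complex scalar multiplication on \<^typ>\<open>complex ^ 'n\<close>, so the
  derivative below is required to be complex linear.
\<close>

definition holo_on :: "(complex ^ 'n) set \<Rightarrow> (complex ^ 'n \<Rightarrow> complex) \<Rightarrow> bool" where
  "holo_on \<Omega> f \<longleftrightarrow>
     (\<forall>z\<in>\<Omega>. \<exists>D. (f has_derivative D) (at z) \<and> (\<forall>c v. D (c *s v) = c * D v))"

text \<open>
  A chart is a domain together with a coordinate map, whose values outside the domain are
  irrelevant.  Atlases are not assumed to be maximal.
\<close>

type_synonym ('a, 'n) chart = "'a set \<times> ('a \<Rightarrow> complex ^ 'n)"
type_synonym ('a, 'n) atlas = "('a, 'n) chart set"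

definition transition :: "('a, 'n :: finite) chart \<Rightarrow> ('a, 'n) chart \<Rightarrow> complex ^ 'n \<Rightarrow> complex ^ 'n" where
  "transition c d = snd d \<circ> inv_into (fst c) (snd c)"

definition complex_manifold :: "('a :: {t2_space, second_countable_topology}, 'n :: finite) atlas \<Rightarrow> bool" where
  "complex_manifold X \<longleftrightarrow>
     \<Union> (fst ` X) = UNIV \<and>
     (\<forall>(U, \<phi>)\<in>X. open U \<and> open (\<phi> ` U) \<and> homeomorphism U (\<phi> ` U) \<phi> (inv_into U \<phi>)) \<and>
     (\<forall>c\<in>X. \<forall>d\<in>X. \<forall>k. holo_on (snd c ` (fst c \<inter> fst d)) (\<lambda>z. transition c d z $ k))"

definition hopf_surface :: "('a :: {t2_space, second_countable_topology}, 2) atlas \<Rightarrow> bool" where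
  "hopf_surface X \<longleftrightarrow>
     complex_manifold X \<and> compact (UNIV :: 'a set) \<and>
     (UNIV :: 'a set) homeomorphic (sphere (0 :: real ^ 2) 1 \<times> sphere (0 :: real ^ 4) 1)"

definition holo_fun :: "('a, 'n :: finite) atlas \<Rightarrow> 'a set \<Rightarrow> ('a \<Rightarrow> complex) \<Rightarrow> bool" where
  "holo_fun X W h \<longleftrightarrow> (\<forall>(U, \<phi>)\<in>X. holo_on (\<phi> ` (U \<inter> W)) (h \<circ> inv_into U \<phi>))"


section \<open>Analytic subsets and irreducible components\<close>

definition analytic_subset :: "(complex ^ 'n) set \<Rightarrow> (complex ^ 'n) set \<Rightarrow> bool" where
  "analytic_subset \<Omega> Z \<longleftrightarrow>
     Z \<subseteq> \<Omega> \<and>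
     (\<forall>p\<in>\<Omega>. \<exists>N F. open N \<and> p \<in> N \<and> N \<subseteq> \<Omega> \<and> finite F \<and> (\<forall>f\<in>F. holo_on N f) \<and>
        Z \<inter> N = {z \<in> N. \<forall>f\<in>F. f z = 0})"

text \<open>
  Analyticity is tested in the charts at every point of the manifold, not only at the points of
  \<open>S\<close>; analytic sets are therefore closed.
\<close>

definition analytic_in :: "('p, 'n :: finite) atlas \<Rightarrow> 'p set \<Rightarrow> bool" where
  "analytic_in M S \<longleftrightarrow>
     S \<subseteq> \<Union> (fst ` M) \<and> (\<forall>(U, \<phi>)\<in>M. analytic_subset (\<phi> ` U) (\<phi> ` (S \<inter> U)))"

definition irreducible_analytic :: "('p, 'n :: finite) atlas \<Rightarrow> 'p set \<Rightarrow> bool" where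
  "irreducible_analytic M S \<longleftrightarrow>
     analytic_in M S \<and> S \<noteq> {} \<and>
     (\<forall>S1 S2. analytic_in M S1 \<and> analytic_in M S2 \<and> S = S1 \<union> S2 \<longrightarrow> S1 = S \<or> S2 = S)"

definition irreducible_component :: "('p, 'n :: finite) atlas \<Rightarrow> 'p set \<Rightarrow> 'p set \<Rightarrow> bool" where
  "irreducible_component M S Z \<longleftrightarrow>
     analytic_in M S \<and> irreducible_analytic M Z \<and> Z \<subseteq> S \<and>
     (\<forall>Z'. irreducible_analytic M Z' \<and> Z \<subseteq> Z' \<and> Z' \<subseteq> S \<longrightarrow> Z' = Z)"


section \<open>Holomorphic vector bundles\<close>

text \<open>
  The total space is the type \<^typ>\<open>'e\<close>.  A trivialization over \<open>U\<close> is given by its fibre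
  coordinates \<open>\<tau>\<close>, that is, by the second component of an isomorphism from the restriction to
  \<open>U\<close> onto the product of \<open>U\<close> with \<^typ>\<open>complex ^ 'r\<close>.  The vector space structure of the
  fibres and the complex structure of the total space are those transported by the
  trivializations.
\<close>

record ('a, 'e, 'r :: finite) vbundle =
  proj :: "'e \<Rightarrow> 'a"
  trivs :: "('a set \<times> ('e \<Rightarrow> complex ^ 'r)) set"

definition holo_vector_bundle ::
    "('a :: topological_space, 'n :: finite) atlas \<Rightarrow> ('a, 'e, 'r :: finite) vbundle \<Rightarrow> bool" where
  "holo_vector_bundle X B \<longleftrightarrow>
     \<Union> (fst ` trivs B) = UNIV \<and>
     (\<forall>(V, \<tau>)\<in>trivs B. open V \<and> (\<forall>x\<in>V. bij_betw \<tau> {e. proj B e = x} UNIV)) \<and>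
     (\<forall>(V, \<tau>)\<in>trivs B. \<forall>(V', \<tau>')\<in>trivs B. \<exists>g :: 'a \<Rightarrow> complex ^ 'r ^ 'r.
        (\<forall>i j. holo_fun X (V \<inter> V') (\<lambda>x. g x $ i $ j)) \<and>
        (\<forall>e. proj B e \<in> V \<inter> V' \<longrightarrow> \<tau>' e = g (proj B e) *v \<tau> e))"

definition vb_scale :: "('a, 'e, 'r :: finite) vbundle \<Rightarrow> complex \<Rightarrow> 'e \<Rightarrow> 'e" where
  "vb_scale B c e = (THE e'. proj B e' = proj B e \<and>
     (\<forall>(V, \<tau>)\<in>trivs B. proj B e \<in> V \<longrightarrow> \<tau> e' = c *s \<tau> e))"

definition vb_is_zero :: "('a, 'e, 'r :: finite) vbundle \<Rightarrow> 'e \<Rightarrow> bool" where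
  "vb_is_zero B e \<longleftrightarrow> (\<forall>(V, \<tau>)\<in>trivs B. proj B e \<in> V \<longrightarrow> \<tau> e = 0)"

definition holo_section ::
    "('a, 'n :: finite) atlas \<Rightarrow> ('a, 'e, 'r :: finite) vbundle \<Rightarrow> 'a set \<Rightarrow> ('a \<Rightarrow> 'e) \<Rightarrow> bool" where
  "holo_section X B W s \<longleftrightarrow>
     (\<forall>x\<in>W. proj B (s x) = x) \<and>
     (\<forall>(V, \<tau>)\<in>trivs B. \<forall>i. holo_fun X (V \<inter> W) (\<lambda>x. \<tau> (s x) $ i))"

definition holo_bundle_map ::
    "('a, 'n :: finite) atlas \<Rightarrow> ('a, 'e, 'r :: finite) vbundle \<Rightarrow> ('a, 'f, 's :: finite) vbundle \<Rightarrow>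
     'a set \<Rightarrow> ('e \<Rightarrow> 'f) \<Rightarrow> bool" where
  "holo_bundle_map X B C W f \<longleftrightarrow>
     (\<forall>e. proj B e \<in> W \<longrightarrow> proj C (f e) = proj B e) \<and>
     (\<forall>(V, \<tau>)\<in>trivs B. \<forall>(V', \<sigma>)\<in>trivs C. \<exists>A :: 'a \<Rightarrow> complex ^ 'r ^ 's.
        (\<forall>i j. holo_fun X (W \<inter> V \<inter> V') (\<lambda>x. A x $ i $ j)) \<and>
        (\<forall>e. proj B e \<in> W \<inter> V \<inter> V' \<longrightarrow> \<sigma> (f e) = A (proj B e) *v \<tau> e))"


section \<open>Trace-free co-Higgs fields\<close>

text \<open>
  A section \<open>\<Phi>\<close> of the tensor product of \<open>End(E)\<close> with the holomorphic tangent bundle of \<open>X\<close>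
  is given by its components: over the domain of a chart \<open>c\<close> with coordinates \<open>z\<^sub>k\<close>,
  it is the sum over \<open>k\<close> of \<open>\<Phi> c k \<otimes> \<partial>/\<partial>z\<^sub>k\<close>, where \<open>\<Phi> c k\<close> is a holomorphic
  endomorphism of the restriction of \<open>E\<close>.  Under a change of charts the components transform by the
  Jacobian matrix, as the coordinates of a tangent vector do.
\<close>

type_synonym ('a, 'e) end_field = "('a, 2) chart \<Rightarrow> 2 \<Rightarrow> 'e \<Rightarrow> 'e"

definition partial_deriv :: "(complex ^ 'n \<Rightarrow> complex) \<Rightarrow> 'n \<Rightarrow> complex ^ 'n \<Rightarrow> complex" where
  "partial_deriv f j z = frechet_derivative f (at z) (axis j 1)"

definition end_tangent_section ::
    "('a, 2) atlas \<Rightarrow> ('a, 'e, 'r :: finite) vbundle \<Rightarrow> ('a, 'e) end_field \<Rightarrow> bool" where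
  "end_tangent_section X E \<Phi> \<longleftrightarrow>
     (\<forall>c\<in>X. \<forall>k. holo_bundle_map X E E (fst c) (\<Phi> c k)) \<and>
     (\<forall>c\<in>X. \<forall>d\<in>X. \<forall>k e. \<forall>(V, \<tau>)\<in>trivs E. proj E e \<in> fst c \<inter> fst d \<inter> V \<longrightarrow>
        \<tau> (\<Phi> d k e) =
          (\<Sum>j\<in>UNIV. partial_deriv (\<lambda>z. transition c d z $ k) j (snd c (proj E e)) *s \<tau> (\<Phi> c j e)))"

text \<open>
  The coefficient of \<open>\<partial>/\<partial>z\<^sub>j \<and> \<partial>/\<partial>z\<^sub>k\<close> in \<open>\<Phi> \<and> \<Phi>\<close> is the commutator of
  \<open>\<Phi> c j\<close> and \<open>\<Phi> c k\<close>.
\<close>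

definition co_higgs_field ::
    "('a, 2) atlas \<Rightarrow> ('a, 'e, 'r :: finite) vbundle \<Rightarrow> ('a, 'e) end_field \<Rightarrow> bool" where
  "co_higgs_field X E \<Phi> \<longleftrightarrow>
     end_tangent_section X E \<Phi> \<and>
     (\<forall>c\<in>X. \<forall>j k e. proj E e \<in> fst c \<longrightarrow> \<Phi> c j (\<Phi> c k e) = \<Phi> c k (\<Phi> c j e))"

definition trace_free ::
    "('a, 2) atlas \<Rightarrow> ('a, 'e, 'r :: finite) vbundle \<Rightarrow> ('a, 'e) end_field \<Rightarrow> bool" where
  "trace_free X E \<Phi> \<longleftrightarrow>
     (\<forall>c\<in>X. \<forall>k. \<forall>(V, \<tau>)\<in>trivs E. \<forall>x \<in> fst c \<inter> V. \<forall>A :: complex ^ 'r ^ 'r.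
        (\<forall>e. proj E e = x \<longrightarrow> \<tau> (\<Phi> c k e) = A *v \<tau> e) \<longrightarrow> trace A = 0)"

definition nonzero_field ::
    "('a, 2) atlas \<Rightarrow> ('a, 'e, 'r :: finite) vbundle \<Rightarrow> ('a, 'e) end_field \<Rightarrow> bool" where
  "nonzero_field X E \<Phi> \<longleftrightarrow> (\<exists>c\<in>X. \<exists>k e. proj E e \<in> fst c \<and> \<not> vb_is_zero E (\<Phi> c k e))"


section \<open>Invariant sub-line bundles with torsion-free cokernel\<close>

text \<open>
  \<open>\<iota>\<close> is injective as a map of sheaves of sections; it may vanish on individual fibres.
\<close>

definition sheaf_injective ::
    "('a :: topological_space, 'n :: finite) atlas \<Rightarrow> ('a, 'l, 's :: finite) vbundle \<Rightarrow>
     ('a, 'e, 'r :: finite) vbundle \<Rightarrow> ('l \<Rightarrow> 'e) \<Rightarrow> bool"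
where
  "sheaf_injective X L E \<iota> \<longleftrightarrow>
     (\<forall>W t. open W \<and> holo_section X L W t \<and> (\<forall>y\<in>W. vb_is_zero E (\<iota> (t y))) \<longrightarrow>
        (\<forall>y\<in>W. vb_is_zero L (t y)))"

definition sub_line_bundle ::
    "('a :: topological_space, 'n :: finite) atlas \<Rightarrow> ('a, 'l, 1) vbundle \<Rightarrow>
     ('a, 'e, 'r :: finite) vbundle \<Rightarrow> ('l \<Rightarrow> 'e) \<Rightarrow> bool"
where
  "sub_line_bundle X L E \<iota> \<longleftrightarrow>
     holo_vector_bundle X L \<and> holo_bundle_map X L E UNIV \<iota> \<and> sheaf_injective X L E \<iota>"

text \<open>
  Every stalk of the cokernel of \<open>\<iota>\<close> is torsion-free: if a product \<open>h \<cdot> s\<close> of germs at \<open>x\<close> lies in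
  the image of \<open>\<iota>\<close> and \<open>h \<noteq> 0\<close> as a germ, then so does \<open>s\<close>.
\<close>

definition torsion_free_cokernel ::
    "('a :: topological_space, 'n :: finite) atlas \<Rightarrow> ('a, 'l, 's :: finite) vbundle \<Rightarrow>
     ('a, 'e, 'r :: finite) vbundle \<Rightarrow> ('l \<Rightarrow> 'e) \<Rightarrow> bool"
where
  "torsion_free_cokernel X L E \<iota> \<longleftrightarrow>
     (\<forall>x W h s t. open W \<and> x \<in> W \<and>
        holo_fun X W h \<and> holo_section X E W s \<and> holo_section X L W t \<and>
        (\<forall>y\<in>W. vb_scale E (h y) (s y) = \<iota> (t y)) \<and>
        (\<forall>N. open N \<and> x \<in> N \<and> N \<subseteq> W \<longrightarrow> (\<exists>y\<in>N. h y \<noteq> 0)) \<longrightarrow>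
        (\<exists>N t'. open N \<and> x \<in> N \<and> N \<subseteq> W \<and> holo_section X L N t' \<and> (\<forall>y\<in>N. s y = \<iota> (t' y))))"

text \<open>
  \<open>\<Phi>\<close> maps local sections of \<open>L\<close> to local sections of the tensor product of \<open>L\<close> with the tangent
  bundle; in a chart this is a condition on each component of \<open>\<Phi>\<close>.
\<close>

definition invariant_under ::
    "('a :: topological_space, 2) atlas \<Rightarrow> ('a, 'l, 's :: finite) vbundle \<Rightarrow> ('a, 'e, 'r :: finite) vbundle \<Rightarrow>
     ('a, 'e) end_field \<Rightarrow> ('l \<Rightarrow> 'e) \<Rightarrow> bool"
where
  "invariant_under X L E \<Phi> \<iota> \<longleftrightarrow>
     (\<forall>c\<in>X. \<forall>k x W t. open W \<and> x \<in> W \<and> W \<subseteq> fst c \<and> holo_section X L W t \<longrightarrow>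
        (\<exists>N t'. open N \<and> x \<in> N \<and> N \<subseteq> W \<and> holo_section X L N t' \<and>
           (\<forall>y\<in>N. \<Phi> c k (\<iota> (t y)) = \<iota> (t' y))))"


section \<open>The bundle of lines of a rank-2 bundle\<close>

text \<open>
  The point \<open>(x, [v])\<close> of the bundle of lines is represented by the set of all multiples of \<open>v\<close> in
  the fibre over \<open>x\<close>, which determines \<open>x\<close>.
\<close>

definition line_of :: "('a, 'e, 'r :: finite) vbundle \<Rightarrow> 'e \<Rightarrow> 'e set" where
  "line_of E v = range (\<lambda>c. vb_scale E c v)"

definition proj_bundle :: "('a, 'e, 'r :: finite) vbundle \<Rightarrow> 'e set set" where
  "proj_bundle E = {line_of E v | v. \<not> vb_is_zero E v}"

text \<open>
  A chart of the base with coordinates \<open>z\<^sub>1, z\<^sub>2\<close>, a trivialization with fibre coordinates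
  \<open>w\<^sub>1, w\<^sub>2\<close> and an index \<open>k\<close> give a chart of the bundle of lines, with coordinates
  \<open>z\<^sub>1\<close>, \<open>z\<^sub>2\<close> and \<open>w\<^sub>j / w\<^sub>k\<close> for \<open>j \<noteq> k\<close>.
\<close>

definition proj_chart ::
    "('a, 'e, 2) vbundle \<Rightarrow> ('a, 2) chart \<Rightarrow> 'a set \<times> ('e \<Rightarrow> complex ^ 2) \<Rightarrow> 2 \<Rightarrow> ('e set, 3) chart"
where
  "proj_chart E c t k =
     ({l \<in> proj_bundle E. \<exists>v\<in>l. proj E v \<in> fst c \<inter> fst t \<and> snd t v $ k \<noteq> 0},
      \<lambda>l. let v = (THE v. v \<in> l \<and> snd t v $ k = 1); z = snd c (proj E v)
          in vector [z $ 1, z $ 2, snd t v $ (if k = 1 then 2 else 1)])"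

definition proj_atlas :: "('a, 2) atlas \<Rightarrow> ('a, 'e, 2) vbundle \<Rightarrow> ('e set, 3) atlas" where
  "proj_atlas X E = {proj_chart E c t k | c t k. c \<in> X \<and> t \<in> trivs E}"

definition wedge2 :: "complex ^ 2 \<Rightarrow> complex ^ 2 \<Rightarrow> complex" where
  "wedge2 a b = a $ 1 * b $ 2 - a $ 2 * b $ 1"

definition eigen_variety ::
    "('a, 2) atlas \<Rightarrow> ('a, 'e, 2) vbundle \<Rightarrow> ('a, 'e) end_field \<Rightarrow> 'e set set" where
  "eigen_variety X E \<Phi> =
     {line_of E v | v. \<not> vb_is_zero E v \<and>
        (\<forall>c\<in>X. \<forall>k. \<forall>(V, \<tau>)\<in>trivs E. proj E v \<in> fst c \<inter> V \<longrightarrow> wedge2 (\<tau> (\<Phi> c k v)) (\<tau> v) = 0)}"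


section \<open>The locus of a sub-line bundle\<close>

text \<open>
  Local sections of the dual bundle over \<open>W\<close>, as fibrewise linear functions on the total space.  The
  dual map sends \<open>\<alpha>\<close> to \<open>\<alpha> \<circ> \<iota>\<close>.
\<close>

definition dual_section ::
    "('a, 'n :: finite) atlas \<Rightarrow> ('a, 'e, 'r :: finite) vbundle \<Rightarrow> 'a set \<Rightarrow> ('e \<Rightarrow> complex) \<Rightarrow> bool" where
  "dual_section X B W \<alpha> \<longleftrightarrow>
     (\<forall>(V, \<tau>)\<in>trivs B. \<exists>a :: 'a \<Rightarrow> complex ^ 'r.
        (\<forall>i. holo_fun X (W \<inter> V) (\<lambda>x. a x $ i)) \<and>
        (\<forall>e. proj B e \<in> W \<inter> V \<longrightarrow> \<alpha> e = (\<Sum>i\<in>UNIV. a (proj B e) $ i * \<tau> e $ i)))"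

definition dual_germ ::
    "('a :: topological_space, 'e, 'r :: finite) vbundle \<Rightarrow> 'a \<Rightarrow> ('e \<Rightarrow> complex) \<Rightarrow> ('e \<Rightarrow> complex) set" where
  "dual_germ B x \<alpha> = {\<beta>. \<exists>W. open W \<and> x \<in> W \<and> (\<forall>e. proj B e \<in> W \<longrightarrow> \<beta> e = \<alpha> e)}"

text \<open>The stalk at \<open>x\<close> of the image sheaf of the dual map of \<open>\<iota>\<close>.\<close>

definition im_dual_stalk ::
    "('a :: topological_space, 'n :: finite) atlas \<Rightarrow> ('a, 'l, 's :: finite) vbundle \<Rightarrow> ('a, 'e, 'r :: finite) vbundle \<Rightarrow>
     ('l \<Rightarrow> 'e) \<Rightarrow> 'a \<Rightarrow> ('l \<Rightarrow> complex) set set"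
where
  "im_dual_stalk X L E \<iota> x =
     {dual_germ L x (\<alpha> \<circ> \<iota>) | \<alpha> W. open W \<and> x \<in> W \<and> dual_section X E W \<alpha>}"

text \<open>
  Linear maps from a stalk \<open>M\<close> to the residue field at \<open>x\<close> (which is the field of complex numbers),
  over the local ring of germs of holomorphic functions at \<open>x\<close>.
\<close>

definition residue_linear ::
    "('a :: topological_space, 'n :: finite) atlas \<Rightarrow> ('a, 'l, 's :: finite) vbundle \<Rightarrow> 'a \<Rightarrow>
     ('l \<Rightarrow> complex) set set \<Rightarrow> (('l \<Rightarrow> complex) set \<Rightarrow> complex) \<Rightarrow> bool"
where
  "residue_linear X L x M \<Lambda> \<longleftrightarrow>
     (\<forall>W h k \<beta> \<gamma>. open W \<and> x \<in> W \<and> holo_fun X W h \<and> holo_fun X W k \<and>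
        dual_germ L x \<beta> \<in> M \<and> dual_germ L x \<gamma> \<in> M \<longrightarrow>
        \<Lambda> (dual_germ L x (\<lambda>e. h (proj L e) * \<beta> e + k (proj L e) * \<gamma> e)) =
          h x * \<Lambda> (dual_germ L x \<beta>) + k x * \<Lambda> (dual_germ L x \<gamma>))"

text \<open>
  Let \<open>F\<close> be the image sheaf of the dual map of \<open>\<iota>\<close>.  By the universal property of the symmetric
  algebra, a point of \<open>Proj(Sym F)\<close> over \<open>x\<close> is a nonzero linear map \<open>\<Lambda>\<close> from the stalk of \<open>F\<close> to
  the residue field at \<open>x\<close>, up to a scalar.  The case in which \<open>F\<close> is the dual of \<open>E\<close> gives the lines
  in the fibre of \<open>E\<close>, a vector \<open>v\<close> being identified with the evaluation at \<open>v\<close>.  The closed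
  embedding given by the surjection from the dual of \<open>E\<close> onto \<open>F\<close> is composition of \<open>\<Lambda>\<close> with this
  surjection.  The set below is its image.
\<close>

definition sub_line_locus ::
    "('a :: topological_space, 'n :: finite) atlas \<Rightarrow> ('a, 'l, 's :: finite) vbundle \<Rightarrow> ('a, 'e, 'r :: finite) vbundle \<Rightarrow>
     ('l \<Rightarrow> 'e) \<Rightarrow> 'e set set"
where
  "sub_line_locus X L E \<iota> =
     {line_of E v | v. \<not> vb_is_zero E v \<and>
        (\<exists>\<Lambda>. residue_linear X L (proj E v) (im_dual_stalk X L E \<iota> (proj E v)) \<Lambda> \<and>
           (\<forall>\<alpha> W. open W \<and> proj E v \<in> W \<and> dual_section X E W \<alpha> \<longrightarrow>
              \<Lambda> (dual_germ L (proj E v) (\<alpha> \<circ> \<iota>)) = \<alpha> v))}"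

end

theory Submission
  imports Defs "HOL-Complex_Analysis.Conformal_Mappings"
begin

text \<open>
  Locally \<open>\<iota>\<close> is a pair \<open>(a, b)\<close> of holomorphic functions, and torsion-freeness of the cokernel says
  that \<open>h \<cdot> s = g \<cdot> (a, b)\<close> with \<open>h \<noteq> 0\<close> makes \<open>s\<close> a multiple of \<open>(a, b)\<close>.
  Relations between \<open>a\<close> and \<open>b\<close> are therefore multiples of \<open>(b, - a)\<close>, so that the locus of \<open>\<iota>\<close> is
  the hypersurface \<open>a w\<^sub>2 = b w\<^sub>1\<close>, which contains the whole fibre over each zero of \<open>\<iota>\<close>.

  Over the complement of the zeros, which is connected, the locus is the graph of \<open>[a : b]\<close>, and the
  identity theorem makes it irreducible.  An analytic set that contains this graph contains the fibres
  over the zeros too: otherwise \<open>a / (b - u\<^sub>0 a)\<close> would be bounded for some \<open>u\<^sub>0\<close>, hence holomorphic,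
  and \<open>b - u\<^sub>0 a\<close> would be a common divisor.

  Finally \<open>\<Phi>\<close> has trace zero, so away from the locus an eigenvector belongs to the eigenvalue opposite
  to that on \<open>\<iota>\<close>.  The eigen-variety is thus covered by the locus and one further analytic set that
  does not contain the locus.
\<close>

section \<open>Bounded quotients of holomorphic functions\<close>

text \<open>At a zero of \<iota> torsion-freeness is always used in the same way: a relation
  \<open>h * s = g * (a, b)\<close>, with \<open>h\<close> not zero as a germ, forces
  \<open>s\<close> to vanish at that zero. The obstacle is to produce such a relation from mere
  boundedness of a quotient, near a point where numerator and denominator both vanish. The
  denominator vanishes along a curve, so the quotient is extended slice by slice in one variable,
  and a Cauchy integral over a common circle makes the extension holomorphic in both variables. The
  further analytic set depends on the field. If \<Phi> kills the image of \<iota>, the eigenvalue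
  zero is its own opposite, and the condition for the opposite eigenvalue holds on the whole locus.
  An eigenvector off the locus then forces the field to vanish on its fibre, and the lines over the
  zeros of \<Phi> serve instead; \<Phi> \<noteq> 0 keeps the locus from lying among them. Maximality
  is then formal, since an irreducible set between the locus and the eigen-variety is the union of
  the locus and its intersection with the further set.\<close>

lemma continuous_on_deriv_parametric:
  fixes f :: "'t::topological_space \<Rightarrow> complex \<Rightarrow> complex"
  assumes cont: "continuous_on (T \<times> U) (\<lambda>(t, z). f t z)" and U: "open U"
    and hol: "\<And>t. t \<in> T \<Longrightarrow> f t holomorphic_on U"
  shows "continuous_on (T \<times> U) (\<lambda>(t, z). deriv (f t) z)"
  unfolding continuous_on_def
proof (rule ballI, rule tendstoI)
  fix p and e :: real
  assume "p \<in> T \<times> U" and e: "e > 0"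
  then obtain t0 z0 where p: "p = (t0, z0)" and t0: "t0 \<in> T" and z0: "z0 \<in> U" by auto
  \<comment> \<open>Radius \<open>2*r\<close> leaves room for the closed disc of radius
    \<open>r\<close> about every \<open>z\<close> within \<open>r\<close> of
    \<open>z0\<close>.\<close>
  obtain r where r: "r > 0" "cball z0 (2*r) \<subseteq> U"
  proof -
    obtain s where s: "s > 0" "cball z0 s \<subseteq> U"
      using U z0 open_contains_cball by blast
    show ?thesis by (rule that[of "s/2"]) (use s in auto)
  qed
  have "continuous_on (T \<times> cball z0 (2*r)) (\<lambda>(t, z). f t z)"
    by (rule continuous_on_subset[OF cont]) (use r in auto)
  moreover have "0 < e*r/2" using e r by simp
  ultimately obtain X0 where X0: "t0 \<in> X0" "open X0"
    and close: "\<forall>t\<in>X0 \<inter> T. \<forall>z\<in>cball z0 (2*r).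
      dist (case (t, z) of (t, z) \<Rightarrow> f t z) (case (t0, z) of (t, z) \<Rightarrow> f t z) \<le> e*r/2"
    using continuous_on_prod_compactE[OF _ compact_cball t0] by metis
  have close: "dist (f t z) (f t0 z) \<le> e*r/2" if "t \<in> X0 \<inter> T" "z \<in> cball z0 (2*r)" for t z
    using close that by fastforce
  have "continuous_on U (deriv (f t0))"
    by (intro holomorphic_on_imp_continuous_on holomorphic_deriv hol t0 U)
  then have "isCont (deriv (f t0)) z0"
    using U z0 continuous_on_eq_continuous_at by blast
  then obtain d where d: "d > 0" "\<And>z. dist z z0 < d \<Longrightarrow> dist (deriv (f t0) z) (deriv (f t0) z0) < e/2"
    unfolding continuous_at_eps_delta using e by (metis half_gt_zero)
  have est: "dist (deriv (f t) z) (deriv (f t0) z0) < e"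
    if t: "t \<in> X0 \<inter> T" and z: "dist z z0 < min r d" for t z
  proof -
    have sub: "cball z r \<subseteq> cball z0 (2*r)"
    proof
      fix y assume "y \<in> cball z r"
      then show "y \<in> cball z0 (2*r)"
        using z dist_triangle[of z0 y z] by (simp add: dist_commute)
    qed
    have hol': "f t holomorphic_on cball z r" "f t0 holomorphic_on cball z r"
      using hol[of t] hol[of t0] t t0 sub r(2) by (auto intro: holomorphic_on_subset)
    have zU: "z \<in> U" using z r by (auto simp: dist_commute)
    \<comment> \<open>Cauchy's inequality on the circle of radius \<open>r\<close> about
      \<open>z\<close>: the bound \<open>e*r/2\<close> on the difference of the functions becomes
      \<open>e/2\<close> for their derivatives.\<close>
    have "norm ((deriv ^^ 1) (\<lambda>w. f t w - f t0 w) z) \<le> fact 1 * (e*r/2) / r^1"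
    proof (rule Cauchy_inequality)
      show "(\<lambda>w. f t w - f t0 w) holomorphic_on ball z r"
        by (intro holomorphic_intros holomorphic_on_subset[OF hol'(1)] holomorphic_on_subset[OF hol'(2)]) auto
      show "continuous_on (cball z r) (\<lambda>w. f t w - f t0 w)"
        by (intro continuous_intros holomorphic_on_imp_continuous_on hol')
      show "norm (f t x - f t0 x) \<le> e*r/2" if "norm (z - x) = r" for x
        using close[OF t, of x] sub that by (auto simp: dist_norm subset_iff)
    qed (use r in auto)
    moreover have "deriv (\<lambda>w. f t w - f t0 w) z = deriv (f t) z - deriv (f t0) z"
      by (rule deriv_diff) (use hol t t0 zU U in \<open>auto intro!: holomorphic_on_imp_differentiable_at\<close>)
    ultimately have "dist (deriv (f t) z) (deriv (f t0) z) \<le> e/2"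
      using r by (simp add: dist_norm field_simps)
    moreover have "dist (deriv (f t0) z) (deriv (f t0) z0) < e/2"
      using d z by auto
    ultimately show ?thesis
      using dist_triangle[of "deriv (f t) z" "deriv (f t0) z0" "deriv (f t0) z"] by linarith
  qed
  have "open (X0 \<times> ball z0 (min r d))" "(t0, z0) \<in> X0 \<times> ball z0 (min r d)"
    using X0 r d by (auto intro: open_Times)
  then show "\<forall>\<^sub>F x in at p within T \<times> U.
      dist (case x of (t, z) \<Rightarrow> deriv (f t) z) (case p of (t, z) \<Rightarrow> deriv (f t) z) < e"
    unfolding p eventually_at_topological
    by (intro exI[of _ "X0 \<times> ball z0 (min r d)"]) (auto intro!: est simp: dist_commute)
qed

text \<open>Total differentiability follows from both partial derivatives once one of them is
  jointly continuous, and Cauchy's inequality supplies this for the derivative in \<open>y\<close>.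
  The resulting linear map is complex linear.\<close>

lemma separately_holomorphic_has_derivative:
  fixes f :: "complex \<Rightarrow> complex \<Rightarrow> complex"
  assumes cont: "continuous_on (A \<times> B) (\<lambda>(x, y). f x y)" and A: "open A" and B: "open B" "convex B"
    and hx: "\<And>y. y \<in> B \<Longrightarrow> (\<lambda>x. f x y) holomorphic_on A"
    and hy: "\<And>x. x \<in> A \<Longrightarrow> f x holomorphic_on B"
    and xy: "x \<in> A" "y \<in> B"
  shows "((\<lambda>(x, y). f x y) has_derivative
          (\<lambda>(u, v). deriv (\<lambda>x. f x y) x * u + deriv (f x) y * v)) (at (x, y))"
proof -
  have "((\<lambda>(x, y). f x y) has_derivative (\<lambda>(tx, ty). deriv (\<lambda>x. f x y) x * tx +
      blinfun_apply (blinfun_mult_right (deriv (f x) y)) ty)) (at (x, y) within A \<times> B)"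
  proof (rule has_derivative_partialsI)
    show "((\<lambda>x. f x y) has_derivative (*) (deriv (\<lambda>x. f x y) x)) (at x within A)"
      using holomorphic_derivI[OF hx[OF xy(2)] A xy(1)]
      by (simp add: has_field_derivative_def has_derivative_at_withinI)
    show "(f x' has_derivative blinfun_apply (blinfun_mult_right (deriv (f x') y'))) (at y' within B)"
      if "x' \<in> A" "y' \<in> B" for x' y'
      using holomorphic_derivI[OF hy[OF that(1)] B(1) that(2)]
      by (simp add: has_field_derivative_def has_derivative_at_withinI)
    have "continuous_on (A \<times> B) (\<lambda>p. blinfun_mult_right ((\<lambda>(x, y). deriv (f x) y) p))"
      by (intro bounded_linear.continuous_on[OF bounded_linear_blinfun_mult_right]
          continuous_on_deriv_parametric cont B hy)
    then show "continuous (at (x, y) within A \<times> B) (\<lambda>(x, y). blinfun_mult_right (deriv (f x) y))"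
      using xy by (simp add: continuous_on_eq_continuous_within case_prod_unfold)
  qed (use xy B in auto)
  moreover have "at (x, y) within A \<times> B = at (x, y)"
    by (rule at_within_open) (use xy A B in \<open>auto intro: open_Times\<close>)
  ultimately show ?thesis by simp
qed

lemma punctured_ball_nonzero:
  fixes h :: "complex \<Rightarrow> complex"
  assumes h: "h holomorphic_on S" and S: "open S" "connected S"
    and nz: "z1 \<in> S" "h z1 \<noteq> 0" and z: "z \<in> S"
  obtains r where "r > 0" "ball z r \<subseteq> S" "\<And>w. w \<in> ball z r - {z} \<Longrightarrow> h w \<noteq> 0"
proof (cases "h z = 0")
  case True
  then show ?thesis using isolated_zeros[OF h S z _ nz] that by blast
next
  case False
  have "open (S \<inter> h -` (- {0}))"
    using h S by (intro continuous_open_preimage holomorphic_on_imp_continuous_on) auto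
  moreover have "z \<in> S \<inter> h -` (- {0})" using z False by auto
  ultimately obtain r where "r > 0" "ball z r \<subseteq> S \<inter> h -` (- {0})"
    using open_contains_ball by blast
  then show ?thesis using that by blast
qed

text \<open>The zeros of \<open>h\<close> are isolated, since \<open>h\<close> is not identically
  zero on the connected set \<open>S\<close>, and Riemann's theorem removes the singularity of the
  bounded quotient at each of them.\<close>

lemma bounded_quotient_holomorphic:
  fixes f h :: "complex \<Rightarrow> complex"
  assumes f: "f holomorphic_on S" and h: "h holomorphic_on S" and S: "open S" "connected S"
    and nz: "z1 \<in> S" "h z1 \<noteq> 0" and bd: "\<And>z. z \<in> S \<Longrightarrow> norm (f z) \<le> C * norm (h z)"
  obtains g where "g holomorphic_on S" "\<And>z. z \<in> S \<Longrightarrow> f z = g z * h z"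
proof -
  have local: "\<exists>r g. r > 0 \<and> ball z r \<subseteq> S \<and> g holomorphic_on ball z r \<and>
      (\<forall>w\<in>ball z r - {z}. h w \<noteq> 0 \<and> g w = f w / h w)" if z: "z \<in> S" for z
  proof -
    obtain r where r: "r > 0" "ball z r \<subseteq> S" "\<And>w. w \<in> ball z r - {z} \<Longrightarrow> h w \<noteq> 0"
      using punctured_ball_nonzero[OF h S nz z] by metis
    have "(\<exists>g. g holomorphic_on ball z r \<and> (\<forall>w\<in>ball z r - {z}. g w = f w / h w))"
    proof (subst holomorphic_on_extend_bounded)
      show "(\<lambda>w. f w / h w) holomorphic_on ball z r - {z}"
        using r by (intro holomorphic_intros holomorphic_on_subset[OF f] holomorphic_on_subset[OF h]) auto
      show "z \<in> interior (ball z r)" using r by simp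
      have "norm (f w / h w) \<le> C" if "w \<in> ball z r - {z}" for w
        using bd[of w] r(2) r(3)[OF that] that by (auto simp: norm_divide field_simps)
      then show "\<exists>B. \<forall>\<^sub>F w in at z. norm (f w / h w) \<le> B"
        by (intro exI[of _ C] eventually_mono[OF eventually_at_ball'[OF r(1), of z UNIV]])
          (auto simp: dist_commute)
    qed
    then show ?thesis using r by blast
  qed
  \<comment> \<open>The limit of the quotient refers to no chosen ball, so the local extensions
    glue.\<close>
  define g where "g z = Lim (at z) (\<lambda>w. f w / h w)" for z
  have g: "g w = g0 w" if "g0 holomorphic_on ball z r" "\<And>w. w \<in> ball z r - {z} \<Longrightarrow> h w \<noteq> 0 \<and> g0 w = f w / h w"
    "w \<in> ball z r" for g0 z r w
  proof -
    have "isCont g0 w"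
      using that holomorphic_on_imp_continuous_on continuous_on_eq_continuous_at by blast
    then have "g0 \<midarrow>w\<rightarrow> g0 w" by (simp add: isCont_def)
    \<comment> \<open>Putting \<open>w\<close> back into the punctured ball gives a neighbourhood of
      \<open>w\<close>, whether or not \<open>w = z\<close>, and away from \<open>w\<close> the
      extension \<open>g0\<close> equals the quotient on it.\<close>
    moreover have "open (ball z r - {z} \<union> {w})"
    proof (cases "w = z")
      case True
      then have "ball z r - {z} \<union> {w} = ball z r" using that by auto
      then show ?thesis by simp
    next
      case False
      then have "ball z r - {z} \<union> {w} = ball z r - {z}" using that by auto
      then show ?thesis by (simp add: open_delete)
    qed
    then have "\<forall>\<^sub>F x in at w. x \<in> ball z r - {z} \<union> {w} - {w}"
      by (intro eventually_at_in_open) auto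
    then have "\<forall>\<^sub>F x in at w. g0 x = f x / h x"
      by (rule eventually_mono) (use that(2) in auto)
    ultimately have "(\<lambda>w. f w / h w) \<midarrow>w\<rightarrow> g0 w"
      by (rule Lim_transform_eventually)
    then show ?thesis unfolding g_def by (simp add: tendsto_Lim)
  qed
  show ?thesis
  proof
    show "g holomorphic_on S"
      unfolding holomorphic_on_def
    proof
      fix z assume "z \<in> S"
      from local[OF this] obtain r g0 where r: "r > 0" "ball z r \<subseteq> S" "g0 holomorphic_on ball z r"
        "\<And>w. w \<in> ball z r - {z} \<Longrightarrow> h w \<noteq> 0 \<and> g0 w = f w / h w" by blast
      have "g holomorphic_on ball z r"
        using g[OF r(3) r(4)] by (intro holomorphic_transform[OF r(3)]) auto
      then show "g field_differentiable at z within S"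
        using r by (meson centre_in_ball field_differentiable_at_within holomorphic_on_imp_differentiable_at open_ball)
    qed
    have eq: "f w = g w * h w" if "w \<in> S" "h w \<noteq> 0" for w
    proof -
      from local[OF that(1)] obtain r g0 where r: "r > 0" "ball w r \<subseteq> S" "g0 holomorphic_on ball w r"
        "\<And>v. v \<in> ball w r - {w} \<Longrightarrow> h v \<noteq> 0 \<and> g0 v = f v / h v" by blast
      have "isCont f w" "isCont h w"
        using f h S that holomorphic_on_imp_continuous_on continuous_on_eq_continuous_at by blast+
      then have "((\<lambda>v. f v / h v) \<longlongrightarrow> f w / h w) (at w)"
        using that by (intro tendsto_intros) (auto simp: isCont_def)
      then show ?thesis using that unfolding g_def by (simp add: tendsto_Lim)
    qed
    \<comment> \<open>At a zero of \<open>h\<close> the bound forces \<open>f z = 0\<close>, so the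
      equation holds whatever the value of \<open>g\<close>.\<close>
    show "f z = g z * h z" if "z \<in> S" for z
      using eq[OF that] bd[OF that] by (cases "h z = 0") auto
  qed
qed

text \<open>Differentiation under the integral sign. The joint continuity of the derivative demanded
  by the Leibniz rule comes from \<open>continuous_on_deriv_parametric\<close>, with the integration
  variable as parameter.\<close>

lemma holomorphic_integral:
  fixes k :: "complex \<Rightarrow> 'b::euclidean_space \<Rightarrow> complex"
  assumes cont: "continuous_on (U \<times> cbox a b) (\<lambda>(z, x). k z x)" and U: "open U" "convex U"
    and hol: "\<And>x. x \<in> cbox a b \<Longrightarrow> (\<lambda>z. k z x) holomorphic_on U"
  shows "(\<lambda>z. integral (cbox a b) (k z)) holomorphic_on U"
proof (rule leibniz_rule_holomorphic[where fx = "\<lambda>z x. deriv (\<lambda>z. k z x) z"])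
  show "((\<lambda>z. k z x) has_field_derivative deriv (\<lambda>z. k z x) z) (at z within U)"
    if "z \<in> U" "x \<in> cbox a b" for z x
    using holomorphic_derivI[OF hol U(1)] that by (simp add: has_field_derivative_at_within)
  show "k z integrable_on cbox a b" if "z \<in> U" for z
  proof (rule integrable_continuous)
    have "continuous_on (cbox a b) ((\<lambda>(z, x). k z x) \<circ> (\<lambda>x. (z, x)))"
      by (intro continuous_on_compose continuous_intros continuous_on_subset[OF cont])
        (use that in auto)
    then show "continuous_on (cbox a b) (k z)" by (simp add: o_def)
  qed
  have "continuous_on (cbox a b \<times> U) ((\<lambda>(z, x). k z x) \<circ> prod.swap)"
    by (intro continuous_on_compose continuous_on_swap continuous_on_subset[OF cont]) auto
  then have "continuous_on (cbox a b \<times> U) (\<lambda>(x, z). deriv (\<lambda>z. k z x) z)"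
    by (intro continuous_on_deriv_parametric U hol) (auto simp: o_def case_prod_unfold prod.swap_def)
  then have "continuous_on (U \<times> cbox a b) ((\<lambda>(x, z). deriv (\<lambda>z. k z x) z) \<circ> prod.swap)"
    by (intro continuous_on_compose continuous_on_swap) (auto simp: product_swap)
  then show "continuous_on (U \<times> cbox a b) (\<lambda>(z, x). deriv (\<lambda>z. k z x) z)"
    by (simp add: o_def case_prod_unfold prod.swap_def)
qed (use U in auto)

text \<open>
  The quotient extends because, along a vertical disc whose boundary circle avoids the zeros of \<open>h\<close>,
  it is given by the Cauchy integral of its values on that circle.
\<close>

lemma bounded_quotient_extension:
  fixes a h :: "complex \<Rightarrow> complex \<Rightarrow> complex"
  assumes R: "0 < R"
    and ca: "continuous_on (ball 0 R \<times> ball 0 R) (\<lambda>(s, t). a s t)"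
    and ch: "continuous_on (ball 0 R \<times> ball 0 R) (\<lambda>(s, t). h s t)"
    and as: "\<And>t. t \<in> ball 0 R \<Longrightarrow> (\<lambda>s. a s t) holomorphic_on ball 0 R"
    and at: "\<And>s. s \<in> ball 0 R \<Longrightarrow> a s holomorphic_on ball 0 R"
    and hs: "\<And>t. t \<in> ball 0 R \<Longrightarrow> (\<lambda>s. h s t) holomorphic_on ball 0 R"
    and ht: "\<And>s. s \<in> ball 0 R \<Longrightarrow> h s holomorphic_on ball 0 R"
    and bd: "\<And>s t. s \<in> ball 0 R \<Longrightarrow> t \<in> ball 0 R \<Longrightarrow> norm (a s t) \<le> C * norm (h s t)"
    and nz: "t0 \<in> ball 0 R" "h 0 t0 \<noteq> 0"
  obtains \<delta> G where "0 < \<delta>" "\<delta> \<le> R"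
    "\<And>s t. s \<in> ball 0 \<delta> \<Longrightarrow> t \<in> ball 0 \<delta> \<Longrightarrow> a s t = G s t * h s t"
    "\<And>s t. s \<in> ball 0 \<delta> \<Longrightarrow> t \<in> ball 0 \<delta> \<Longrightarrow>
       \<exists>p q. ((\<lambda>(s, t). G s t) has_derivative (\<lambda>(u, v). p * u + q * v)) (at (s, t))"
proof -
  let ?B = "ball (0::complex) R"
  obtain r0 where r0: "r0 > 0" "ball 0 r0 \<subseteq> ?B" "\<And>w. w \<in> ball 0 r0 - {0} \<Longrightarrow> h 0 w \<noteq> 0"
    using punctured_ball_nonzero[of "h 0" ?B t0 0] ht nz R by auto
  define r where "r = r0/2"
  have r: "0 < r" "cball 0 r \<subseteq> ?B" "sphere 0 r \<subseteq> ?B"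
    using r0 by (auto simp: r_def subset_iff)
  have "r < R" using r0 R by (auto simp: r_def ball_subset_ball_iff)
  let ?W = "(?B \<times> ?B) \<inter> (\<lambda>(s, t). h s t) -` (- {0})"
  have "open ?W"
    by (intro continuous_open_preimage ch open_Times) auto
  moreover have "{0} \<times> sphere 0 r \<subseteq> ?W"
    using r r0 R by (auto simp: r_def)
  \<comment> \<open>The circle of radius \<open>r\<close> avoids the zeros of \<open>h 0\<close>; by
    compactness it avoids those of \<open>h s\<close> for all \<open>s\<close> near 0, so that a
    single contour serves all these slices.\<close>
  ultimately have "\<exists>X0. 0 \<in> X0 \<and> open X0 \<and> X0 \<times> sphere 0 r \<subseteq> ?W"
    by (rule Elementary_Topology.tube_lemma[OF compact_sphere])
  then obtain X0 where X0: "0 \<in> X0" "open X0" "X0 \<times> sphere 0 r \<subseteq> ?W" by (elim exE conjE)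
  then obtain d where d: "d > 0" "ball 0 d \<subseteq> X0" using open_contains_ball by blast
  define \<delta> where "\<delta> = min d r"
  have \<delta>: "0 < \<delta>" "\<delta> \<le> r" "\<delta> \<le> R" "ball 0 \<delta> \<subseteq> ?B"
    using d r \<open>r < R\<close> by (auto simp: \<delta>_def)
  have hnz: "h s t \<noteq> 0" if "s \<in> ball 0 \<delta>" "norm t = r" for s t
  proof -
    have "s \<in> ball 0 d" using that(1) by (simp add: \<delta>_def)
    then have "(s, t) \<in> X0 \<times> sphere 0 r" using that(2) d(2) by auto
    then have "(s, t) \<in> ?W" using X0(3) by (rule subsetD[rotated])
    then show ?thesis by simp
  qed
  define \<gamma> where "\<gamma> x = circlepath 0 r x" for x
  have n\<gamma>: "norm (\<gamma> x) = r" for x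
    using r by (simp add: \<gamma>_def circlepath norm_mult)
  have c\<gamma>: "continuous_on A \<gamma>" for A
    unfolding \<gamma>_def circlepath by (intro continuous_intros)
  have \<gamma>B: "\<gamma> x \<in> ?B" for x using n\<gamma> \<open>r < R\<close> by auto
  \<comment> \<open>Parametrising the circle by \<gamma> contributes the factor
    \<open>2 * pi * \<i> * \<gamma> x\<close>, which cancels the constant of Cauchy's formula;
    \<open>G\<close> is the Cauchy integral of the quotient.\<close>
  define k where "k s t x = a s (\<gamma> x) / h s (\<gamma> x) / (\<gamma> x - t) * \<gamma> x" for s t x
  define G where "G s t = integral (cbox 0 1) (k s t)" for s t
  let ?D = "ball (0::complex) \<delta>"
  have ne: "\<gamma> x \<noteq> t" if "t \<in> ?D" for x t
    using n\<gamma>[of x] that \<delta> by auto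
  have ck: "continuous_on ((?D \<times> ?D) \<times> cbox 0 1) (\<lambda>(p, x). k (fst p) (snd p) x)"
  proof -
    have "continuous_on ((?D \<times> ?D) \<times> cbox 0 1) (\<lambda>q. (\<lambda>(s, t). f s t) (fst (fst q), \<gamma> (snd q)))"
      if "continuous_on (?B \<times> ?B) (\<lambda>(s, t). f s t)" for f :: "complex \<Rightarrow> complex \<Rightarrow> complex"
      by (rule continuous_on_compose2[OF that])
        (use \<delta> \<gamma>B in \<open>auto intro!: continuous_intros continuous_on_compose2[OF c\<gamma>]\<close>)
    from this[OF ca] this[OF ch] show ?thesis
      unfolding k_def case_prod_unfold
      by (intro continuous_intros continuous_on_compose2[OF c\<gamma>])
        (use hnz n\<gamma> ne in \<open>auto simp: \<open>\<delta> \<le> R\<close>\<close>)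
  qed
  have cG: "continuous_on (?D \<times> ?D) (\<lambda>(s, t). G s t)"
    using integral_continuous_on_param[OF ck] by (simp add: G_def case_prod_unfold)
  have Gs: "(\<lambda>s. G s t) holomorphic_on ?D" if t: "t \<in> ?D" for t
    unfolding G_def
  proof (rule holomorphic_integral)
    have "continuous_on (?D \<times> cbox 0 1) (\<lambda>q. (\<lambda>(p, x). k (fst p) (snd p) x) ((fst q, t), snd q))"
      by (rule continuous_on_compose2[OF ck]) (use t in \<open>auto intro!: continuous_intros\<close>)
    then show "continuous_on (?D \<times> cbox 0 1) (\<lambda>(s, x). k s t x)"
      by (simp add: case_prod_unfold)
    show "(\<lambda>s. k s t x) holomorphic_on ?D" for x
      unfolding k_def
      by (intro holomorphic_intros holomorphic_on_subset[OF as[OF \<gamma>B]] holomorphic_on_subset[OF hs[OF \<gamma>B]])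
        (use \<delta> hnz n\<gamma> ne t in auto)
  qed auto
  have Gt: "G s holomorphic_on ?D" if s: "s \<in> ?D" for s
    unfolding G_def
  proof (rule holomorphic_integral)
    have "continuous_on (?D \<times> cbox 0 1) (\<lambda>q. (\<lambda>(p, x). k (fst p) (snd p) x) ((s, fst q), snd q))"
      by (rule continuous_on_compose2[OF ck]) (use s in \<open>auto intro!: continuous_intros\<close>)
    then show "continuous_on (?D \<times> cbox 0 1) (\<lambda>(t, x). k s t x)"
      by (simp add: case_prod_unfold)
    show "(\<lambda>t. k s t x) holomorphic_on ?D" for x
      unfolding k_def by (intro holomorphic_intros) (use hnz n\<gamma> ne s in auto)
  qed auto
  show ?thesis
  proof
    show "0 < \<delta>" "\<delta> \<le> R" by (fact \<delta>)+
    show "a s t = G s t * h s t" if s: "s \<in> ?D" and t: "t \<in> ?D" for s t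
    proof -
      have sB: "s \<in> ?B" using s \<delta> by auto
      \<comment> \<open>A point of the contour shows that \<open>h s\<close> is not identically
        zero, so the quotient extends on the slice to some \<open>g\<close>. Cauchy's formula then
        identifies \<open>G s t\<close> with \<open>g t\<close>, even though \<open>h s\<close> may
        have zeros inside the circle.\<close>
      have "complex_of_real r \<in> ?B" "h s (complex_of_real r) \<noteq> 0"
        using r(1) \<open>r < R\<close> hnz[OF s, of "complex_of_real r"] by auto
      from bounded_quotient_holomorphic[OF at[OF sB] ht[OF sB] open_ball connected_ball this bd[OF sB]]
      obtain g where g: "g holomorphic_on ?B" "\<And>z. z \<in> ?B \<Longrightarrow> a s z = g z * h s z" by blast
      have "((\<lambda>u. g u / (u - t)) has_contour_integral (2 * of_real pi * \<i> * g t)) (circlepath 0 r)"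
        by (rule Cauchy_integral_circlepath_simple[OF holomorphic_on_subset[OF g(1) r(2)]])
          (use t \<delta> in auto)
      then have "((\<lambda>x. g (\<gamma> x) / (\<gamma> x - t) * vector_derivative (circlepath 0 r) (at x within {0..1}))
          has_integral (2 * of_real pi * \<i> * g t)) {0..1}"
        by (simp add: has_contour_integral_def \<gamma>_def)
      then have "((\<lambda>x. 2 * of_real pi * \<i> * k s t x) has_integral (2 * of_real pi * \<i> * g t)) {0..1}"
      proof (rule has_integral_eq[rotated])
        fix x :: real assume x: "x \<in> {0..1}"
        have "g (\<gamma> x) = a s (\<gamma> x) / h s (\<gamma> x)"
          using g(2)[OF \<gamma>B] hnz[OF s n\<gamma>] by simp
        moreover have "vector_derivative (circlepath 0 r) (at x within {0..1}) = 2 * of_real pi * \<i> * \<gamma> x"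
          using vector_derivative_circlepath01[of x 0 r] x by (simp add: \<gamma>_def) (simp add: circlepath)
        ultimately show "g (\<gamma> x) / (\<gamma> x - t) * vector_derivative (circlepath 0 r) (at x within {0..1}) =
            2 * of_real pi * \<i> * k s t x"
          by (simp add: k_def)
      qed
      then have "((\<lambda>x. (2 * of_real pi * \<i>) * k s t x / (2 * of_real pi * \<i>)) has_integral
          (2 * of_real pi * \<i> * g t) / (2 * of_real pi * \<i>)) {0..1}"
        by (rule has_integral_divide)
      then have "(k s t has_integral g t) (cbox 0 1)" by simp
      then have "G s t = g t" unfolding G_def by (rule integral_unique)
      then show ?thesis using g(2)[of t] t \<delta> by auto
    qed
    show "\<exists>p q. ((\<lambda>(s, t). G s t) has_derivative (\<lambda>(u, v). p * u + q * v)) (at (s, t))"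
      if "s \<in> ?D" "t \<in> ?D" for s t
      using separately_holomorphic_has_derivative[OF cG _ _ _ Gs Gt that] by auto
  qed
qed

section \<open>Closure properties of holomorphic functions of several variables\<close>

lemma holo_on_subset: "holo_on A f \<Longrightarrow> B \<subseteq> A \<Longrightarrow> holo_on B f"
  unfolding holo_on_def by blast

lemma holo_on_imp_continuous_on:
  assumes "holo_on A f" shows "continuous_on A f"
  using assms unfolding holo_on_def
  by (meson has_derivative_continuous continuous_at_imp_continuous_on)

text \<open>Derivatives are taken in a full neighbourhood of each point, so agreement on a set
  transfers them only when that set is open.\<close>

lemma holo_on_transform:
  assumes f: "holo_on A f" and A: "open A" and eq: "\<And>z. z \<in> A \<Longrightarrow> f z = g z"
  shows "holo_on A g"
  unfolding holo_on_def
proof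
  fix z assume z: "z \<in> A"
  obtain D where D: "(f has_derivative D) (at z)" "\<forall>c v. D (c *s v) = c * D v"
    using f z unfolding holo_on_def by blast
  have "(g has_derivative D) (at z)"
    by (rule has_derivative_transform_within_open[OF D(1) A z eq])
  then show "\<exists>D. (g has_derivative D) (at z) \<and> (\<forall>c v. D (c *s v) = c * D v)"
    using D(2) by blast
qed

lemma holo_on_const: "holo_on A (\<lambda>_. c)"
  unfolding holo_on_def by (intro ballI exI[of _ "\<lambda>_. 0"]) auto

lemma holo_on_component: "holo_on A (\<lambda>z. z $ i)"
  unfolding holo_on_def
  by (intro ballI exI[of _ "\<lambda>v. v $ i"])
    (auto intro!: bounded_linear_imp_has_derivative bounded_linear_vec_nth)

lemma holo_on_add:
  assumes "holo_on A f" "holo_on A g" shows "holo_on A (\<lambda>z. f z + g z)"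
  unfolding holo_on_def
proof
  fix z assume z: "z \<in> A"
  obtain D E where D: "(f has_derivative D) (at z)" "\<forall>c v. D (c *s v) = c * D v"
    and E: "(g has_derivative E) (at z)" "\<forall>c v. E (c *s v) = c * E v"
    using assms z unfolding holo_on_def by blast
  then show "\<exists>D. ((\<lambda>z. f z + g z) has_derivative D) (at z) \<and> (\<forall>c v. D (c *s v) = c * D v)"
    by (intro exI[of _ "\<lambda>h. D h + E h"]) (auto intro!: derivative_intros simp: algebra_simps)
qed

lemma holo_on_mult:
  assumes "holo_on A f" "holo_on A g" shows "holo_on A (\<lambda>z. f z * g z)"
  unfolding holo_on_def
proof
  fix z assume z: "z \<in> A"
  obtain D E where D: "(f has_derivative D) (at z)" "\<forall>c v. D (c *s v) = c * D v"
    and E: "(g has_derivative E) (at z)" "\<forall>c v. E (c *s v) = c * E v"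
    using assms z unfolding holo_on_def by blast
  then show "\<exists>D. ((\<lambda>z. f z * g z) has_derivative D) (at z) \<and> (\<forall>c v. D (c *s v) = c * D v)"
    by (intro exI[of _ "\<lambda>h. f z * E h + D h * g z"]) (auto intro!: derivative_eq_intros simp: algebra_simps)
qed

lemma holo_on_inverse:
  assumes "holo_on A f" "\<And>z. z \<in> A \<Longrightarrow> f z \<noteq> 0" shows "holo_on A (\<lambda>z. inverse (f z))"
  unfolding holo_on_def
proof
  fix z assume z: "z \<in> A"
  obtain D where D: "(f has_derivative D) (at z)" "\<forall>c v. D (c *s v) = c * D v"
    using assms z unfolding holo_on_def by blast
  then show "\<exists>D. ((\<lambda>z. inverse (f z)) has_derivative D) (at z) \<and> (\<forall>c v. D (c *s v) = c * D v)"
    using Deriv.has_derivative_inverse[OF assms(2)[OF z] D(1)]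
    by (intro exI[of _ "\<lambda>h. - (inverse (f z) * D h * inverse (f z))"]) auto
qed

lemma holo_on_uminus: "holo_on A f \<Longrightarrow> holo_on A (\<lambda>z. - f z)"
  using holo_on_mult[OF holo_on_const[of A "-1"]] by simp

lemma holo_on_diff: "holo_on A f \<Longrightarrow> holo_on A g \<Longrightarrow> holo_on A (\<lambda>z. f z - g z)"
  using holo_on_add[OF _ holo_on_uminus] by fastforce

lemma holo_on_divide:
  "holo_on A f \<Longrightarrow> holo_on A g \<Longrightarrow> (\<And>z. z \<in> A \<Longrightarrow> g z \<noteq> 0) \<Longrightarrow> holo_on A (\<lambda>z. f z / g z)"
  unfolding divide_inverse by (rule holo_on_mult[OF _ holo_on_inverse])

lemma holo_on_sum:
  "(\<And>i. i \<in> I \<Longrightarrow> holo_on A (f i)) \<Longrightarrow> holo_on A (\<lambda>z. \<Sum>i\<in>I. f i z)"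
  by (induction I rule: infinite_finite_induct) (auto intro: holo_on_const holo_on_add)

lemmas holo_on_intros = holo_on_const holo_on_component holo_on_add holo_on_mult holo_on_uminus
  holo_on_diff holo_on_divide holo_on_sum

lemma has_derivative_vec_lambda:
  fixes f :: "'a::real_normed_vector \<Rightarrow> complex ^ 'n"
  assumes "\<And>i. ((\<lambda>z. f z $ i) has_derivative D i) (at z)"
  shows "(f has_derivative (\<lambda>h. \<chi> i. D i h)) (at z)"
  by (subst has_derivative_componentwise_within)
    (auto simp: Basis_vec_def inner_axis intro!: has_derivative_inner_left assms)

lemma holo_on_compose:
  fixes Q :: "complex ^ 'm \<Rightarrow> complex ^ 'n"
  assumes Q: "\<And>k. holo_on A (\<lambda>z. Q z $ k)" and f: "holo_on B f" and sub: "\<And>z. z \<in> A \<Longrightarrow> Q z \<in> B"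
  shows "holo_on A (\<lambda>z. f (Q z))"
  unfolding holo_on_def
proof
  fix z assume z: "z \<in> A"
  have "\<forall>k. \<exists>D. ((\<lambda>z. Q z $ k) has_derivative D) (at z) \<and> (\<forall>c v. D (c *s v) = c * D v)"
    using Q z unfolding holo_on_def by blast
  then obtain D where D: "\<And>k. ((\<lambda>z. Q z $ k) has_derivative D k) (at z)"
    "\<And>k c v. D k (c *s v) = c * D k v" by metis
  obtain E where E: "(f has_derivative E) (at (Q z))" "\<forall>c v. E (c *s v) = c * E v"
    using f sub[OF z] unfolding holo_on_def by blast
  have "((\<lambda>z. f (Q z)) has_derivative (\<lambda>h. E (\<chi> i. D i h))) (at z)"
    by (rule has_derivative_compose[OF has_derivative_vec_lambda[OF D(1)] E(1)])
  moreover have "(\<chi> i. D i (c *s v)) = c *s (\<chi> i. D i v)" for c v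
    by (simp add: D(2) vec_eq_iff)
  ultimately show "\<exists>D. ((\<lambda>z. f (Q z)) has_derivative D) (at z) \<and> (\<forall>c v. D (c *s v) = c * D v)"
    using E(2) by (intro exI[of _ "\<lambda>h. E (\<chi> i. D i h)"]) auto
qed

section \<open>Restriction to complex lines, identity theorem and connectedness\<close>

lemma has_derivative_complex_line:
  "((\<lambda>\<zeta>. p + \<zeta> *s (v :: complex ^ 'n)) has_derivative (\<lambda>h. h *s v)) (at \<zeta>)"
proof -
  have "((\<lambda>\<zeta>. p + \<zeta> *s v) has_derivative (\<lambda>h. \<chi> i. h * v $ i)) (at \<zeta>)"
    by (rule has_derivative_vec_lambda) (auto intro!: derivative_eq_intros)
  then show ?thesis by (simp add: vector_scalar_mult_def)
qed

lemma continuous_on_complex_line: "continuous_on A (\<lambda>\<zeta>. p + \<zeta> *s (v :: complex ^ 'n))"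
  by (intro continuous_at_imp_continuous_on ballI has_derivative_continuous[OF has_derivative_complex_line])

text \<open>Complex linearity turns \<open>D (h *s v)\<close> into \<open>h * D v\<close>, so
  \<open>D v\<close> is a complex derivative along the line. This reduces questions in several
  variables to function theory in the plane.\<close>

lemma holo_on_complex_line:
  assumes "holo_on A f" "\<And>\<zeta>. \<zeta> \<in> S \<Longrightarrow> p + \<zeta> *s v \<in> A"
  shows "(\<lambda>\<zeta>. f (p + \<zeta> *s v)) holomorphic_on S"
  unfolding holomorphic_on_def
proof
  fix \<zeta> assume "\<zeta> \<in> S"
  then obtain D where D: "(f has_derivative D) (at (p + \<zeta> *s v))" "\<forall>c v. D (c *s v) = c * D v"
    using assms unfolding holo_on_def by blast
  have "((\<lambda>\<zeta>. f (p + \<zeta> *s v)) has_derivative (\<lambda>h. D (h *s v))) (at \<zeta>)"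
    by (rule has_derivative_compose[OF has_derivative_complex_line D(1)])
  then have "((\<lambda>\<zeta>. f (p + \<zeta> *s v)) has_field_derivative D v) (at \<zeta>)"
    using D(2) by (simp add: has_field_derivative_def mult_commute_abs)
  then show "(\<lambda>\<zeta>. f (p + \<zeta> *s v)) field_differentiable at \<zeta> within S"
    using field_differentiable_at_within field_differentiable_def by blast
qed

text \<open>The slice of a ball by a complex line is thus a connected open set in the plane, as
  required for analytic continuation along the line.\<close>

lemma complex_line_preimage_ball:
  fixes v :: "complex ^ 'n"
  shows "open {\<zeta>. p + \<zeta> *s v \<in> ball c r}" "convex {\<zeta>. p + \<zeta> *s v \<in> ball c r}"
proof -
  have "{\<zeta>. p + \<zeta> *s v \<in> ball c r} = (\<lambda>\<zeta>. p + \<zeta> *s v) -` ball c r" by auto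
  then show "open {\<zeta>. p + \<zeta> *s v \<in> ball c r}"
    using continuous_on_complex_line[of UNIV] open_vimage[OF open_ball] by metis
  show "convex {\<zeta>. p + \<zeta> *s v \<in> ball c r}"
  proof (rule convexI)
    fix x y :: complex and u w :: real
    assume *: "x \<in> {\<zeta>. p + \<zeta> *s v \<in> ball c r}" "y \<in> {\<zeta>. p + \<zeta> *s v \<in> ball c r}"
      and u: "0 \<le> u" "0 \<le> w" "u + w = 1"
    have "u *\<^sub>R (p + x *s v) + w *\<^sub>R (p + y *s v) \<in> ball c r"
      using convexD[OF convex_ball, of _ c r] * u by blast
    moreover have "u *\<^sub>R (p + x *s v) + w *\<^sub>R (p + y *s v) = (u + w) *\<^sub>R p + (u *\<^sub>R x + w *\<^sub>R y) *s v"
      by (simp add: vec_eq_iff algebra_simps)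
    ultimately show "u *\<^sub>R x + w *\<^sub>R y \<in> {\<zeta>. p + \<zeta> *s v \<in> ball c r}"
      using u by simp
  qed
qed

text \<open>The complex line from a point \<open>p\<close> of \<open>U\<close> to \<open>q\<close>
  meets the ball in a connected set, and on it the function vanishes near the parameter 0;
  one-variable continuation carries this to the parameter 1.\<close>

lemma holo_on_ball_identity:
  fixes f :: "complex ^ 'n \<Rightarrow> complex"
  assumes f: "holo_on (ball c r) f" and U: "open U" "U \<noteq> {}" "U \<subseteq> ball c r"
    and 0: "\<And>z. z \<in> U \<Longrightarrow> f z = 0" and q: "q \<in> ball c r"
  shows "f q = 0"
proof -
  obtain p where p: "p \<in> U" using U by auto
  let ?R = "{\<zeta>. p + \<zeta> *s (q - p) \<in> ball c r}"
  let ?Z = "{\<zeta>. p + \<zeta> *s (q - p) \<in> U}"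
  have "?Z = (\<lambda>\<zeta>. p + \<zeta> *s (q - p)) -` U" by auto
  then have Z: "open ?Z" using continuous_on_complex_line[of UNIV] open_vimage[OF U(1)] by metis
  have "0 \<in> ?Z" using p by simp
  then have Z0: "?Z \<noteq> {}" by blast
  have "(\<lambda>\<zeta>. f (p + \<zeta> *s (q - p))) 1 = (\<lambda>_. 0) 1"
  proof (rule analytic_continuation_open[of ?Z ?R "\<lambda>\<zeta>. f (p + \<zeta> *s (q - p))" "\<lambda>_. 0" 1])
    show "connected ?R" by (intro convex_connected complex_line_preimage_ball)
    show "(\<lambda>\<zeta>. f (p + \<zeta> *s (q - p))) holomorphic_on ?R"
      by (rule holo_on_complex_line[OF f]) auto
  qed (use U 0 q Z Z0 complex_line_preimage_ball(1)[of p "q - p" c r] in auto)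
  then show ?thesis by simp
qed

text \<open>On the complex line through two points where \<open>f\<close> is nonzero,
  \<open>f\<close> has only countably many zeros in the ball, and removing a countable set from a
  connected open set in the plane leaves it connected.\<close>

lemma connected_nonzero_set:
  fixes f :: "complex ^ 'n \<Rightarrow> complex"
  assumes f: "holo_on (ball c r) f"
  shows "connected {z \<in> ball c r. f z \<noteq> 0}"
  unfolding connected_iff_connected_component
proof (intro ballI)
  let ?S = "{z \<in> ball c r. f z \<noteq> 0}"
  fix p q assume p: "p \<in> ?S" and q: "q \<in> ?S"
  let ?R = "{\<zeta>. p + \<zeta> *s (q - p) \<in> ball c r}"
  let ?g = "\<lambda>\<zeta>. f (p + \<zeta> *s (q - p))"
  have hol: "?g holomorphic_on ?R" by (rule holo_on_complex_line[OF f]) auto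
  have R: "open ?R" "connected ?R"
    by (intro complex_line_preimage_ball convex_connected)+
  have 0: "0 \<in> ?R" "?g 0 \<noteq> 0" "1 \<in> ?R" "?g 1 \<noteq> 0" using p q by auto
  have "countable {\<zeta> \<in> ?R. ?g \<zeta> = 0}"
  \<comment> \<open>Countability of the zeros is available for nonconstant functions; a constant one
    has no zeros here, its value at 0 being nonzero.\<close>
  proof (cases "?g constant_on ?R")
    case True
    then obtain k where k: "\<And>\<zeta>. \<zeta> \<in> ?R \<Longrightarrow> ?g \<zeta> = k" unfolding constant_on_def by blast
    have "?g \<zeta> \<noteq> 0" if "\<zeta> \<in> ?R" for \<zeta>
      using k[OF that] k[OF 0(1)] 0(2) by metis
    then have "{\<zeta> \<in> ?R. ?g \<zeta> = 0} = {}" by blast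
    then show ?thesis by (simp only: countable_empty)
  next
    case False
    obtain F :: "nat \<Rightarrow> complex set" where "\<And>n. compact (F n)" "(\<Union>n. F n) = ?R"
      using open_Union_compact_subsets[OF R(1)] by metis
    then have "fsigma ?R" unfolding fsigma_Union_compact by blast
    then show ?thesis by (intro holomorphic_countable_zeros hol R False)
  qed
  then have "connected (?R - {\<zeta> \<in> ?R. ?g \<zeta> = 0})"
    by (intro connected_open_diff_countable R) auto
  then have "connected ((\<lambda>\<zeta>. p + \<zeta> *s (q - p)) ` (?R - {\<zeta> \<in> ?R. ?g \<zeta> = 0}))" (is "connected ?C")
    by (intro connected_continuous_image continuous_on_complex_line)
  moreover have "?C \<subseteq> ?S" by auto
  moreover have "p \<in> ?C" by (rule image_eqI[of _ _ 0]) (use 0 in auto)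
  moreover have "q \<in> ?C" by (rule image_eqI[of _ _ 1]) (use 0 in auto)
  ultimately show "connected_component ?S p q"
    unfolding connected_component_def by blast
qed

lemma closure_nonzero_set:
  fixes f :: "complex ^ 'n \<Rightarrow> complex"
  assumes f: "holo_on (ball c r) f" and z0: "z0 \<in> ball c r" "f z0 \<noteq> 0"
  shows "ball c r \<subseteq> closure {z \<in> ball c r. f z \<noteq> 0}"
proof
  fix x assume x: "x \<in> ball c r"
  show "x \<in> closure {z \<in> ball c r. f z \<noteq> 0}"
    unfolding closure_iff_nhds_not_empty
  proof (intro allI impI)
    fix A U assume U: "U \<subseteq> A" "open U" "x \<in> U"
    have "\<exists>z\<in>U \<inter> ball c r. f z \<noteq> 0"
      using holo_on_ball_identity[OF f, of "U \<inter> ball c r" z0] U x z0 by fastforce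
    then show "{z \<in> ball c r. f z \<noteq> 0} \<inter> A \<noteq> {}" using U by blast
  qed
qed

text \<open>If \<open>f\<close> is not identically zero, the set lies between the connected set
  where \<open>f\<close> is nonzero and its closure, which contains the ball. Otherwise
  \<open>g\<close> takes the place of \<open>f\<close>, or the set is empty.\<close>

lemma connected_common_zero_complement:
  fixes f g :: "complex ^ 'n \<Rightarrow> complex"
  assumes f: "holo_on (ball c r) f" and g: "holo_on (ball c r) g"
  shows "connected {z \<in> ball c r. f z \<noteq> 0 \<or> g z \<noteq> 0}"
proof -
  have *: "connected {z \<in> ball c r. f z \<noteq> 0 \<or> g z \<noteq> 0}"
    if f: "holo_on (ball c r) f" and z0: "z0 \<in> ball c r" "f z0 \<noteq> 0"
    for f g :: "complex ^ 'n \<Rightarrow> complex" and z0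
    by (rule connected_intermediate_closure[OF connected_nonzero_set[OF f]])
      (use closure_nonzero_set[OF f z0] in auto)
  consider (f) z where "z \<in> ball c r" "f z \<noteq> 0" | (g) z where "z \<in> ball c r" "g z \<noteq> 0"
    | (n) "{z \<in> ball c r. f z \<noteq> 0 \<or> g z \<noteq> 0} = {}" by blast
  then show ?thesis
  proof cases
    case f then show ?thesis using *[OF assms(1)] by blast
  next
    case g
    then have "connected {z \<in> ball c r. g z \<noteq> 0 \<or> f z \<noteq> 0}" using *[OF assms(2)] by blast
    then show ?thesis by (simp add: disj_commute)
  next
    case n then show ?thesis by (simp only: connected_empty)
  qed
qed

text \<open>If \<open>S\<close> falls into two pieces, their closures cover the space by density. A
  common point of the closures would have a neighbourhood whose connected trace on \<open>S\<close>
  meets both pieces, so the closures separate the whole space.\<close>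

lemma connected_dense_subset:
  fixes S :: "'a::topological_space set"
  assumes conn: "connected (UNIV :: 'a set)" and S: "open S" "closure S = UNIV"
    and loc: "\<And>x. \<exists>N. open N \<and> x \<in> N \<and> connected (N \<inter> S)"
  shows "connected S"
proof (rule ccontr)
  assume "\<not> connected S"
  then obtain A B where AB: "open A" "open B" "A \<inter> S \<noteq> {}" "B \<inter> S \<noteq> {}" "A \<inter> B \<inter> S = {}" "S \<subseteq> A \<union> B"
    unfolding connected_def by blast
  have "closure (A \<inter> S) \<union> closure (B \<inter> S) = UNIV"
    using S AB by (metis closure_Un Int_Un_distrib2 inf.absorb_iff2)
  moreover have "closure (A \<inter> S) \<inter> closure (B \<inter> S) = {}"
  proof (rule ccontr)
    assume "closure (A \<inter> S) \<inter> closure (B \<inter> S) \<noteq> {}"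
    then obtain x where x: "x \<in> closure (A \<inter> S)" "x \<in> closure (B \<inter> S)" by blast
    obtain N where N: "open N" "x \<in> N" "connected (N \<inter> S)" using loc by blast
    have "N \<inter> (A \<inter> S) \<noteq> {}" "N \<inter> (B \<inter> S) \<noteq> {}"
      using x N open_Int_closure_eq_empty[OF N(1)] by (metis disjoint_iff)+
    then show False
      using N(3) AB unfolding connected_def by blast
  qed
  moreover have "closure (A \<inter> S) \<noteq> {}" "closure (B \<inter> S) \<noteq> {}" using AB by (simp_all add: closure_eq_empty)
  ultimately show False
    using conn unfolding connected_closed by (metis Int_UNIV_right closed_closure order_refl)
qed

text \<open>
  Coordinates are chosen so that \<open>h\<close> does not vanish identically on the line through \<open>x\<close> and a point \<open>y\<close> at which \<open>h\<close> is nonzero.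
\<close>

lemma bounded_quotient_extension_vec:
  fixes f h :: "complex ^ 2 \<Rightarrow> complex"
  assumes W: "open W" "x \<in> W" and f: "holo_on W f" and h: "holo_on W h"
    and bd: "\<And>z. z \<in> W \<Longrightarrow> norm (f z) \<le> C * norm (h z)"
    and nz: "\<And>N. open N \<Longrightarrow> x \<in> N \<Longrightarrow> N \<subseteq> W \<Longrightarrow> \<exists>y\<in>N. h y \<noteq> 0"
  obtains N G where "open N" "x \<in> N" "N \<subseteq> W" "holo_on N G" "\<And>z. z \<in> N \<Longrightarrow> f z = G z * h z"
proof -
  obtain R0 where R0: "R0 > 0" "ball x R0 \<subseteq> W" using W open_contains_ball by blast
  obtain y0 where y0: "y0 \<in> ball x R0" "h y0 \<noteq> 0" using nz[of "ball x R0"] R0 by auto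
  \<comment> \<open>The direction from \<open>x\<close> to \<open>y\<close> must be independent of
    the second axis. If this failed for every admissible \<open>y\<close>, the function
    \<open>z $ 1 - x $ 1\<close> would vanish on the nonempty open set where \<open>h\<close> is
    nonzero, hence on the whole ball.\<close>
  have "\<exists>y\<in>ball x R0. h y \<noteq> 0 \<and> y $ 1 \<noteq> x $ 1"
  proof (rule ccontr)
    assume neg: "\<not> ?thesis"
    define e where "e = R0/2"
    let ?U = "ball x R0 \<inter> h -` (- {0})"
    have "(x + axis 1 (of_real e)) $ 1 - x $ 1 = 0"
    proof (rule holo_on_ball_identity[of x R0 "\<lambda>z. z $ 1 - x $ 1" ?U])
      show "open ?U"
        by (intro continuous_open_preimage holo_on_imp_continuous_on holo_on_subset[OF h R0(2)]) auto
      show "x + axis 1 (of_real e) \<in> ball x R0"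
        using R0 by (simp add: dist_norm norm_vec_def L2_set_def sum_2 axis_def e_def)
      show "holo_on (ball x R0) (\<lambda>z. z $ 1 - x $ 1)" by (intro holo_on_intros)
    qed (use neg y0 in auto)
    then show False using R0 by (simp add: e_def)
  qed
  then obtain y where y: "y \<in> ball x R0" "h y \<noteq> 0" "y $ 1 \<noteq> x $ 1" by blast
  define v where "v = y - x"
  have v1: "v $ 1 \<noteq> 0" using y by (simp add: v_def)
  \<comment> \<open>Affine coordinates with \<open>t\<close> along \<open>v\<close>:
    \<open>h (T 0 t)\<close> is then not identically zero, which is the nondegeneracy that the
    extension theorem asks for.\<close>
  define T :: "complex \<Rightarrow> complex \<Rightarrow> complex ^ 2" where "T s t = x + t *s v + s *s axis 2 1" for s t
  have cT: "continuous_on A (\<lambda>p. T (fst p) (snd p))" for A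
    by (subst continuous_on_componentwise)
      (auto simp: T_def Basis_vec_def inner_axis inner_add_left intro!: continuous_intros)
  have "open ((\<lambda>p. T (fst p) (snd p)) -` ball x R0)"
    by (intro open_vimage open_ball cT)
  moreover have "(0, 0) \<in> (\<lambda>p. T (fst p) (snd p)) -` ball x R0"
    using R0 by (simp add: T_def)
  ultimately obtain A B where AB0: "open A" "open B" "(0, 0) \<in> A \<times> B"
    and AB: "A \<times> B \<subseteq> (\<lambda>p. T (fst p) (snd p)) -` ball x R0"
    by (rule open_prod_elim)
  have "open (A \<inter> B)" "0 \<in> A \<inter> B" using AB0 by auto
  then obtain R where R: "R > 0" "ball 0 R \<subseteq> A \<inter> B" using open_contains_ball by blast
  have TW: "T s t \<in> W" if "s \<in> ball 0 R" "t \<in> ball 0 R" for s t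
  proof -
    have "s \<in> A \<inter> B" "t \<in> A \<inter> B" using that R(2) by (simp_all only: subsetD)
    then have "(s, t) \<in> A \<times> B" by simp
    with AB have "(s, t) \<in> (\<lambda>p. T (fst p) (snd p)) -` ball x R0" by (rule subsetD)
    then have "T s t \<in> ball x R0" by simp
    with R0(2) show ?thesis by (rule subsetD)
  qed
  have ct: "continuous_on (ball 0 R \<times> ball 0 R) (\<lambda>(s, t). k (T s t))" if "holo_on W k" for k
    unfolding case_prod_unfold
    by (rule continuous_on_compose2[OF holo_on_imp_continuous_on[OF that] cT]) (auto simp: TW)
  have hs: "(\<lambda>s. k (T s t)) holomorphic_on ball 0 R" if "holo_on W k" "t \<in> ball 0 R" for k t
    unfolding T_def by (rule holo_on_complex_line[OF that(1)]) (use TW that(2) T_def in auto)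
  have ht: "(\<lambda>t. k (T s t)) holomorphic_on ball 0 R" if "holo_on W k" "s \<in> ball 0 R" for k s
  proof -
    have eq: "T s t = (x + s *s axis 2 1) + t *s v" for t by (simp add: T_def)
    show ?thesis
      unfolding eq by (rule holo_on_complex_line[OF that(1)]) (use TW[OF that(2)] in \<open>simp only: eq[symmetric]\<close>)
  qed
  obtain t0 where t0: "t0 \<in> ball 0 R" "h (T 0 t0) \<noteq> 0"
  proof -
    let ?R = "{\<zeta>. x + \<zeta> *s v \<in> ball x R0}"
    have hol: "(\<lambda>\<zeta>. h (x + \<zeta> *s v)) holomorphic_on ?R"
      by (rule holo_on_complex_line[OF h]) (use R0 in auto)
    have 1: "1 \<in> ?R" "h (x + 1 *s v) \<noteq> 0" and 0: "0 \<in> ?R" using y R0 by (auto simp: v_def)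
    obtain r where r: "r > 0" "ball 0 r \<subseteq> ?R" "\<And>w. w \<in> ball 0 r - {0} \<Longrightarrow> h (x + w *s v) \<noteq> 0"
      by (rule punctured_ball_nonzero[OF hol complex_line_preimage_ball(1)
            convex_connected[OF complex_line_preimage_ball(2)] 1 0]) (rule that)
    define \<rho> where "\<rho> = min r R / 2"
    have "0 < \<rho>" "\<rho> < r" "\<rho> < R" using r(1) R(1) by (auto simp: \<rho>_def min_def)
    then show ?thesis
      using r(3)[of "of_real \<rho>"] by (intro that[of "of_real \<rho>"]) (auto simp: T_def)
  qed
  obtain \<delta> G where \<delta>: "0 < \<delta>" "\<delta> \<le> R"
    and G: "\<And>s t. s \<in> ball 0 \<delta> \<Longrightarrow> t \<in> ball 0 \<delta> \<Longrightarrow> f (T s t) = G s t * h (T s t)"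
    and dG: "\<And>s t. s \<in> ball 0 \<delta> \<Longrightarrow> t \<in> ball 0 \<delta> \<Longrightarrow>
       \<exists>p q. ((\<lambda>(s, t). G s t) has_derivative (\<lambda>(u, v). p * u + q * v)) (at (s, t))"
    using bounded_quotient_extension[of R "\<lambda>s t. f (T s t)" "\<lambda>s t. h (T s t)" C t0,
        OF R(1) ct[OF f] ct[OF h] hs[OF f] ht[OF f] hs[OF h] ht[OF h] bd[OF TW] t0] by blast
  \<comment> \<open>The inverse of \<open>T\<close>: the second axis does not affect the first
    coordinate, which therefore determines \<open>t\<close>, and then \<open>s\<close> is read off
    from the second.\<close>
  define \<tau> where "\<tau> z = (z $ 1 - x $ 1) / v $ 1" for z :: "complex ^ 2"
  define \<sigma> where "\<sigma> z = z $ 2 - x $ 2 - \<tau> z * v $ 2" for z :: "complex ^ 2"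
  have hol: "holo_on UNIV \<tau>" "holo_on UNIV \<sigma>"
    unfolding \<sigma>_def \<tau>_def using v1 by (auto intro!: holo_on_intros)
  have T: "T (\<sigma> z) (\<tau> z) = z" for z
    using v1 by (simp add: T_def vec_eq_iff forall_2 \<sigma>_def \<tau>_def axis_def)
  define N where "N = \<sigma> -` ball 0 \<delta> \<inter> \<tau> -` ball 0 \<delta>"
  show ?thesis
  proof
    show "open N"
      unfolding N_def by (intro open_Int open_vimage open_ball holo_on_imp_continuous_on hol)
    show "x \<in> N" using \<delta> by (simp add: N_def \<sigma>_def \<tau>_def)
    show "N \<subseteq> W"
    proof
      fix z assume "z \<in> N"
      then have "T (\<sigma> z) (\<tau> z) \<in> W" using \<delta> by (intro TW) (auto simp: N_def)
      then show "z \<in> W" by (simp add: T)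
    qed
    show "f z = G (\<sigma> z) (\<tau> z) * h z" if "z \<in> N" for z
      using G[of "\<sigma> z" "\<tau> z"] that by (simp add: N_def T)
    show "holo_on N (\<lambda>z. G (\<sigma> z) (\<tau> z))"
      unfolding holo_on_def
    proof
      fix z assume z: "z \<in> N"
      obtain D E where D: "(\<sigma> has_derivative D) (at z)" "\<forall>c v. D (c *s v) = c * D v"
        and E: "(\<tau> has_derivative E) (at z)" "\<forall>c v. E (c *s v) = c * E v"
        using hol unfolding holo_on_def by blast
      obtain p q where "((\<lambda>(s, t). G s t) has_derivative (\<lambda>(u, v). p * u + q * v)) (at (\<sigma> z, \<tau> z))"
        using dG[of "\<sigma> z" "\<tau> z"] z by (auto simp: N_def)
      from has_derivative_compose[OF has_derivative_Pair[OF D(1) E(1)] this]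
      show "\<exists>D. ((\<lambda>z. G (\<sigma> z) (\<tau> z)) has_derivative D) (at z) \<and> (\<forall>c v. D (c *s v) = c * D v)"
        using D(2) E(2) by (intro exI[of _ "\<lambda>h. p * D h + q * E h"]) (simp add: algebra_simps)
    qed
  qed
qed

section \<open>Charts and trivializations\<close>

lemma complex_manifold_chart:
  assumes "complex_manifold X" "(U, \<phi>) \<in> X"
  shows "open U" "homeomorphism U (\<phi> ` U) \<phi> (inv_into U \<phi>)" "open (\<phi> ` U)" "inj_on \<phi> U"
proof -
  show "open U" and hom: "homeomorphism U (\<phi> ` U) \<phi> (inv_into U \<phi>)" and "open (\<phi> ` U)"
    using assms unfolding complex_manifold_def by auto
  show "inj_on \<phi> U"
    using hom unfolding homeomorphism_def by (metis inj_on_inverseI)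
qed

lemma complex_manifold_chart_image:
  assumes "complex_manifold X" "(U, \<phi>) \<in> X" "open W" "W \<subseteq> U"
  shows "open (\<phi> ` W)"
proof -
  note c = complex_manifold_chart[OF assms(1,2)]
  have "openin (top_of_set U) W" using assms c by (simp add: openin_open_eq)
  then have "openin (top_of_set (\<phi> ` U)) (\<phi> ` W)"
    using homeomorphism_imp_open_map[OF c(2)] by blast
  then show ?thesis using c(3) openin_open_eq by blast
qed

lemma complex_manifold_covered:
  assumes "complex_manifold X" obtains U \<phi> where "(U, \<phi>) \<in> X" "x \<in> U"
  using assms unfolding complex_manifold_def by (metis (no_types) UNIV_I UN_iff prod.collapse)

section \<open>Holomorphic functions on a manifold\<close>

lemma holo_fun_subset: "holo_fun X W h \<Longrightarrow> W' \<subseteq> W \<Longrightarrow> holo_fun X W' h"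
  unfolding holo_fun_def by (blast intro: holo_on_subset)

lemma holo_fun_chartD: "holo_fun X W h \<Longrightarrow> (U, \<phi>) \<in> X \<Longrightarrow> holo_on (\<phi> ` (U \<inter> W)) (h \<circ> inv_into U \<phi>)"
  unfolding holo_fun_def by auto

lemma holo_fun_const: "holo_fun X W (\<lambda>_. c)"
  unfolding holo_fun_def by (auto simp: o_def intro: holo_on_intros)

lemma holo_fun_add: "holo_fun X W f \<Longrightarrow> holo_fun X W g \<Longrightarrow> holo_fun X W (\<lambda>x. f x + g x)"
  unfolding holo_fun_def by (fastforce simp: o_def intro: holo_on_intros)

lemma holo_fun_mult: "holo_fun X W f \<Longrightarrow> holo_fun X W g \<Longrightarrow> holo_fun X W (\<lambda>x. f x * g x)"
  unfolding holo_fun_def by (fastforce simp: o_def intro: holo_on_intros)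

lemma holo_fun_uminus: "holo_fun X W f \<Longrightarrow> holo_fun X W (\<lambda>x. - f x)"
  unfolding holo_fun_def by (fastforce simp: o_def intro: holo_on_intros)

lemma holo_fun_diff: "holo_fun X W f \<Longrightarrow> holo_fun X W g \<Longrightarrow> holo_fun X W (\<lambda>x. f x - g x)"
  unfolding holo_fun_def by (fastforce simp: o_def intro: holo_on_intros)

lemma holo_fun_sum:
  "(\<And>i. i \<in> I \<Longrightarrow> holo_fun X W (f i)) \<Longrightarrow> holo_fun X W (\<lambda>x. \<Sum>i\<in>I. f i x)"
  by (induction I rule: infinite_finite_induct) (auto intro: holo_fun_const holo_fun_add)

lemmas holo_fun_intros = holo_fun_const holo_fun_add holo_fun_mult holo_fun_uminus holo_fun_diff
  holo_fun_sum

lemma holo_fun_transform: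
  assumes X: "complex_manifold X" and f: "holo_fun X W f" and W: "open W"
    and eq: "\<And>x. x \<in> W \<Longrightarrow> f x = g x"
  shows "holo_fun X W g"
  unfolding holo_fun_def
proof clarify
  fix U \<phi> assume c: "(U, \<phi>) \<in> X"
  note ch = complex_manifold_chart[OF X c]
  show "holo_on (\<phi> ` (U \<inter> W)) (g \<circ> inv_into U \<phi>)"
  proof (rule holo_on_transform)
    show "holo_on (\<phi> ` (U \<inter> W)) (f \<circ> inv_into U \<phi>)" using f c unfolding holo_fun_def by auto
    show "open (\<phi> ` (U \<inter> W))" by (rule complex_manifold_chart_image[OF X c]) (use ch W in auto)
  qed (use ch eq in auto)
qed

lemma holo_fun_imp_continuous_on:
  assumes X: "complex_manifold X" and h: "holo_fun X W h" and W: "open W"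
  shows "continuous_on W h"
proof (rule continuous_at_imp_continuous_on, rule ballI)
  fix x assume x: "x \<in> W"
  obtain U \<phi> where c: "(U, \<phi>) \<in> X" "x \<in> U" using complex_manifold_covered[OF X] .
  note ch = complex_manifold_chart[OF X c(1)]
  have "continuous_on (\<phi> ` (U \<inter> W)) (h \<circ> inv_into U \<phi>)"
    by (rule holo_on_imp_continuous_on[OF holo_fun_chartD[OF h c(1)]])
  moreover have "continuous_on (U \<inter> W) \<phi>"
    using ch(2) unfolding homeomorphism_def by (auto intro: continuous_on_subset)
  ultimately have "continuous_on (U \<inter> W) ((h \<circ> inv_into U \<phi>) \<circ> \<phi>)"
    by (rule continuous_on_compose[rotated])
  then have "continuous_on (U \<inter> W) h"
    by (rule continuous_on_eq) (use ch(4) in auto)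
  then show "isCont h x"
    using x c ch W by (simp add: continuous_on_eq_continuous_at open_Int)
qed

text \<open>Transition maps are holomorphic, so one chart suffices. This turns a quotient
  constructed in a single chart into a holomorphic function on the manifold.\<close>

lemma holo_fun_chartI:
  assumes X: "complex_manifold X" and c: "(U, \<phi>) \<in> X" and N: "open N" "N \<subseteq> U"
    and h: "holo_on (\<phi> ` N) (h \<circ> inv_into U \<phi>)"
  shows "holo_fun X N h"
  unfolding holo_fun_def
proof clarify
  fix U' \<psi> assume d: "(U', \<psi>) \<in> X"
  note ch = complex_manifold_chart[OF X c] and dh = complex_manifold_chart[OF X d]
  have "holo_on (\<psi> ` (U' \<inter> U)) (\<lambda>z. transition (U', \<psi>) (U, \<phi>) z $ k)" for k
    using X c d unfolding complex_manifold_def by fastforce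
  then have tr: "holo_on (\<psi> ` (U' \<inter> N)) (\<lambda>z. transition (U', \<psi>) (U, \<phi>) z $ k)" for k
    by (rule holo_on_subset) (use N in auto)
  show "holo_on (\<psi> ` (U' \<inter> N)) (h \<circ> inv_into U' \<psi>)"
  proof (rule holo_on_transform)
    show "holo_on (\<psi> ` (U' \<inter> N)) (\<lambda>z. (h \<circ> inv_into U \<phi>) (transition (U', \<psi>) (U, \<phi>) z))"
      by (rule holo_on_compose[OF tr h]) (use dh in \<open>auto simp: transition_def\<close>)
    show "open (\<psi> ` (U' \<inter> N))" by (rule complex_manifold_chart_image[OF X d]) (use N dh in auto)
  qed (use dh ch N in \<open>auto simp: transition_def subset_iff\<close>)
qed

section \<open>Vectors, sections and lines in fibre coordinates\<close>

definition fibre_vec :: "('a, 'e, 'r :: finite) vbundle \<Rightarrow> ('e \<Rightarrow> complex ^ 'r) \<Rightarrow> 'a \<Rightarrow> complex ^ 'r \<Rightarrow> 'e" where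
  "fibre_vec B \<tau> x w = inv_into {e. proj B e = x} \<tau> w"

context
  fixes X :: "('a :: {t2_space, second_countable_topology}, 'n :: finite) atlas"
    and B :: "('a, 'e, 'r :: finite) vbundle"
  assumes X: "complex_manifold X" and B: "holo_vector_bundle X B"
begin

lemma triv_covered: obtains V \<tau> where "(V, \<tau>) \<in> trivs B" "x \<in> V"
  using B unfolding holo_vector_bundle_def by (metis (no_types) UNIV_I UN_iff prod.collapse)

lemma triv_open: "(V, \<tau>) \<in> trivs B \<Longrightarrow> open V"
  using B unfolding holo_vector_bundle_def by auto

lemma triv_bij: "(V, \<tau>) \<in> trivs B \<Longrightarrow> x \<in> V \<Longrightarrow> bij_betw \<tau> {e. proj B e = x} UNIV"
  using B unfolding holo_vector_bundle_def by auto

lemma triv_inj: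
  "(V, \<tau>) \<in> trivs B \<Longrightarrow> proj B e \<in> V \<Longrightarrow> proj B e' = proj B e \<Longrightarrow> \<tau> e' = \<tau> e \<Longrightarrow> e' = e"
  using triv_bij[of V \<tau> "proj B e"] unfolding bij_betw_def inj_on_def by auto

lemma fibre_vec:
  assumes "(V, \<tau>) \<in> trivs B" "x \<in> V"
  shows "proj B (fibre_vec B \<tau> x w) = x" "\<tau> (fibre_vec B \<tau> x w) = w"
proof -
  have "w \<in> \<tau> ` {e. proj B e = x}" using triv_bij[OF assms] by (simp add: bij_betw_def)
  then show "proj B (fibre_vec B \<tau> x w) = x" "\<tau> (fibre_vec B \<tau> x w) = w"
    unfolding fibre_vec_def using inv_into_into[of w \<tau> "{e. proj B e = x}"] by (auto simp: f_inv_into_f)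
qed

lemma triv_transition:
  assumes "(V, \<tau>) \<in> trivs B" "(V', \<tau>') \<in> trivs B"
  obtains g :: "'a \<Rightarrow> complex ^ 'r ^ 'r" where "\<And>i j. holo_fun X (V \<inter> V') (\<lambda>x. g x $ i $ j)"
    "\<And>e. proj B e \<in> V \<inter> V' \<Longrightarrow> \<tau>' e = g (proj B e) *v \<tau> e"
  using B assms unfolding holo_vector_bundle_def by fast

text \<open>The definite description in the definition is justified: the vector built in one
  trivialization has the right coordinates in every other one, because transition maps are linear on
  fibres.\<close>

lemma vb_scale:
  shows "proj B (vb_scale B c e) = proj B e"
    and "(V, \<tau>) \<in> trivs B \<Longrightarrow> proj B e \<in> V \<Longrightarrow> \<tau> (vb_scale B c e) = c *s \<tau> e"
proof -
  obtain V0 \<tau>0 where t0: "(V0, \<tau>0) \<in> trivs B" "proj B e \<in> V0" by (rule triv_covered)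
  define e' where "e' = fibre_vec B \<tau>0 (proj B e) (c *s \<tau>0 e)"
  have e': "proj B e' = proj B e" "\<tau>0 e' = c *s \<tau>0 e" using fibre_vec[OF t0] by (auto simp: e'_def)
  have all: "\<tau> e' = c *s \<tau> e" if t: "(V, \<tau>) \<in> trivs B" "proj B e \<in> V" for V \<tau>
  proof -
    obtain g where g: "\<And>e. proj B e \<in> V0 \<inter> V \<Longrightarrow> \<tau> e = g (proj B e) *v \<tau>0 e"
      using triv_transition[OF t0(1) t(1)] by metis
    show ?thesis using g[of e] g[of e'] e' t0 t
      by (simp add: vec.scale)
  qed
  have "proj B (vb_scale B c e) = proj B e \<and>
     (\<forall>(V, \<tau>)\<in>trivs B. proj B e \<in> V \<longrightarrow> \<tau> (vb_scale B c e) = c *s \<tau> e)"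
    unfolding vb_scale_def
  proof (rule theI[of _ e'])
    show "proj B e' = proj B e \<and> (\<forall>(V, \<tau>)\<in>trivs B. proj B e \<in> V \<longrightarrow> \<tau> e' = c *s \<tau> e)"
      using e' all by blast
    fix y assume "proj B y = proj B e \<and> (\<forall>(V, \<tau>)\<in>trivs B. proj B e \<in> V \<longrightarrow> \<tau> y = c *s \<tau> e)"
    then have "proj B y = proj B e'" "\<tau>0 y = \<tau>0 e'" using e' t0 by auto
    then show "y = e'" using triv_inj[OF t0(1)] t0(2) e' by metis
  qed
  then show "proj B (vb_scale B c e) = proj B e"
    and "(V, \<tau>) \<in> trivs B \<Longrightarrow> proj B e \<in> V \<Longrightarrow> \<tau> (vb_scale B c e) = c *s \<tau> e" by auto
qed

lemma vb_is_zero_iff: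
  assumes t: "(V, \<tau>) \<in> trivs B" "proj B e \<in> V"
  shows "vb_is_zero B e \<longleftrightarrow> \<tau> e = 0"
proof
  show "vb_is_zero B e \<Longrightarrow> \<tau> e = 0" using t unfolding vb_is_zero_def by auto
  assume 0: "\<tau> e = 0"
  show "vb_is_zero B e"
    unfolding vb_is_zero_def
  proof clarify
    fix V' \<tau>' assume t': "(V', \<tau>') \<in> trivs B" "proj B e \<in> V'"
    obtain g where "\<And>e. proj B e \<in> V \<inter> V' \<Longrightarrow> \<tau>' e = g (proj B e) *v \<tau> e"
      using triv_transition[OF t(1) t'(1)] by metis
    then show "\<tau>' e = 0" using 0 t t' by simp
  qed
qed

lemma holo_section_fibre_vec:
  assumes t: "(V, \<tau>) \<in> trivs B" and N: "open N" "N \<subseteq> V" and w: "\<And>i. holo_fun X N (\<lambda>x. w x $ i)"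
  shows "holo_section X B N (\<lambda>x. fibre_vec B \<tau> x (w x))"
  unfolding holo_section_def
proof (intro conjI ballI, goal_cases)
  case (1 x) then show ?case using fibre_vec(1)[OF t] N by auto
next
  case (2 t')
  obtain V' \<tau>' where t': "t' = (V', \<tau>')" "(V', \<tau>') \<in> trivs B" using 2 by (metis surj_pair)
  obtain g where g: "\<And>i j. holo_fun X (V \<inter> V') (\<lambda>x. g x $ i $ j)"
    "\<And>e. proj B e \<in> V \<inter> V' \<Longrightarrow> \<tau>' e = g (proj B e) *v \<tau> e"
    by (rule triv_transition[OF t t'(2)]) (rule that)
  have "holo_fun X (V' \<inter> N) (\<lambda>x. \<tau>' (fibre_vec B \<tau> x (w x)) $ i)" for i
  proof (rule holo_fun_transform[OF X])
    show "holo_fun X (V' \<inter> N) (\<lambda>x. \<Sum>j\<in>UNIV. g x $ i $ j * w x $ j)"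
      using N by (intro holo_fun_intros holo_fun_subset[OF w] holo_fun_subset[OF g(1)]) auto
    show "open (V' \<inter> N)" using triv_open[OF t'(2)] N by blast
    fix x assume x: "x \<in> V' \<inter> N"
    then have xV: "x \<in> V" using N by blast
    note f = fibre_vec[OF t xV, of "w x"]
    show "(\<Sum>j\<in>UNIV. g x $ i $ j * w x $ j) = \<tau>' (fibre_vec B \<tau> x (w x)) $ i"
      using g(2)[of "fibre_vec B \<tau> x (w x)"] f x xV by (simp add: matrix_vector_mult_def)
  qed
  then show ?case using t' by simp
qed

text \<open>Coefficients of a linear form change by the transposed transition matrix, whose entries
  are holomorphic, so holomorphy in one trivialization is enough.\<close>

lemma dual_section_coords:
  assumes t: "(V, \<tau>) \<in> trivs B" and N: "open N" "N \<subseteq> V" and a: "\<And>i. holo_fun X N (\<lambda>x. a x $ i)"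
  shows "dual_section X B N (\<lambda>e. \<Sum>i\<in>UNIV. a (proj B e) $ i * \<tau> e $ i)"
  unfolding dual_section_def
proof clarify
  fix V' \<tau>' assume t': "(V', \<tau>') \<in> trivs B"
  obtain g where g: "\<And>i j. holo_fun X (V' \<inter> V) (\<lambda>x. g x $ i $ j)"
    "\<And>e. proj B e \<in> V' \<inter> V \<Longrightarrow> \<tau> e = g (proj B e) *v \<tau>' e"
    by (rule triv_transition[OF t' t]) (rule that)
  let ?a = "\<lambda>x. \<chi> j. \<Sum>i\<in>UNIV. a x $ i * g x $ i $ j"
  have "holo_fun X (N \<inter> V') (\<lambda>x. ?a x $ j)" for j
    using N by (simp, intro holo_fun_intros holo_fun_subset[OF a] holo_fun_subset[OF g(1)]) auto
  moreover have "(\<Sum>i\<in>UNIV. a (proj B e) $ i * \<tau> e $ i) = (\<Sum>i\<in>UNIV. ?a (proj B e) $ i * \<tau>' e $ i)"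
    if "proj B e \<in> N \<inter> V'" for e
  proof -
    have "(\<Sum>i\<in>UNIV. a (proj B e) $ i * \<tau> e $ i) =
        (\<Sum>i\<in>UNIV. \<Sum>j\<in>UNIV. a (proj B e) $ i * g (proj B e) $ i $ j * \<tau>' e $ j)"
      using g(2)[of e] that N by (auto simp: matrix_vector_mult_def sum_distrib_left mult.assoc)
    also have "\<dots> = (\<Sum>j\<in>UNIV. ?a (proj B e) $ j * \<tau>' e $ j)"
      by (subst sum.swap) (simp add: sum_distrib_right)
    finally show ?thesis .
  qed
  ultimately show "\<exists>a'. (\<forall>i. holo_fun X (N \<inter> V') (\<lambda>x. a' x $ i)) \<and>
      (\<forall>e. proj B e \<in> N \<inter> V' \<longrightarrow> (\<Sum>i\<in>UNIV. a (proj B e) $ i * \<tau> e $ i) = (\<Sum>i\<in>UNIV. a' (proj B e) $ i * \<tau>' e $ i))"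
    by (intro exI[of _ ?a]) blast
qed

lemma line_of_eq:
  assumes "(V, \<tau>) \<in> trivs B" "proj B v \<in> V"
  shows "line_of B v = {e. proj B e = proj B v \<and> (\<exists>c. \<tau> e = c *s \<tau> v)}"
proof (intro set_eqI iffI)
  fix e assume "e \<in> line_of B v"
  then show "e \<in> {e. proj B e = proj B v \<and> (\<exists>c. \<tau> e = c *s \<tau> v)}"
    using vb_scale assms unfolding line_of_def by blast
next
  fix e assume "e \<in> {e. proj B e = proj B v \<and> (\<exists>c. \<tau> e = c *s \<tau> v)}"
  then obtain c where "proj B e = proj B v" "\<tau> e = c *s \<tau> v" by blast
  then have "e = vb_scale B c v" using triv_inj[OF assms(1)] assms vb_scale by metis
  then show "e \<in> line_of B v" unfolding line_of_def by blast
qed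

lemma mem_line_of: "v \<in> line_of B v"
proof -
  obtain V \<tau> where t: "(V, \<tau>) \<in> trivs B" "proj B v \<in> V" by (rule triv_covered)
  have "\<tau> v = 1 *s \<tau> v" by simp
  then show ?thesis unfolding line_of_eq[OF t] by blast
qed

lemma line_of_eqI:
  assumes t: "(V, \<tau>) \<in> trivs B" "proj B v \<in> V" and "proj B v' = proj B v" "\<tau> v' = c *s \<tau> v" "c \<noteq> 0"
  shows "line_of B v' = line_of B v"
proof -
  have "(\<exists>d. w = d *s \<tau> v') \<longleftrightarrow> (\<exists>d. w = d *s \<tau> v)" for w
  proof
    assume "\<exists>d. w = d *s \<tau> v'"
    then obtain d where "w = (d * c) *s \<tau> v" using assms by auto
    then show "\<exists>d. w = d *s \<tau> v" by blast
  next
    assume "\<exists>d. w = d *s \<tau> v"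
    then obtain d where "w = (d / c) *s \<tau> v'" using assms by auto
    then show "\<exists>d. w = d *s \<tau> v'" by blast
  qed
  then show ?thesis using line_of_eq t assms by auto
qed

lemma line_of_eqD:
  assumes eq: "line_of B v = line_of B v'"
  obtains c where "v' = vb_scale B c v"
  using mem_line_of[of v'] eq unfolding line_of_def by auto

end

section \<open>Analytic sets of lines\<close>

definition base_pt :: "complex ^ 3 \<Rightarrow> complex ^ 2" where
  "base_pt q = vector [q $ 1, q $ 2]"

definition affine_vec :: "2 \<Rightarrow> complex \<Rightarrow> complex ^ 2" where
  "affine_vec k u = (\<chi> i. if i = k then 1 else u)"

definition other :: "2 \<Rightarrow> 2" where "other k = (if k = 1 then 2 else 1)"

lemma other_neq [simp]: "other k \<noteq> k" "k \<noteq> other k" "other (other k) = k"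
  using exhaust_2[of k] by (auto simp: other_def)

lemma eq_or_other: "i = k \<or> i = other k"
  using exhaust_2[of k] exhaust_2[of i] by (auto simp: other_def)

lemma vec2_eq_iff: "(a :: 'b ^ 2) = b \<longleftrightarrow> a $ k = b $ k \<and> a $ other k = b $ other k"
proof -
  have "(\<forall>i. P i) \<longleftrightarrow> P k \<and> P (other k)" for P :: "2 \<Rightarrow> bool"
    by (metis eq_or_other)
  then show ?thesis unfolding vec_eq_iff .
qed

lemma affine_vec_nth [simp]: "affine_vec k u $ k = 1" "affine_vec k u $ other k = u"
  by (simp_all add: affine_vec_def)

lemma base_pt_nth [simp]: "base_pt q $ 1 = q $ 1" "base_pt q $ 2 = q $ 2"
  by (simp_all add: base_pt_def)

text \<open>The inverse of the chart \<open>proj_chart E c t k\<close>, in explicit form: the line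
  of the vector whose coordinate with index \<open>k\<close> is 1.\<close>

definition proj_line ::
    "('a, 'e, 2) vbundle \<Rightarrow> ('a, 2) chart \<Rightarrow> 'a set \<times> ('e \<Rightarrow> complex ^ 2) \<Rightarrow> 2 \<Rightarrow> complex ^ 3 \<Rightarrow> 'e set" where
  "proj_line E c t k q =
     line_of E (fibre_vec E (snd t) (inv_into (fst c) (snd c) (base_pt q)) (affine_vec k (q $ 3)))"

text \<open>The image of that chart; it is the same for both indices \<open>k\<close>, since the
  affine coordinate is unrestricted.\<close>

definition proj_dom :: "('a, 2) chart \<Rightarrow> 'a set \<times> ('e \<Rightarrow> complex ^ 2) \<Rightarrow> (complex ^ 3) set" where
  "proj_dom c t = {q. base_pt q \<in> snd c ` (fst c \<inter> fst t)}"

text \<open>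
  Functions of a base point and a fibre coordinate vector that pull back to holomorphic functions
  along holomorphic families of such pairs.
\<close>

definition fibrewise_holo ::
    "('a, 2) atlas \<Rightarrow> 'a set \<Rightarrow> ('a \<Rightarrow> complex ^ 2 \<Rightarrow> complex) \<Rightarrow> bool" where
  "fibrewise_holo X N f \<longleftrightarrow> (\<forall>(\<Omega> :: (complex ^ 3) set) \<xi> w.
     (\<forall>h. holo_fun X N h \<longrightarrow> holo_on \<Omega> (\<lambda>q. h (\<xi> q))) \<and> (\<forall>i. holo_on \<Omega> (\<lambda>q. w q $ i)) \<longrightarrow>
     holo_on \<Omega> (\<lambda>q. f (\<xi> q) (w q)))"

lemma fibrewise_holo_base: "holo_fun X N h \<Longrightarrow> fibrewise_holo X N (\<lambda>x w. h x)"
  unfolding fibrewise_holo_def by blast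

lemma fibrewise_holo_coord: "fibrewise_holo X N (\<lambda>x w. w $ i)"
  unfolding fibrewise_holo_def by blast

lemma fibrewise_holo_add:
  "fibrewise_holo X N f \<Longrightarrow> fibrewise_holo X N g \<Longrightarrow> fibrewise_holo X N (\<lambda>x w. f x w + g x w)"
  unfolding fibrewise_holo_def by (intro allI impI holo_on_add; blast)

lemma fibrewise_holo_diff:
  "fibrewise_holo X N f \<Longrightarrow> fibrewise_holo X N g \<Longrightarrow> fibrewise_holo X N (\<lambda>x w. f x w - g x w)"
  unfolding fibrewise_holo_def by (intro allI impI holo_on_diff; blast)

lemma fibrewise_holo_mult:
  "fibrewise_holo X N f \<Longrightarrow> fibrewise_holo X N g \<Longrightarrow> fibrewise_holo X N (\<lambda>x w. f x w * g x w)"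
  unfolding fibrewise_holo_def by (intro allI impI holo_on_mult; blast)

lemmas fibrewise_holo_intros = fibrewise_holo_base fibrewise_holo_coord fibrewise_holo_add
  fibrewise_holo_diff fibrewise_holo_mult

lemma analytic_subset_Int:
  assumes A: "analytic_subset \<Omega> A" and B: "analytic_subset \<Omega> B"
  shows "analytic_subset \<Omega> (A \<inter> B)"
  unfolding analytic_subset_def
proof (intro conjI ballI)
  show "A \<inter> B \<subseteq> \<Omega>" using A unfolding analytic_subset_def by blast
  fix p assume p: "p \<in> \<Omega>"
  obtain N F where N: "open N" "p \<in> N" "N \<subseteq> \<Omega>" "finite F" "\<forall>f\<in>F. holo_on N f"
    "A \<inter> N = {z \<in> N. \<forall>f\<in>F. f z = 0}"
    using A p unfolding analytic_subset_def by meson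
  obtain N' F' where N': "open N'" "p \<in> N'" "N' \<subseteq> \<Omega>" "finite F'" "\<forall>f\<in>F'. holo_on N' f"
    "B \<inter> N' = {z \<in> N'. \<forall>f\<in>F'. f z = 0}"
    using B p unfolding analytic_subset_def by meson
  show "\<exists>N F. open N \<and> p \<in> N \<and> N \<subseteq> \<Omega> \<and> finite F \<and> (\<forall>f\<in>F. holo_on N f) \<and>
      A \<inter> B \<inter> N = {z \<in> N. \<forall>f\<in>F. f z = 0}"
  proof (intro exI conjI)
    show "A \<inter> B \<inter> (N \<inter> N') = {z \<in> N \<inter> N'. \<forall>f\<in>F \<union> F'. f z = 0}"
      using N(6) N'(6) by blast
  qed (use N N' in \<open>auto intro: holo_on_subset\<close>)
qed

context
  fixes X :: "('a :: {t2_space, second_countable_topology}, 2) atlas"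
    and E :: "('a, 'e, 2) vbundle"
  assumes X: "complex_manifold X" and E: "holo_vector_bundle X E"
begin

lemma proj_chart_line_of:
  assumes c: "(U, \<phi>) \<in> X" and t: "(V, \<tau>) \<in> trivs E" and v: "proj E v \<in> U \<inter> V" "\<tau> v $ k \<noteq> 0"
  shows "line_of E v \<in> fst (proj_chart E (U, \<phi>) (V, \<tau>) k)"
    and "snd (proj_chart E (U, \<phi>) (V, \<tau>) k) (line_of E v) =
      vector [\<phi> (proj E v) $ 1, \<phi> (proj E v) $ 2, \<tau> v $ other k / \<tau> v $ k]"
proof -
  have vV: "proj E v \<in> V" using v by simp
  note L = line_of_eq[OF X E t vV]
  have "\<not> vb_is_zero E v" using v vb_is_zero_iff[OF X E t vV] by auto
  then show "line_of E v \<in> fst (proj_chart E (U, \<phi>) (V, \<tau>) k)"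
    unfolding proj_chart_def proj_bundle_def using v mem_line_of[OF X E] by auto
  define v0 where "v0 = vb_scale E (1 / \<tau> v $ k) v"
  have v0: "proj E v0 = proj E v" "\<tau> v0 = (1 / \<tau> v $ k) *s \<tau> v"
    unfolding v0_def using vb_scale[OF X E] t vV by blast+
  have "(THE w. w \<in> line_of E v \<and> \<tau> w $ k = 1) = v0"
  proof (rule the_equality)
    show "v0 \<in> line_of E v \<and> \<tau> v0 $ k = 1"
      unfolding L using v0 v by auto
    fix w assume w: "w \<in> line_of E v \<and> \<tau> w $ k = 1"
    then obtain d where d: "proj E w = proj E v" "\<tau> w = d *s \<tau> v" unfolding L by blast
    then have "d = 1 / \<tau> v $ k" using w v by (auto simp: field_simps)
    then show "w = v0" using d v0 triv_inj[OF X E t, of v0 w] vV by simp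
  qed
  then show "snd (proj_chart E (U, \<phi>) (V, \<tau>) k) (line_of E v) =
      vector [\<phi> (proj E v) $ 1, \<phi> (proj E v) $ 2, \<tau> v $ other k / \<tau> v $ k]"
    unfolding proj_chart_def Let_def by (simp add: v0 other_def)
qed

lemma fst_proj_chartE:
  assumes t: "(V, \<tau>) \<in> trivs E" and l: "l \<in> fst (proj_chart E (U, \<phi>) (V, \<tau>) k)"
  obtains v where "l = line_of E v" "proj E v \<in> U \<inter> V" "\<tau> v $ k = 1"
proof -
  obtain v1 v where v1: "l = line_of E v1" and v: "v \<in> l" "proj E v \<in> U \<inter> V" "\<tau> v $ k \<noteq> 0"
    using l unfolding proj_chart_def proj_bundle_def by auto
  then have pv: "proj E v = proj E v1"
    unfolding line_of_def using vb_scale(1)[OF X E] by auto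
  have v1V: "proj E v1 \<in> V" using v pv by auto
  obtain d where d: "\<tau> v = d *s \<tau> v1"
    using v(1) unfolding v1 line_of_eq[OF X E t v1V] by auto
  define v0 where "v0 = vb_scale E (1 / \<tau> v $ k) v"
  have v0: "proj E v0 = proj E v" "\<tau> v0 = (1 / \<tau> v $ k) *s \<tau> v"
    unfolding v0_def using vb_scale[OF X E] t v by blast+
  have "line_of E v0 = line_of E v1"
  proof (rule line_of_eqI[OF X E t v1V])
    show "proj E v0 = proj E v1" using v0 pv by simp
    show "\<tau> v0 = (1 / \<tau> v $ k * d) *s \<tau> v1" using v0 d by simp
    show "1 / \<tau> v $ k * d \<noteq> 0" using v(3) d by auto
  qed
  then show ?thesis using that[of v0] v0 v v1 by simp
qed

lemma proj_line_eq:
  assumes c: "(U, \<phi>) \<in> X" and t: "(V, \<tau>) \<in> trivs E" and v: "proj E v \<in> U \<inter> V" "\<tau> v $ k = 1"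
  shows "proj_line E (U, \<phi>) (V, \<tau>) k (vector [\<phi> (proj E v) $ 1, \<phi> (proj E v) $ 2, \<tau> v $ other k]) = line_of E v"
proof -
  have "base_pt (vector [\<phi> (proj E v) $ 1, \<phi> (proj E v) $ 2, \<tau> v $ other k]) = \<phi> (proj E v)"
    by (simp add: vec_eq_iff forall_2)
  moreover have "affine_vec k (\<tau> v $ other k) = \<tau> v"
    using v by (simp add: vec2_eq_iff[of _ _ k])
  moreover have "fibre_vec E \<tau> (proj E v) (\<tau> v) = v"
    using triv_inj[OF X E t, of v] fibre_vec[OF X E t] v by simp
  ultimately show ?thesis
    using complex_manifold_chart(4)[OF X c] v by (simp add: proj_line_def)
qed

lemma proj_line_rep:
  fixes k :: 2
  assumes c: "(U, \<phi>) \<in> X" and t: "(V, \<tau>) \<in> trivs E" and q: "q \<in> proj_dom (U, \<phi>) (V, \<tau>)"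
  defines "x \<equiv> inv_into U \<phi> (base_pt q)"
  defines "v \<equiv> fibre_vec E \<tau> x (affine_vec k (q $ 3))"
  shows "x \<in> U \<inter> V" "\<phi> x = base_pt q" "proj E v = x" "\<tau> v = affine_vec k (q $ 3)"
    "proj_line E (U, \<phi>) (V, \<tau>) k q = line_of E v"
proof -
  obtain y where y: "y \<in> U \<inter> V" "base_pt q = \<phi> y" using q unfolding proj_dom_def by auto
  then have "x = y" using complex_manifold_chart(4)[OF X c] by (simp add: x_def)
  then show "x \<in> U \<inter> V" "\<phi> x = base_pt q" using y by auto
  then show "proj E v = x" "\<tau> v = affine_vec k (q $ 3)"
    unfolding v_def using fibre_vec[OF X E t] by auto
  show "proj_line E (U, \<phi>) (V, \<tau>) k q = line_of E v"
    by (simp add: proj_line_def v_def x_def)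
qed

lemma proj_chart_proj_line:
  assumes c: "(U, \<phi>) \<in> X" and t: "(V, \<tau>) \<in> trivs E" and q: "q \<in> proj_dom (U, \<phi>) (V, \<tau>)"
  shows "proj_line E (U, \<phi>) (V, \<tau>) k q \<in> fst (proj_chart E (U, \<phi>) (V, \<tau>) k)"
    and "snd (proj_chart E (U, \<phi>) (V, \<tau>) k) (proj_line E (U, \<phi>) (V, \<tau>) k q) = q"
proof -
  note r = proj_line_rep(1,2)[OF c t q] proj_line_rep(3-5)[OF c t q, where k = k]
  define v where "v = fibre_vec E \<tau> (inv_into U \<phi> (base_pt q)) (affine_vec k (q $ 3))"
  have v: "proj E v \<in> U \<inter> V" "\<tau> v $ k \<noteq> 0" using r by (auto simp: v_def)
  show "proj_line E (U, \<phi>) (V, \<tau>) k q \<in> fst (proj_chart E (U, \<phi>) (V, \<tau>) k)"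
    using proj_chart_line_of(1)[OF c t v] r(5) by (simp add: v_def)
  have "vector [\<phi> (proj E v) $ 1, \<phi> (proj E v) $ 2, \<tau> v $ other k / \<tau> v $ k] = q"
    using r by (simp add: v_def vec_eq_iff forall_3)
  then show "snd (proj_chart E (U, \<phi>) (V, \<tau>) k) (proj_line E (U, \<phi>) (V, \<tau>) k q) = q"
    using proj_chart_line_of(2)[OF c t v] r(5) by (simp add: v_def)
qed

lemma proj_chart_image:
  fixes k :: 2
  assumes c: "(U, \<phi>) \<in> X" and t: "(V, \<tau>) \<in> trivs E"
  defines "C \<equiv> proj_chart E (U, \<phi>) (V, \<tau>) k"
  shows "snd C ` (S \<inter> fst C) =
      {q \<in> proj_dom (U, \<phi>) (V, \<tau>). proj_line E (U, \<phi>) (V, \<tau>) k q \<in> S}"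
proof (intro set_eqI iffI)
  fix q assume "q \<in> snd C ` (S \<inter> fst C)"
  then obtain l where l: "l \<in> S" "l \<in> fst C" "q = snd C l" by blast
  obtain v where v: "l = line_of E v" "proj E v \<in> U \<inter> V" "\<tau> v $ k = 1"
    using fst_proj_chartE[OF t l(2)[unfolded C_def]] by blast
  have q: "q = vector [\<phi> (proj E v) $ 1, \<phi> (proj E v) $ 2, \<tau> v $ other k]"
    using proj_chart_line_of(2)[OF c t v(2), of k] v l(3) by (simp add: C_def)
  then have "base_pt q = \<phi> (proj E v)" by (simp add: vec_eq_iff forall_2)
  then show "q \<in> {q \<in> proj_dom (U, \<phi>) (V, \<tau>). proj_line E (U, \<phi>) (V, \<tau>) k q \<in> S}"
    using proj_line_eq[OF c t v(2,3)] q l v by (auto simp: proj_dom_def)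
next
  fix q assume "q \<in> {q \<in> proj_dom (U, \<phi>) (V, \<tau>). proj_line E (U, \<phi>) (V, \<tau>) k q \<in> S}"
  then show "q \<in> snd C ` (S \<inter> fst C)"
    using proj_chart_proj_line[OF c t, of q k] unfolding C_def by force
qed

lemma open_base_pt_vimage: "open N \<Longrightarrow> open (base_pt -` N)"
proof (rule open_vimage)
  have "continuous_on UNIV (\<lambda>q :: complex ^ 3. \<chi> i :: 2. q $ (if i = 1 then 1 else 2))"
    by (intro continuous_on_vec_lambda) (auto intro!: continuous_intros)
  moreover have "base_pt = (\<lambda>q. \<chi> i. q $ (if i = 1 then 1 else 2))"
    by (auto simp: vec_eq_iff forall_2 fun_eq_iff)
  ultimately show "continuous_on UNIV base_pt" by (simp only:)
qed

lemma Union_proj_atlas: "\<Union> (fst ` proj_atlas X E) = proj_bundle E"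
proof
  show "\<Union> (fst ` proj_atlas X E) \<subseteq> proj_bundle E"
  proof (rule UN_least)
    fix C assume "C \<in> proj_atlas X E"
    then obtain c t k where C: "C = proj_chart E c t k" unfolding proj_atlas_def by blast
    show "fst C \<subseteq> proj_bundle E" unfolding C proj_chart_def fst_conv by blast
  qed
  show "proj_bundle E \<subseteq> \<Union> (fst ` proj_atlas X E)"
  proof
    fix l assume "l \<in> proj_bundle E"
    then obtain v where v: "l = line_of E v" "\<not> vb_is_zero E v" unfolding proj_bundle_def by blast
    obtain U \<phi> where c: "(U, \<phi>) \<in> X" "proj E v \<in> U" using complex_manifold_covered[OF X] .
    obtain V \<tau> where t: "(V, \<tau>) \<in> trivs E" "proj E v \<in> V" using triv_covered[OF X E] .
    have "\<tau> v \<noteq> 0" using v vb_is_zero_iff[OF X E t] by blast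
    then obtain k where "\<tau> v $ k \<noteq> 0" by (auto simp: vec_eq_iff)
    then have "l \<in> fst (proj_chart E (U, \<phi>) (V, \<tau>) k)"
      using proj_chart_line_of(1)[OF c(1) t(1), of v k] c t v by simp
    then show "l \<in> \<Union> (fst ` proj_atlas X E)"
      using c t unfolding proj_atlas_def by blast
  qed
qed

text \<open>Images under the charts, which involve a definite description, are traded for preimages
  under the explicit inverse \<open>proj_line\<close>.\<close>

lemma analytic_in_proj_atlas_iff:
  "analytic_in (proj_atlas X E) S \<longleftrightarrow> S \<subseteq> proj_bundle E \<and>
     (\<forall>U \<phi> V \<tau> k. (U, \<phi>) \<in> X \<longrightarrow> (V, \<tau>) \<in> trivs E \<longrightarrow>
        analytic_subset (proj_dom (U, \<phi>) (V, \<tau>))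
          {q \<in> proj_dom (U, \<phi>) (V, \<tau>). proj_line E (U, \<phi>) (V, \<tau>) k q \<in> S})"
proof -
  have atlas: "(\<forall>C\<in>proj_atlas X E. P C) \<longleftrightarrow>
      (\<forall>U \<phi> V \<tau> k. (U, \<phi>) \<in> X \<longrightarrow> (V, \<tau>) \<in> trivs E \<longrightarrow> P (proj_chart E (U, \<phi>) (V, \<tau>) k))" for P
  proof (intro iffI allI impI ballI)
    fix U \<phi> V \<tau> k assume "\<forall>C\<in>proj_atlas X E. P C" "(U, \<phi>) \<in> X" "(V, \<tau>) \<in> trivs E"
    moreover from this have "proj_chart E (U, \<phi>) (V, \<tau>) k \<in> proj_atlas X E"
      unfolding proj_atlas_def by blast
    ultimately show "P (proj_chart E (U, \<phi>) (V, \<tau>) k)" by (rule_tac bspec)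
  next
    fix C assume *: "\<forall>U \<phi> V \<tau> k. (U, \<phi>) \<in> X \<longrightarrow> (V, \<tau>) \<in> trivs E \<longrightarrow> P (proj_chart E (U, \<phi>) (V, \<tau>) k)"
      and "C \<in> proj_atlas X E"
    then obtain c t k where ct: "C = proj_chart E c t k" "c \<in> X" "t \<in> trivs E"
      unfolding proj_atlas_def by blast
    show "P C" using *[rule_format, of "fst c" "snd c" "fst t" "snd t" k] ct by simp
  qed
  have "(\<forall>(D, \<psi>)\<in>proj_atlas X E. analytic_subset (\<psi> ` D) (\<psi> ` (S \<inter> D))) \<longleftrightarrow>
      (\<forall>C\<in>proj_atlas X E. analytic_subset (snd C ` fst C) (snd C ` (S \<inter> fst C)))"
    by (simp only: case_prod_unfold)
  also have "\<dots> \<longleftrightarrow> (\<forall>U \<phi> V \<tau> k. (U, \<phi>) \<in> X \<longrightarrow> (V, \<tau>) \<in> trivs E \<longrightarrow>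
        analytic_subset (snd (proj_chart E (U, \<phi>) (V, \<tau>) k) ` fst (proj_chart E (U, \<phi>) (V, \<tau>) k))
          (snd (proj_chart E (U, \<phi>) (V, \<tau>) k) ` (S \<inter> fst (proj_chart E (U, \<phi>) (V, \<tau>) k))))"
    by (rule atlas)
  also have "\<dots> \<longleftrightarrow> (\<forall>U \<phi> V \<tau> k. (U, \<phi>) \<in> X \<longrightarrow> (V, \<tau>) \<in> trivs E \<longrightarrow>
        analytic_subset (proj_dom (U, \<phi>) (V, \<tau>))
          {q \<in> proj_dom (U, \<phi>) (V, \<tau>). proj_line E (U, \<phi>) (V, \<tau>) k q \<in> S})"
    using proj_chart_image[where S = S] proj_chart_image[where S = UNIV] by simp
  finally show ?thesis unfolding analytic_in_def Union_proj_atlas by simp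
qed

lemma analytic_in_Int:
  assumes S: "analytic_in (proj_atlas X E) S" and T: "analytic_in (proj_atlas X E) T"
  shows "analytic_in (proj_atlas X E) (S \<inter> T)"
  unfolding analytic_in_proj_atlas_iff
proof (intro conjI allI impI)
  show "S \<inter> T \<subseteq> proj_bundle E" using S unfolding analytic_in_proj_atlas_iff by blast
  fix U \<phi> V \<tau> k assume c: "(U, \<phi>) \<in> X" and t: "(V, \<tau>) \<in> trivs E"
  let ?D = "proj_dom (U, \<phi>) (V, \<tau>)" and ?l = "proj_line E (U, \<phi>) (V, \<tau>) k"
  have "analytic_subset ?D ({q \<in> ?D. ?l q \<in> S} \<inter> {q \<in> ?D. ?l q \<in> T})"
    using S T c t unfolding analytic_in_proj_atlas_iff by (intro analytic_subset_Int) simp_all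
  moreover have "{q \<in> ?D. ?l q \<in> S} \<inter> {q \<in> ?D. ?l q \<in> T} = {q \<in> ?D. ?l q \<in> S \<inter> T}" by blast
  ultimately show "analytic_subset ?D {q \<in> ?D. ?l q \<in> S \<inter> T}" by simp
qed

lemma holo_on_base_pullback:
  assumes c: "(U, \<phi>) \<in> X" and N: "N \<subseteq> U" and h: "holo_fun X N h"
  shows "holo_on {q. base_pt q \<in> \<phi> ` N} (\<lambda>q. h (inv_into U \<phi> (base_pt q)))"
proof -
  have f: "holo_on (\<phi> ` N) (h \<circ> inv_into U \<phi>)"
    using holo_fun_chartD[OF h c] N by (simp add: Int_absorb1)
  have "holo_on {q. base_pt q \<in> \<phi> ` N} (\<lambda>q. base_pt q $ k)" for k
    using exhaust_2[of k] by (auto intro: holo_on_component)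
  then have "holo_on {q. base_pt q \<in> \<phi> ` N} (\<lambda>q. (h \<circ> inv_into U \<phi>) (base_pt q))"
    by (rule holo_on_compose[OF _ f]) auto
  then show ?thesis by simp
qed

text \<open>The criterion behind all analytic sets of lines below: the condition passes to nonzero
  multiples and is cut out locally by finitely many equations in base point and fibre coordinates. A
  chart evaluates these equations at vectors with one coordinate equal to 1, where they become
  holomorphic in three variables.\<close>

lemma analytic_in_lines:
  fixes R :: "'e \<Rightarrow> bool"
  assumes scale: "\<And>v c. R v \<Longrightarrow> \<not> vb_is_zero E v \<Longrightarrow> \<not> vb_is_zero E (vb_scale E c v) \<Longrightarrow> R (vb_scale E c v)"
    and local: "\<And>U \<phi> V \<tau> x. (U, \<phi>) \<in> X \<Longrightarrow> (V, \<tau>) \<in> trivs E \<Longrightarrow> x \<in> U \<Longrightarrow> x \<in> V \<Longrightarrow>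
      \<exists>N F. open N \<and> x \<in> N \<and> N \<subseteq> U \<inter> V \<and> finite F \<and> (\<forall>f\<in>F. fibrewise_holo X N f) \<and>
        (\<forall>v. proj E v \<in> N \<longrightarrow> \<not> vb_is_zero E v \<longrightarrow> R v \<longleftrightarrow> (\<forall>f\<in>F. f (proj E v) (\<tau> v) = 0))"
  shows "analytic_in (proj_atlas X E) {line_of E v | v. \<not> vb_is_zero E v \<and> R v}"
  unfolding analytic_in_proj_atlas_iff
proof (intro conjI allI impI)
  let ?S = "{line_of E v | v. \<not> vb_is_zero E v \<and> R v}"
  show "?S \<subseteq> proj_bundle E" unfolding proj_bundle_def by blast
  fix U \<phi> V \<tau> k assume c: "(U, \<phi>) \<in> X" and t: "(V, \<tau>) \<in> trivs E"
  let ?D = "proj_dom (U, \<phi>) (V, \<tau>)"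
  let ?l = "proj_line E (U, \<phi>) (V, \<tau>) k"
  define \<xi> where "\<xi> q = inv_into U \<phi> (base_pt q)" for q
  define \<nu> where "\<nu> q = fibre_vec E \<tau> (\<xi> q) (affine_vec k (q $ 3))" for q
  note rep = proj_line_rep(1,2)[OF c t, folded \<xi>_def] proj_line_rep(3-5)[OF c t, where k = k, folded \<xi>_def, folded \<nu>_def]
  have nz: "\<not> vb_is_zero E (\<nu> q)" if "q \<in> ?D" for q
    using rep[OF that] vb_is_zero_iff[OF X E t, of "\<nu> q"] affine_vec_nth(1)[of k "q $ 3"]
    by (metis IntD2 zero_index zero_neq_one)
  \<comment> \<open>Every vector that witnesses membership of the line has the nonzero vector
    \<open>\<nu> q\<close> as a multiple, so the condition can be tested on \<open>\<nu> q\<close>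
    alone.\<close>
  have mem: "?l q \<in> ?S \<longleftrightarrow> R (\<nu> q)" if q: "q \<in> ?D" for q
  proof
    assume "?l q \<in> ?S"
    then obtain v where v: "line_of E v = line_of E (\<nu> q)" "\<not> vb_is_zero E v" "R v"
      using rep(5)[OF q] by auto
    obtain d where "\<nu> q = vb_scale E d v" using line_of_eqD[OF X E v(1)] .
    then show "R (\<nu> q)" using scale[OF v(3,2)] nz[OF q] by metis
  next
    assume "R (\<nu> q)"
    then show "?l q \<in> ?S" using rep(5)[OF q] nz[OF q] by blast
  qed
  show "analytic_subset ?D {q \<in> ?D. ?l q \<in> ?S}"
    unfolding analytic_subset_def
  proof (intro conjI ballI)
    fix p assume p: "p \<in> ?D"
    have "\<xi> p \<in> U" "\<xi> p \<in> V" using rep(1)[OF p] by auto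
    from local[OF c t this] obtain N F where N: "open N" "\<xi> p \<in> N" "N \<subseteq> U \<inter> V" and F: "finite F"
      "\<And>f. f \<in> F \<Longrightarrow> fibrewise_holo X N f"
      and R: "\<And>v. proj E v \<in> N \<Longrightarrow> \<not> vb_is_zero E v \<Longrightarrow> R v \<longleftrightarrow> (\<forall>f\<in>F. f (proj E v) (\<tau> v) = 0)"
      by metis
    let ?N = "{q. base_pt q \<in> \<phi> ` N}"
    let ?G = "(\<lambda>f q. f (\<xi> q) (affine_vec k (q $ 3))) ` F"
    have ND: "?N \<subseteq> ?D" using N unfolding proj_dom_def by auto
    have \<xi>N: "\<xi> q \<in> N" if "q \<in> ?N" for q
      using that N complex_manifold_chart(4)[OF X c] by (auto simp: \<xi>_def)
    show "\<exists>N F. open N \<and> p \<in> N \<and> N \<subseteq> ?D \<and> finite F \<and> (\<forall>f\<in>F. holo_on N f) \<and>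
        {q \<in> ?D. ?l q \<in> ?S} \<inter> N = {z \<in> N. \<forall>f\<in>F. f z = 0}"
    proof (intro exI conjI)
      have "open (\<phi> ` N)" by (rule complex_manifold_chart_image[OF X c]) (use N in auto)
      then show "open ?N" using open_base_pt_vimage by (simp add: vimage_def)
      show "p \<in> ?N" using rep(2)[OF p] N(2) by (auto intro: image_eqI[of _ _ "\<xi> p"])
      show "?N \<subseteq> ?D" by (rule ND)
      show "finite ?G" using F by simp
      have "holo_on ?N (\<lambda>q. f (\<xi> q) (affine_vec k (q $ 3)))" if "f \<in> F" for f
      proof -
        have "holo_on ?N (\<lambda>q. h (\<xi> q))" if "holo_fun X N h" for h
          unfolding \<xi>_def by (rule holo_on_base_pullback[OF c _ that]) (use N in auto)
        moreover have "holo_on ?N (\<lambda>q. affine_vec k (q $ 3) $ i)" for i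
          by (cases "i = k") (simp_all add: affine_vec_def holo_on_const holo_on_component)
        ultimately show ?thesis
          using F(2)[OF that, unfolded fibrewise_holo_def, rule_format, of ?N \<xi> "\<lambda>q. affine_vec k (q $ 3)"]
          by blast
      qed
      then show "\<forall>f\<in>?G. holo_on ?N f" by blast
      have "?l q \<in> ?S \<longleftrightarrow> (\<forall>f\<in>F. f (\<xi> q) (affine_vec k (q $ 3)) = 0)" if q: "q \<in> ?N" for q
      proof -
        have qD: "q \<in> ?D" using q ND by blast
        show ?thesis
          using mem[OF qD] R[of "\<nu> q"] nz[OF qD] rep(3,4)[OF qD] \<xi>N[OF q] by simp
      qed
      then show "{q \<in> ?D. ?l q \<in> ?S} \<inter> ?N = {z \<in> ?N. \<forall>f\<in>?G. f z = 0}"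
        using ND by auto
    qed
  qed auto
qed

end

section \<open>The locus of a sub-line bundle\<close>

text \<open>The factor is the determinant of \<open>g\<close>; a vanishing wedge therefore stays
  zero under a change of trivialization.\<close>

lemma wedge2_matrix_vector_mult:
  "wedge2 (g *v a) (g *v b) = (g $ 1 $ 1 * g $ 2 $ 2 - g $ 1 $ 2 * g $ 2 $ 1) * wedge2 a b"
  by (simp add: wedge2_def matrix_vector_mult_def sum_2 algebra_simps)

lemma wedge2_scale: "wedge2 (c *s a) b = c * wedge2 a b" "wedge2 a (c *s b) = c * wedge2 a b"
  by (simp_all add: wedge2_def algebra_simps)

lemma wedge2_eq_0_imp:
  assumes "wedge2 a b = 0" "a \<noteq> 0" obtains c where "b = c *s a"
proof (cases "a $ 1 = 0")
  case True
  then have "a $ 2 \<noteq> 0" using assms(2) by (auto simp: vec_eq_iff forall_2)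
  then show ?thesis using assms True
    by (intro that[of "b $ 2 / a $ 2"]) (auto simp: vec_eq_iff forall_2 wedge2_def)
next
  case False
  then show ?thesis using assms
    by (intro that[of "b $ 1 / a $ 1"]) (auto simp: vec_eq_iff forall_2 wedge2_def field_simps)
qed

lemma dual_germ_eq_iff:
  "dual_germ B x \<alpha> = dual_germ B x \<beta> \<longleftrightarrow>
     (\<exists>W. open W \<and> x \<in> W \<and> (\<forall>e. proj B e \<in> W \<longrightarrow> \<alpha> e = \<beta> e))"
proof
  assume "dual_germ B x \<alpha> = dual_germ B x \<beta>"
  moreover have "\<alpha> \<in> dual_germ B x \<alpha>" unfolding dual_germ_def by (auto intro: exI[of _ UNIV])
  ultimately show "\<exists>W. open W \<and> x \<in> W \<and> (\<forall>e. proj B e \<in> W \<longrightarrow> \<alpha> e = \<beta> e)"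
    unfolding dual_germ_def by blast
next
  assume "\<exists>W. open W \<and> x \<in> W \<and> (\<forall>e. proj B e \<in> W \<longrightarrow> \<alpha> e = \<beta> e)"
  then obtain W where W: "open W" "x \<in> W" "\<And>e. proj B e \<in> W \<Longrightarrow> \<alpha> e = \<beta> e" by blast
  have "(\<exists>W'. open W' \<and> x \<in> W' \<and> (\<forall>e. proj B e \<in> W' \<longrightarrow> \<gamma> e = \<alpha> e)) \<longleftrightarrow>
      (\<exists>W'. open W' \<and> x \<in> W' \<and> (\<forall>e. proj B e \<in> W' \<longrightarrow> \<gamma> e = \<beta> e))" for \<gamma>
  proof
    assume "\<exists>W'. open W' \<and> x \<in> W' \<and> (\<forall>e. proj B e \<in> W' \<longrightarrow> \<gamma> e = \<alpha> e)"
    then obtain W' where "open W'" "x \<in> W'" "\<And>e. proj B e \<in> W' \<Longrightarrow> \<gamma> e = \<alpha> e" by blast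
    then show "\<exists>W'. open W' \<and> x \<in> W' \<and> (\<forall>e. proj B e \<in> W' \<longrightarrow> \<gamma> e = \<beta> e)"
      using W by (intro exI[of _ "W \<inter> W'"]) auto
  next
    assume "\<exists>W'. open W' \<and> x \<in> W' \<and> (\<forall>e. proj B e \<in> W' \<longrightarrow> \<gamma> e = \<beta> e)"
    then obtain W' where "open W'" "x \<in> W'" "\<And>e. proj B e \<in> W' \<Longrightarrow> \<gamma> e = \<beta> e" by blast
    then show "\<exists>W'. open W' \<and> x \<in> W' \<and> (\<forall>e. proj B e \<in> W' \<longrightarrow> \<gamma> e = \<alpha> e)"
      using W by (intro exI[of _ "W \<inter> W'"]) auto
  qed
  then show "dual_germ B x \<alpha> = dual_germ B x \<beta>" unfolding dual_germ_def by blast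
qed

lemma dual_section_combination:
  assumes \<alpha>: "dual_section X B W1 \<alpha>" and \<beta>: "dual_section X B W2 \<beta>"
    and h: "holo_fun X W h" and k: "holo_fun X W k"
  shows "dual_section X B (W \<inter> W1 \<inter> W2) (\<lambda>e. h (proj B e) * \<alpha> e + k (proj B e) * \<beta> e)"
  unfolding dual_section_def
proof clarify
  fix V \<tau> assume t: "(V, \<tau>) \<in> trivs B"
  obtain a where a: "\<And>i. holo_fun X (W1 \<inter> V) (\<lambda>x. a x $ i)"
    "\<And>e. proj B e \<in> W1 \<inter> V \<Longrightarrow> \<alpha> e = (\<Sum>i\<in>UNIV. a (proj B e) $ i * \<tau> e $ i)"
    using \<alpha> t unfolding dual_section_def by fast
  obtain b where b: "\<And>i. holo_fun X (W2 \<inter> V) (\<lambda>x. b x $ i)"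
    "\<And>e. proj B e \<in> W2 \<inter> V \<Longrightarrow> \<beta> e = (\<Sum>i\<in>UNIV. b (proj B e) $ i * \<tau> e $ i)"
    using \<beta> t unfolding dual_section_def by fast
  let ?c = "\<lambda>x. \<chi> i. h x * a x $ i + k x * b x $ i"
  have "holo_fun X (W \<inter> W1 \<inter> W2 \<inter> V) (\<lambda>x. ?c x $ i)" for i
    by (simp, intro holo_fun_intros holo_fun_subset[OF h] holo_fun_subset[OF k]
        holo_fun_subset[OF a(1)] holo_fun_subset[OF b(1)]) auto
  moreover have "h (proj B e) * \<alpha> e + k (proj B e) * \<beta> e = (\<Sum>i\<in>UNIV. ?c (proj B e) $ i * \<tau> e $ i)"
    if "proj B e \<in> W \<inter> W1 \<inter> W2 \<inter> V" for e
    using that a(2)[of e] b(2)[of e] by (simp add: sum_distrib_left algebra_simps sum.distrib)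
  ultimately show "\<exists>c. (\<forall>i. holo_fun X (W \<inter> W1 \<inter> W2 \<inter> V) (\<lambda>x. c x $ i)) \<and>
      (\<forall>e. proj B e \<in> W \<inter> W1 \<inter> W2 \<inter> V \<longrightarrow>
        h (proj B e) * \<alpha> e + k (proj B e) * \<beta> e = (\<Sum>i\<in>UNIV. c (proj B e) $ i * \<tau> e $ i))"
    by (intro exI[of _ ?c]) blast
qed

section \<open>The map \<iota> in local coordinates\<close>

locale sub_line_setting =
  fixes X :: "('a :: {t2_space, second_countable_topology}, 2) atlas"
    and E :: "('a, 'e, 2) vbundle" and L :: "('a, 'l, 1) vbundle" and \<iota> :: "'l \<Rightarrow> 'e"
  assumes X: "complex_manifold X" and conn: "connected (UNIV :: 'a set)"
    and E: "holo_vector_bundle X E" and sub: "sub_line_bundle X L E \<iota>"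
    and tfree: "torsion_free_cokernel X L E \<iota>"
begin

lemma L: "holo_vector_bundle X L"
  using sub unfolding sub_line_bundle_def by blast

lemma proj_iota [simp]: "proj E (\<iota> e) = proj L e"
  using sub unfolding sub_line_bundle_def holo_bundle_map_def by blast

text \<open>\<open>p\<close> is the image under \<iota> of the local frame of \<open>L\<close> on
  which \<sigma> equals 1, written in the trivialization \<tau>.\<close>

definition iota_coords ::
    "'a set \<Rightarrow> ('e \<Rightarrow> complex ^ 2) \<Rightarrow> 'a set \<Rightarrow> ('l \<Rightarrow> complex ^ 1) \<Rightarrow> ('a \<Rightarrow> complex ^ 2) \<Rightarrow> bool" where
  "iota_coords V \<tau> V' \<sigma> p \<longleftrightarrow> (V, \<tau>) \<in> trivs E \<and> (V', \<sigma>) \<in> trivs L \<and>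
     (\<forall>i. holo_fun X (V \<inter> V') (\<lambda>x. p x $ i)) \<and>
     (\<forall>e. proj L e \<in> V \<inter> V' \<longrightarrow> \<tau> (\<iota> e) = \<sigma> e $ 1 *s p (proj L e))"

lemma iota_coords_exist:
  assumes "(V, \<tau>) \<in> trivs E" "(V', \<sigma>) \<in> trivs L"
  obtains p where "iota_coords V \<tau> V' \<sigma> p"
proof -
  have "holo_bundle_map X L E UNIV \<iota>" using sub unfolding sub_line_bundle_def by blast
  then obtain A :: "'a \<Rightarrow> complex ^ 1 ^ 2" where
    A: "\<And>i j. holo_fun X (UNIV \<inter> V' \<inter> V) (\<lambda>x. A x $ i $ j)"
      "\<And>e. proj L e \<in> UNIV \<inter> V' \<inter> V \<Longrightarrow> \<tau> (\<iota> e) = A (proj L e) *v \<sigma> e"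
    using assms unfolding holo_bundle_map_def by fast
  have "iota_coords V \<tau> V' \<sigma> (\<lambda>x. \<chi> i. A x $ i $ 1)"
    unfolding iota_coords_def
  proof (intro conjI allI impI assms)
    show "holo_fun X (V \<inter> V') (\<lambda>x. (\<chi> i. A x $ i $ 1) $ i)" for i
      using A(1)[of i 1] by (simp add: Int_commute)
    show "\<tau> (\<iota> e) = \<sigma> e $ 1 *s (\<chi> i. A (proj L e) $ i $ 1)" if "proj L e \<in> V \<inter> V'" for e
      using A(2)[of e] that by (simp add: vec_eq_iff matrix_vector_mult_def UNIV_1 mult.commute)
  qed
  then show ?thesis by (rule that)
qed

lemma iota_coords_near:
  obtains V \<tau> V' \<sigma> p where "iota_coords V \<tau> V' \<sigma> p" "x \<in> V" "x \<in> V'"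
  using iota_coords_exist triv_covered[OF X E] triv_covered[OF X L] by metis

context
  fixes V \<tau> V' \<sigma> p assumes ic: "iota_coords V \<tau> V' \<sigma> p"
begin

lemma ic_triv: "(V, \<tau>) \<in> trivs E" "(V', \<sigma>) \<in> trivs L"
  and ic_holo: "holo_fun X (V \<inter> V') (\<lambda>x. p x $ i)"
  and ic_eq: "proj L e \<in> V \<Longrightarrow> proj L e \<in> V' \<Longrightarrow> \<tau> (\<iota> e) = \<sigma> e $ 1 *s p (proj L e)"
  using ic unfolding iota_coords_def by auto

lemma ic_open: "open V" "open V'"
  using triv_open[OF X E ic_triv(1)] triv_open[OF X L ic_triv(2)] .

lemma ic_frame:
  assumes "x \<in> V'" obtains e where "proj L e = x" "\<sigma> e $ 1 = 1"
  using fibre_vec[OF X L ic_triv(2) assms, of "vec 1"] that by auto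

end

definition nonzero_pts :: "'a set" where
  "nonzero_pts = {x. \<exists>e. proj L e = x \<and> \<not> vb_is_zero E (\<iota> e)}"

lemma nonzero_pts_iff:
  assumes ic: "iota_coords V \<tau> V' \<sigma> p" and x: "x \<in> V" "x \<in> V'"
  shows "x \<in> nonzero_pts \<longleftrightarrow> p x \<noteq> 0"
proof
  assume "x \<in> nonzero_pts"
  then obtain e where e: "proj L e = x" "\<not> vb_is_zero E (\<iota> e)" unfolding nonzero_pts_def by blast
  then have "\<tau> (\<iota> e) \<noteq> 0" using vb_is_zero_iff[OF X E ic_triv(1)[OF ic], of "\<iota> e"] x by simp
  then show "p x \<noteq> 0" using ic_eq[OF ic, of e] e x by auto
next
  assume p: "p x \<noteq> 0"
  obtain e where e: "proj L e = x" "\<sigma> e $ 1 = 1" using ic_frame[OF ic x(2)] .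
  then have "\<tau> (\<iota> e) = p x" using ic_eq[OF ic, of e] x by simp
  then show "x \<in> nonzero_pts"
    unfolding nonzero_pts_def using vb_is_zero_iff[OF X E ic_triv(1)[OF ic], of "\<iota> e"] x p e by auto
qed

lemma iota_coords_continuous:
  assumes ic: "iota_coords V \<tau> V' \<sigma> p"
  shows "continuous_on (V \<inter> V') (\<lambda>x. p x $ i)"
  using holo_fun_imp_continuous_on[OF X ic_holo[OF ic]] ic_open[OF ic] by blast

lemma open_nonzero_pts: "open nonzero_pts"
proof (subst open_subopen, rule ballI)
  fix x assume x: "x \<in> nonzero_pts"
  obtain V \<tau> V' \<sigma> p where ic: "iota_coords V \<tau> V' \<sigma> p" and xV: "x \<in> V" "x \<in> V'"
    by (rule iota_coords_near)
  obtain i where i: "p x $ i \<noteq> 0"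
    using nonzero_pts_iff[OF ic xV] x by (auto simp: vec_eq_iff)
  let ?N = "(V \<inter> V') \<inter> (\<lambda>x. p x $ i) -` (- {0})"
  have "open ?N"
    by (intro continuous_open_preimage iota_coords_continuous[OF ic] open_Int ic_open[OF ic]) auto
  moreover have "?N \<subseteq> nonzero_pts"
    using nonzero_pts_iff[OF ic] by auto
  ultimately show "\<exists>T. open T \<and> x \<in> T \<and> T \<subseteq> nonzero_pts" using i xV by blast
qed

text \<open>If \<iota> vanished over a nonempty open set, it would kill a local frame of
  \<open>L\<close>, against its injectivity on sections.\<close>

lemma nonzero_pts_dense:
  assumes W: "open W" "W \<noteq> {}" shows "W \<inter> nonzero_pts \<noteq> {}"
proof
  assume empty: "W \<inter> nonzero_pts = {}"
  obtain x where x: "x \<in> W" using W by blast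
  obtain V \<tau> V' \<sigma> p where ic: "iota_coords V \<tau> V' \<sigma> p" and xV: "x \<in> V" "x \<in> V'"
    by (rule iota_coords_near)
  note tL = ic_triv(2)[OF ic]
  let ?W = "W \<inter> V \<inter> V'" and ?t = "\<lambda>x. fibre_vec L \<sigma> x (vec 1)"
  have W': "open ?W" using W ic_open[OF ic] by blast
  have "holo_section X L ?W ?t"
    by (rule holo_section_fibre_vec[OF X L tL W']) (auto intro: holo_fun_const)
  moreover have "vb_is_zero E (\<iota> (?t y))" if "y \<in> ?W" for y
    using that empty fibre_vec(1)[OF X L tL, of y] unfolding nonzero_pts_def by blast
  ultimately have "vb_is_zero L (?t x)"
    using sub W' x xV unfolding sub_line_bundle_def sheaf_injective_def by blast
  then have "\<sigma> (?t x) = 0"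
    using vb_is_zero_iff[OF X L tL, of "?t x"] fibre_vec(1)[OF X L tL xV(2)] xV by simp
  then show False using fibre_vec(2)[OF X L tL xV(2)] by (simp add: vec_eq_iff)
qed

text \<open>The cokernel being torsion-free, \<open>s\<close> is near \<open>x\<close> the image of
  a section of \<open>L\<close>, hence a multiple of \<open>p\<close>, and so vanishes at
  \<open>x\<close> together with \<open>p\<close>.\<close>

lemma torsion_freeD:
  assumes ic: "iota_coords V \<tau> V' \<sigma> p" and N: "open N" "x \<in> N" "N \<subseteq> V \<inter> V'"
    and h: "holo_fun X N h" and s: "\<And>i. holo_fun X N (\<lambda>y. s y $ i)" and g: "holo_fun X N g"
    and eq: "\<And>y. y \<in> N \<Longrightarrow> h y *s s y = g y *s p y"
    and nz: "\<And>M. open M \<Longrightarrow> x \<in> M \<Longrightarrow> M \<subseteq> N \<Longrightarrow> \<exists>y\<in>M. h y \<noteq> 0"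
    and px: "p x = 0"
  shows "s x = 0"
proof -
  note tE = ic_triv(1)[OF ic] and tL = ic_triv(2)[OF ic]
  have NV: "y \<in> V" "y \<in> V'" if "y \<in> N" for y using N that by auto
  let ?s = "\<lambda>y. fibre_vec E \<tau> y (s y)" and ?t = "\<lambda>y. fibre_vec L \<sigma> y (vec (g y))"
  have "holo_section X E N ?s"
    by (rule holo_section_fibre_vec[OF X E tE]) (use N s in auto)
  moreover have "holo_section X L N ?t"
    by (rule holo_section_fibre_vec[OF X L tL]) (use N g in auto)
  moreover have "vb_scale E (h y) (?s y) = \<iota> (?t y)" if y: "y \<in> N" for y
  proof (rule triv_inj[OF X E tE])
    note fE = fibre_vec[OF X E tE NV(1)[OF y], of "s y"]
    note fL = fibre_vec[OF X L tL NV(2)[OF y], of "vec (g y)"]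
    show "proj E (\<iota> (?t y)) \<in> V" using fL NV[OF y] by simp
    show "proj E (vb_scale E (h y) (?s y)) = proj E (\<iota> (?t y))"
      using fE fL vb_scale(1)[OF X E] by simp
    show "\<tau> (vb_scale E (h y) (?s y)) = \<tau> (\<iota> (?t y))"
      using fE fL vb_scale(2)[OF X E tE, of "?s y" "h y"] ic_eq[OF ic, of "?t y"] NV[OF y] eq[OF y] by simp
  qed
  moreover have "\<forall>M. open M \<and> x \<in> M \<and> M \<subseteq> N \<longrightarrow> (\<exists>y\<in>M. h y \<noteq> 0)" using nz by blast
  ultimately obtain M t' where M: "x \<in> M" "M \<subseteq> N" and t': "holo_section X L M t'" "\<And>y. y \<in> M \<Longrightarrow> ?s y = \<iota> (t' y)"
    using tfree[unfolded torsion_free_cokernel_def, rule_format, of N x h ?s ?t] N h by blast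
  have "proj L (t' x) = x" using t'(1) M unfolding holo_section_def by blast
  then have "\<tau> (\<iota> (t' x)) = 0" using ic_eq[OF ic, of "t' x"] NV[OF N(2)] px by simp
  then show "s x = 0" using t'(2)[OF M(1)] fibre_vec(2)[OF X E tE NV(1)[OF N(2)], of "s x"] by simp
qed

text \<open>The equation of the hypersurface in a form free of choices: \<open>v\<close> is
  proportional to the values of \<iota> over its base point, and over a zero of \<iota> every vector
  qualifies.\<close>

definition parallel :: "'e \<Rightarrow> bool" where
  "parallel v \<longleftrightarrow> (\<forall>e V \<tau>. proj L e = proj E v \<and> (V, \<tau>) \<in> trivs E \<and> proj E v \<in> V \<longrightarrow>
     wedge2 (\<tau> (\<iota> e)) (\<tau> v) = 0)"

lemma parallel_iff:
  assumes ic: "iota_coords V \<tau> V' \<sigma> p" and v: "proj E v \<in> V" "proj E v \<in> V'"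
  shows "parallel v \<longleftrightarrow> wedge2 (p (proj E v)) (\<tau> v) = 0"
proof
  assume R: "parallel v"
  obtain e where e: "proj L e = proj E v" "\<sigma> e $ 1 = 1" using ic_frame[OF ic v(2)] .
  then have "wedge2 (\<tau> (\<iota> e)) (\<tau> v) = 0"
    using R v ic_triv(1)[OF ic] unfolding parallel_def by blast
  then show "wedge2 (p (proj E v)) (\<tau> v) = 0" using ic_eq[OF ic, of e] e v by simp
next
  assume 0: "wedge2 (p (proj E v)) (\<tau> v) = 0"
  show "parallel v"
    unfolding parallel_def
  proof clarify
    fix e V1 \<tau>1 assume e: "proj L e = proj E v" and t1: "(V1, \<tau>1) \<in> trivs E" "proj E v \<in> V1"
    obtain g where g: "\<And>e. proj E e \<in> V \<inter> V1 \<Longrightarrow> \<tau>1 e = g (proj E e) *v \<tau> e"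
      using triv_transition[OF X E ic_triv(1)[OF ic] t1(1)] by metis
    show "wedge2 (\<tau>1 (\<iota> e)) (\<tau>1 v) = 0"
      using g[of v] g[of "\<iota> e"] e t1 v ic_eq[OF ic, of e] 0
      by (simp add: wedge2_matrix_vector_mult wedge2_scale)
  qed
qed

text \<open>In coordinates the hypothesis is the relation
  \<open>a $ 1 * p $ 1 + a $ 2 * p $ 2 = 0\<close>. For \<open>s = (- a $ 2, a $ 1)\<close> it gives
  \<open>p $ 1 * s = - a $ 2 * p\<close> and \<open>p $ 2 * s = a $ 1 * p\<close>, so
  torsion-freeness makes both coefficients vanish at a zero of \<open>p\<close>. At other points
  \<open>v\<close> is a multiple of \<open>p\<close> and the relation applies directly.\<close>

lemma dual_section_vanishing:
  assumes v: "parallel v" and W: "open W" "proj E v \<in> W" and \<alpha>: "dual_section X E W \<alpha>"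
    and 0: "\<And>e. proj L e \<in> W \<Longrightarrow> \<alpha> (\<iota> e) = 0"
  shows "\<alpha> v = 0"
proof -
  define x where "x = proj E v"
  obtain V \<tau> V' \<sigma> p where ic: "iota_coords V \<tau> V' \<sigma> p" and xV: "x \<in> V" "x \<in> V'"
    by (rule iota_coords_near)
  obtain a where a: "\<And>i. holo_fun X (W \<inter> V) (\<lambda>x. a x $ i)"
    "\<And>e. proj E e \<in> W \<inter> V \<Longrightarrow> \<alpha> e = (\<Sum>i\<in>UNIV. a (proj E e) $ i * \<tau> e $ i)"
    using \<alpha> ic_triv(1)[OF ic] unfolding dual_section_def by fast
  let ?N = "W \<inter> V \<inter> V'"
  have N: "open ?N" "x \<in> ?N" "?N \<subseteq> V \<inter> V'" using W xV ic_open[OF ic] by (auto simp: x_def)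
  have ap: "a y $ 1 * p y $ 1 + a y $ 2 * p y $ 2 = 0" if "y \<in> ?N" for y
  proof -
    have "y \<in> V'" using that by blast
    then obtain e where e: "proj L e = y" "\<sigma> e $ 1 = 1" by (rule ic_frame[OF ic])
    then show ?thesis using 0[of e] a(2)[of "\<iota> e"] ic_eq[OF ic, of e] that by (simp add: sum_2)
  qed
  have ap': "a y $ 1 * p y $ 1 = - (a y $ 2 * p y $ 2)" if "y \<in> ?N" for y
    using ap[OF that] by (simp add: eq_neg_iff_add_eq_0)
  have \<alpha>v: "\<alpha> v = a x $ 1 * \<tau> v $ 1 + a x $ 2 * \<tau> v $ 2"
    using a(2)[of v] N(2) by (simp add: sum_2 x_def)
  show ?thesis
  proof (cases "p x = 0")
    case False
    have "wedge2 (p x) (\<tau> v) = 0" using v parallel_iff[OF ic] xV by (simp add: x_def)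
    then obtain c where "\<tau> v = c *s p x" using wedge2_eq_0_imp False by blast
    then have "\<alpha> v = c * (a x $ 1 * p x $ 1 + a x $ 2 * p x $ 2)"
      unfolding \<alpha>v by (simp add: algebra_simps)
    then show ?thesis using ap[OF N(2)] by simp
  next
    case True
    define s where "s y = (vector [- a y $ 2, a y $ 1] :: complex ^ 2)" for y
    have ha: "holo_fun X ?N (\<lambda>y. a y $ i)" for i by (rule holo_fun_subset[OF a(1)]) auto
    have hp: "holo_fun X ?N (\<lambda>y. p y $ i)" for i by (rule holo_fun_subset[OF ic_holo[OF ic]]) auto
    have hs: "holo_fun X ?N (\<lambda>y. s y $ i)" for i
      using exhaust_2[of i] ha by (auto simp: s_def intro!: holo_fun_intros)
    \<comment> \<open>The multiplier must be nonzero as a germ: if \<open>p $ 1\<close> vanishes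
      near \<open>x\<close>, then \<open>p $ 2\<close> does not, because the points where \<iota> is
      nonzero are dense.\<close>
    have "s x = 0"
    proof (cases "\<forall>M. open M \<and> x \<in> M \<and> M \<subseteq> ?N \<longrightarrow> (\<exists>y\<in>M. p y $ 1 \<noteq> 0)")
      case nz: True
      show ?thesis
      proof (rule torsion_freeD[OF ic N hp[of 1] hs holo_fun_uminus[OF ha[of 2]] _ _ True])
        show "p y $ 1 *s s y = - a y $ 2 *s p y" if "y \<in> ?N" for y
          using ap'[OF that] by (simp add: vec_eq_iff forall_2 s_def mult.commute)
      qed (use nz in blast)
    next
      case False
      then obtain M where M: "open M" "x \<in> M" "M \<subseteq> ?N" "\<And>y. y \<in> M \<Longrightarrow> p y $ 1 = 0" by blast
      show ?thesis
      proof (rule torsion_freeD[OF ic N hp[of 2] hs ha[of 1] _ _ True])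
        show "p y $ 2 *s s y = a y $ 1 *s p y" if "y \<in> ?N" for y
          using ap'[OF that] by (simp add: vec_eq_iff forall_2 s_def mult.commute)
        fix M' assume M': "open M'" "x \<in> M'" "M' \<subseteq> ?N"
        then obtain y where y: "y \<in> M \<inter> M'" "y \<in> nonzero_pts"
          using nonzero_pts_dense[of "M \<inter> M'"] M by blast
        then have "p y \<noteq> 0" using nonzero_pts_iff[OF ic, of y] M'(3) by blast
        then have "p y $ 2 \<noteq> 0" using M(4)[of y] y by (auto simp: vec_eq_iff forall_2)
        then show "\<exists>y\<in>M'. p y $ 2 \<noteq> 0" using y by blast
      qed
    qed
    then have "a x $ 1 = 0" "a x $ 2 = 0" by (auto simp: s_def vec_eq_iff forall_2)
    then show ?thesis unfolding \<alpha>v by simp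
  qed
qed

text \<open>A functional with \<Lambda>(\<alpha> \<circ> \<iota>) = \<alpha>(v) exists precisely
  when every \<alpha> that vanishes on the image of \<iota> near the base point also vanishes at
  \<open>v\<close>.\<close>

lemma sub_line_locus_eq: "sub_line_locus X L E \<iota> = {line_of E v | v. \<not> vb_is_zero E v \<and> parallel v}"
proof -
  have "(\<exists>\<Lambda>. residue_linear X L (proj E v) (im_dual_stalk X L E \<iota> (proj E v)) \<Lambda> \<and>
           (\<forall>\<alpha> W. open W \<and> proj E v \<in> W \<and> dual_section X E W \<alpha> \<longrightarrow>
              \<Lambda> (dual_germ L (proj E v) (\<alpha> \<circ> \<iota>)) = \<alpha> v)) \<longleftrightarrow> parallel v" (is "?L \<longleftrightarrow> _") for v
  proof
    define x where "x = proj E v"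
    assume ?L
    then obtain \<Lambda> where \<Lambda>: "\<And>\<alpha> W. open W \<Longrightarrow> x \<in> W \<Longrightarrow> dual_section X E W \<alpha> \<Longrightarrow>
        \<Lambda> (dual_germ L x (\<alpha> \<circ> \<iota>)) = \<alpha> v" unfolding x_def by blast
    obtain V \<tau> V' \<sigma> p where ic: "iota_coords V \<tau> V' \<sigma> p" and xV: "x \<in> V" "x \<in> V'"
      by (rule iota_coords_near)
    let ?N = "V \<inter> V'"
    \<comment> \<open>This \<alpha> is the wedge with \<open>p\<close>. It kills the image of
      \<iota>, and its vanishing at \<open>v\<close> is exactly the equation of the
      hypersurface.\<close>
    define a where "a y = (vector [- p y $ 2, p y $ 1] :: complex ^ 2)" for y
    define \<alpha> where "\<alpha> e = (\<Sum>i\<in>UNIV. a (proj E e) $ i * \<tau> e $ i)" for e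
    have \<alpha>w: "\<alpha> e = wedge2 (p (proj E e)) (\<tau> e)" for e
      by (simp add: \<alpha>_def a_def sum_2 wedge2_def)
    have N: "open ?N" "x \<in> ?N" using ic_open[OF ic] xV by auto
    have ds: "dual_section X E ?N \<alpha>"
      unfolding \<alpha>_def
    proof (rule dual_section_coords[OF X E ic_triv(1)[OF ic] N(1)])
      show "holo_fun X ?N (\<lambda>x. a x $ i)" for i
        using exhaust_2[of i] ic_holo[OF ic] by (auto simp: a_def intro!: holo_fun_intros)
    qed auto
    \<comment> \<open>The property of \<Lambda> in use is its value on germs of the form \<alpha>
      \<circ> \<iota>, so its value at the zero germ is read off from the zero section.\<close>
    have ds0: "dual_section X E ?N (\<lambda>e. 0 * \<alpha> e + 0 * \<alpha> e)"
      using dual_section_combination[OF ds ds, of UNIV "\<lambda>_. 0" "\<lambda>_. 0"] by (simp add: holo_fun_const)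
    have "dual_germ L x (\<alpha> \<circ> \<iota>) = dual_germ L x ((\<lambda>e. 0 * \<alpha> e + 0 * \<alpha> e) \<circ> \<iota>)"
      unfolding dual_germ_eq_iff
    proof (intro exI[of _ ?N] conjI allI impI N)
      fix e assume "proj L e \<in> ?N"
      then show "(\<alpha> \<circ> \<iota>) e = ((\<lambda>e. 0 * \<alpha> e + 0 * \<alpha> e) \<circ> \<iota>) e"
        using ic_eq[OF ic, of e] by (simp add: \<alpha>w wedge2_scale) (simp add: wedge2_def)
    qed
    then have "\<alpha> v = 0" using \<Lambda>[OF N ds] \<Lambda>[OF N ds0] by simp
    then show "parallel v" using parallel_iff[OF ic] xV by (simp add: \<alpha>w x_def)
  next
    define x where "x = proj E v"
    assume R: "parallel v"
    define P where "P G \<alpha> \<longleftrightarrow> (\<exists>W. open W \<and> x \<in> W \<and> dual_section X E W \<alpha> \<and> G = dual_germ L x (\<alpha> \<circ> \<iota>))" for G \<alpha>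
    have uniq: "\<alpha> v = \<beta> v" if P1: "P G \<alpha>" and P2: "P G \<beta>" for G \<alpha> \<beta>
    proof -
      obtain W1 where W1: "open W1" "x \<in> W1" "dual_section X E W1 \<alpha>" "G = dual_germ L x (\<alpha> \<circ> \<iota>)"
        using P1 unfolding P_def by blast
      obtain W2 where W2: "open W2" "x \<in> W2" "dual_section X E W2 \<beta>" "G = dual_germ L x (\<beta> \<circ> \<iota>)"
        using P2 unfolding P_def by blast
      note W = W1(1-3) W2(1-3)
      have eq: "dual_germ L x (\<alpha> \<circ> \<iota>) = dual_germ L x (\<beta> \<circ> \<iota>)" using W1(4) W2(4) by simp
      obtain W where W': "open W" "x \<in> W" "\<And>e. proj L e \<in> W \<Longrightarrow> \<alpha> (\<iota> e) = \<beta> (\<iota> e)"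
        using eq unfolding dual_germ_eq_iff by auto
      have "dual_section X E (W \<inter> W1 \<inter> W2) (\<lambda>e. 1 * \<alpha> e + (- 1) * \<beta> e)"
        by (rule dual_section_combination[OF W(3,6)]) (rule holo_fun_const)+
      from dual_section_vanishing[OF R _ _ this] have "1 * \<alpha> v + (- 1) * \<beta> v = 0"
        using W W' by (auto simp: x_def)
      then show ?thesis by simp
    qed
    \<comment> \<open>Evaluation at \<open>v\<close> of an arbitrarily chosen section inducing the
      germ; \<open>uniq\<close> makes the choice immaterial.\<close>
    define \<Lambda> where "\<Lambda> G = (SOME \<alpha>. P G \<alpha>) v" for G
    have \<Lambda>: "\<Lambda> G = \<alpha> v" if "P G \<alpha>" for G \<alpha>
      unfolding \<Lambda>_def using uniq[OF someI[of "P G", OF that] that] .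
    have "residue_linear X L x (im_dual_stalk X L E \<iota> x) \<Lambda>"
      unfolding residue_linear_def
    proof (intro allI impI, elim conjE)
      fix W h k \<beta> \<gamma>
      assume W: "open W" "x \<in> W" and h: "holo_fun X W h" and k: "holo_fun X W k"
        and \<beta>: "dual_germ L x \<beta> \<in> im_dual_stalk X L E \<iota> x" and \<gamma>: "dual_germ L x \<gamma> \<in> im_dual_stalk X L E \<iota> x"
      obtain \<alpha>1 W1 where 1: "dual_germ L x \<beta> = dual_germ L x (\<alpha>1 \<circ> \<iota>)" "open W1" "x \<in> W1" "dual_section X E W1 \<alpha>1"
        using \<beta> unfolding im_dual_stalk_def by blast
      obtain \<alpha>2 W2 where 2: "dual_germ L x \<gamma> = dual_germ L x (\<alpha>2 \<circ> \<iota>)" "open W2" "x \<in> W2" "dual_section X E W2 \<alpha>2"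
        using \<gamma> unfolding im_dual_stalk_def by blast
      let ?\<alpha> = "\<lambda>e. h (proj E e) * \<alpha>1 e + k (proj E e) * \<alpha>2 e"
      obtain N1 where N1: "open N1" "x \<in> N1" "\<And>e. proj L e \<in> N1 \<Longrightarrow> \<beta> e = \<alpha>1 (\<iota> e)"
        using 1(1) unfolding dual_germ_eq_iff by auto
      obtain N2 where N2: "open N2" "x \<in> N2" "\<And>e. proj L e \<in> N2 \<Longrightarrow> \<gamma> e = \<alpha>2 (\<iota> e)"
        using 2(1) unfolding dual_germ_eq_iff by auto
      have eq: "dual_germ L x (\<lambda>e. h (proj L e) * \<beta> e + k (proj L e) * \<gamma> e) = dual_germ L x (?\<alpha> \<circ> \<iota>)"
        unfolding dual_germ_eq_iff
        by (intro exI[of _ "N1 \<inter> N2"]) (use N1 N2 in auto)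
      have "dual_section X E (W \<inter> W1 \<inter> W2) ?\<alpha>"
        by (rule dual_section_combination[OF 1(4) 2(4) h k])
      then have "P (dual_germ L x (\<lambda>e. h (proj L e) * \<beta> e + k (proj L e) * \<gamma> e)) ?\<alpha>"
        unfolding P_def eq by (intro exI[of _ "W \<inter> W1 \<inter> W2"]) (use W 1 2 in auto)
      moreover have "P (dual_germ L x \<beta>) \<alpha>1" "P (dual_germ L x \<gamma>) \<alpha>2"
        unfolding P_def using 1 2 by blast+
      ultimately show "\<Lambda> (dual_germ L x (\<lambda>e. h (proj L e) * \<beta> e + k (proj L e) * \<gamma> e)) =
          h x * \<Lambda> (dual_germ L x \<beta>) + k x * \<Lambda> (dual_germ L x \<gamma>)"
        by (simp add: \<Lambda> x_def)
    qed
    moreover have "\<Lambda> (dual_germ L x (\<alpha> \<circ> \<iota>)) = \<alpha> v" if "open W" "x \<in> W" "dual_section X E W \<alpha>" for \<alpha> W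
      by (rule \<Lambda>) (use that in \<open>auto simp: P_def\<close>)
    ultimately show ?L unfolding x_def by blast
  qed
  then show ?thesis unfolding sub_line_locus_def by simp
qed

lemma parallel_scale:
  assumes v: "parallel v" shows "parallel (vb_scale E c v)"
  unfolding parallel_def vb_scale(1)[OF X E]
proof clarify
  fix e V \<tau> assume e: "proj L e = proj E v" and t: "(V, \<tau>) \<in> trivs E" "proj E v \<in> V"
  then have "wedge2 (\<tau> (\<iota> e)) (\<tau> v) = 0" using v unfolding parallel_def by blast
  then show "wedge2 (\<tau> (\<iota> e)) (\<tau> (vb_scale E c v)) = 0"
    using vb_scale(2)[OF X E t] by (simp add: wedge2_scale)
qed

lemma sub_line_locus_analytic: "analytic_in (proj_atlas X E) (sub_line_locus X L E \<iota>)"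
  unfolding sub_line_locus_eq
proof (rule analytic_in_lines[OF X E])
  fix U \<phi> V \<tau> x assume c: "(U, \<phi>) \<in> X" "x \<in> U" and t: "(V, \<tau>) \<in> trivs E" "x \<in> V"
  obtain V' \<sigma> where t': "(V', \<sigma>) \<in> trivs L" "x \<in> V'" using triv_covered[OF X L] .
  obtain p where ic: "iota_coords V \<tau> V' \<sigma> p" using iota_coords_exist[OF t(1) t'(1)] .
  let ?N = "U \<inter> V \<inter> V'"
  have "fibrewise_holo X ?N (\<lambda>x w. wedge2 (p x) w)"
    unfolding wedge2_def
    by (intro fibrewise_holo_intros holo_fun_subset[OF ic_holo[OF ic]]) auto
  moreover have "open ?N" "x \<in> ?N"
    using ic_open[OF ic] complex_manifold_chart(1)[OF X c(1)] c t t' by auto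
  ultimately show "\<exists>N F. open N \<and> x \<in> N \<and> N \<subseteq> U \<inter> V \<and> finite F \<and> (\<forall>f\<in>F. fibrewise_holo X N f) \<and>
        (\<forall>v. proj E v \<in> N \<longrightarrow> \<not> vb_is_zero E v \<longrightarrow> parallel v \<longleftrightarrow> (\<forall>f\<in>F. f (proj E v) (\<tau> v) = 0))"
    using parallel_iff[OF ic]
    by (intro exI[of _ ?N] exI[of _ "{\<lambda>x w. wedge2 (p x) w}"]) auto
qed (rule parallel_scale)

end

section \<open>Irreducibility of the locus\<close>

lemma open_chart_vimage:
  assumes "complex_manifold X" "(U, \<phi>) \<in> X" "open N"
  shows "open {y \<in> U. \<phi> y \<in> N}"
proof -
  have "open (U \<inter> \<phi> -` N)"
    using complex_manifold_chart[OF assms(1,2)] assms(3) unfolding homeomorphism_def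
    by (intro continuous_open_preimage) auto
  then show ?thesis by (simp add: Int_def vimage_def)
qed

lemma chart_ball:
  assumes X: "complex_manifold X" and c: "(U, \<phi>) \<in> X" and W: "open W" "x \<in> W" "W \<subseteq> U"
  obtains r where "r > 0" "open {y \<in> U. \<phi> y \<in> ball (\<phi> x) r}" "{y \<in> U. \<phi> y \<in> ball (\<phi> x) r} \<subseteq> W"
    "\<phi> ` {y \<in> U. \<phi> y \<in> ball (\<phi> x) r} = ball (\<phi> x) r"
proof -
  have "open (\<phi> ` W)" by (rule complex_manifold_chart_image[OF X c W(1,3)])
  then obtain r where r: "r > 0" "ball (\<phi> x) r \<subseteq> \<phi> ` W"
    using W(2) open_contains_ball by blast
  show ?thesis
  proof (rule that[OF r(1) open_chart_vimage[OF X c open_ball]])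
    show "{y \<in> U. \<phi> y \<in> ball (\<phi> x) r} \<subseteq> W"
    proof
      fix y assume y: "y \<in> {y \<in> U. \<phi> y \<in> ball (\<phi> x) r}"
      then obtain w where w: "w \<in> W" "\<phi> y = \<phi> w" using r(2) by blast
      then have "y = w"
        using complex_manifold_chart(4)[OF X c] W(3) y by (auto simp: inj_on_def)
      then show "y \<in> W" using w by simp
    qed
    show "\<phi> ` {y \<in> U. \<phi> y \<in> ball (\<phi> x) r} = ball (\<phi> x) r"
      using r(2) W(3) by blast
  qed
qed

lemma continuous_on_vector_3:
  assumes "continuous_on A f" "continuous_on A g" "continuous_on A h"
  shows "continuous_on A (\<lambda>x. vector [f x, g x, h x] :: complex ^ 3)"
proof -
  have "continuous_on A (\<lambda>x. \<chi> i. (vector [f x, g x, h x] :: complex ^ 3) $ i)"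
  proof (rule continuous_on_vec_lambda)
    fix i :: 3
    show "continuous_on A (\<lambda>x. (vector [f x, g x, h x] :: complex ^ 3) $ i)"
      using exhaust_3[of i] assms by auto
  qed
  then show ?thesis by simp
qed

section \<open>The graph over the complement of the zeros, and analytic sets containing it\<close>

context sub_line_setting
begin

definition generic_locus :: "'e set set" where
  "generic_locus = {line_of E (\<iota> e) | e. \<not> vb_is_zero E (\<iota> e)}"

lemma generic_locus_subset: "generic_locus \<subseteq> sub_line_locus X L E \<iota>"
proof -
  have "parallel (\<iota> e)" for e
  proof -
    obtain V \<tau> V' \<sigma> p where ic: "iota_coords V \<tau> V' \<sigma> p" and xV: "proj L e \<in> V" "proj L e \<in> V'"
      by (rule iota_coords_near)
    show ?thesis
      using parallel_iff[OF ic, of "\<iota> e"] ic_eq[OF ic, of e] xV by (simp add: wedge2_scale) (simp add: wedge2_def)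
  qed
  then show ?thesis unfolding generic_locus_def sub_line_locus_eq by blast
qed

lemma parallel_line_eq:
  assumes v: "parallel v" "\<not> vb_is_zero E v" and e: "proj L e = proj E v" "\<not> vb_is_zero E (\<iota> e)"
  shows "line_of E v = line_of E (\<iota> e)"
proof -
  obtain V \<tau> where t: "(V, \<tau>) \<in> trivs E" "proj E v \<in> V" using triv_covered[OF X E] .
  have "wedge2 (\<tau> (\<iota> e)) (\<tau> v) = 0" using v e t unfolding parallel_def by blast
  moreover have "\<tau> (\<iota> e) \<noteq> 0" "\<tau> v \<noteq> 0"
    using vb_is_zero_iff[OF X E t(1)] v e t by auto
  ultimately obtain c where "\<tau> v = c *s \<tau> (\<iota> e)" "c \<noteq> 0"
    using wedge2_eq_0_imp by (metis vector_smult_lzero)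
  then show ?thesis by (intro line_of_eqI[OF X E t(1)]) (use e t in auto)
qed

lemma iota_line_eq:
  assumes "proj L e = proj L e'" "\<not> vb_is_zero E (\<iota> e)" "\<not> vb_is_zero E (\<iota> e')"
  shows "line_of E (\<iota> e) = line_of E (\<iota> e')"
proof (rule parallel_line_eq)
  have "line_of E (\<iota> e) \<in> generic_locus" using assms unfolding generic_locus_def by blast
  then obtain v where v: "line_of E (\<iota> e) = line_of E v" "parallel v" "\<not> vb_is_zero E v"
    using generic_locus_subset unfolding sub_line_locus_eq by blast
  obtain c where "\<iota> e = vb_scale E c v" using line_of_eqD[OF X E v(1)[symmetric]] .
  then show "parallel (\<iota> e)" using parallel_scale v by simp
qed (use assms in auto)

text \<open>
  Near a zero \<open>x\<close> of \<open>\<iota> = (a, b)\<close>, a point \<open>[1 : u\<^sub>0]\<close> of the fibre that is not a limit of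
  points of the graph of \<open>b / a\<close> gives a bound \<open>|a| \<le> C |b - u\<^sub>0 a|\<close>.  By the extension theorem
  \<open>b - u\<^sub>0 a\<close> divides \<open>a\<close> and \<open>b\<close>, contrary to torsion-freeness.
\<close>

lemma analytic_superset_generic_locus:
  assumes S: "analytic_in (proj_atlas X E) S" and gen: "generic_locus \<subseteq> S"
  shows "sub_line_locus X L E \<iota> \<subseteq> S"
proof
  fix l assume "l \<in> sub_line_locus X L E \<iota>"
  then obtain v0 where v0: "l = line_of E v0" "\<not> vb_is_zero E v0" "parallel v0"
    unfolding sub_line_locus_eq by blast
  define x where "x = proj E v0"
  obtain U \<phi> where c: "(U, \<phi>) \<in> X" "x \<in> U" using complex_manifold_covered[OF X] .
  obtain V \<tau> V' \<sigma> p where ic: "iota_coords V \<tau> V' \<sigma> p" and xV: "x \<in> V" "x \<in> V'"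
    by (rule iota_coords_near)
  note tE = ic_triv(1)[OF ic] and inj\<phi> = complex_manifold_chart(4)[OF X c(1)]
  obtain k where k: "\<tau> v0 $ k \<noteq> 0"
    using vb_is_zero_iff[OF X E tE, of v0] v0 xV by (auto simp: x_def vec_eq_iff)
  define v where "v = vb_scale E (1 / \<tau> v0 $ k) v0"
  have v: "proj E v = x" "\<tau> v = (1 / \<tau> v0 $ k) *s \<tau> v0"
    unfolding v_def using vb_scale[OF X E] tE xV by (auto simp: x_def)
  have l: "l = line_of E v"
    unfolding v0(1) by (rule sym, rule line_of_eqI[OF X E tE, of _ _ "1 / \<tau> v0 $ k"]) (use v xV k in \<open>auto simp: x_def\<close>)
  have vk: "\<tau> v $ k = 1" using v k by simp
  define u0 where "u0 = \<tau> v $ other k"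
  show "l \<in> S"
  proof (cases "x \<in> nonzero_pts")
    case True
    then obtain e where "proj L e = x" "\<not> vb_is_zero E (\<iota> e)" unfolding nonzero_pts_def by blast
    then show ?thesis using parallel_line_eq[OF v0(3,2), of e] v0(1) gen by (auto simp: x_def generic_locus_def)
  next
    case False
    then have px: "p x = 0" using nonzero_pts_iff[OF ic xV] by simp
    let ?D = "proj_dom (U, \<phi>) (V, \<tau>)" and ?l = "proj_line E (U, \<phi>) (V, \<tau>) k"
    define emb where "emb z u = (vector [z $ 1, z $ 2, u] :: complex ^ 3)" for z :: "complex ^ 2" and u
    have base [simp]: "base_pt (emb z u) = z" for z u by (simp add: emb_def vec_eq_iff forall_2)
    have lq0: "?l (emb (\<phi> x) u0) = l"
      using proj_line_eq[OF X E c(1) tE, of v k] v vk c xV by (simp add: l u0_def emb_def)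
    have q0: "emb (\<phi> x) u0 \<in> ?D" using c xV by (simp add: proj_dom_def)
    show ?thesis
    proof (rule ccontr)
      assume "l \<notin> S"
      have "analytic_subset ?D {q \<in> ?D. ?l q \<in> S}"
        using S c tE unfolding analytic_in_proj_atlas_iff[OF X E] by blast
      then obtain N F where N: "open N" "emb (\<phi> x) u0 \<in> N" "N \<subseteq> ?D" and F: "\<forall>f\<in>F. holo_on N f"
        "{q \<in> ?D. ?l q \<in> S} \<inter> N = {z \<in> N. \<forall>f\<in>F. f z = 0}"
        using q0 unfolding analytic_subset_def by meson
      have "emb (\<phi> x) u0 \<notin> {q \<in> ?D. ?l q \<in> S} \<inter> N" using lq0 \<open>l \<notin> S\<close> by simp
      \<comment> \<open>An equation of \<open>S\<close> that fails at the point is nonzero on a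
        neighbourhood \<open>Q\<close>, so \<open>Q\<close> misses \<open>S\<close> and with it the
        graph.\<close>
      then obtain f where f: "f \<in> F" "f (emb (\<phi> x) u0) \<noteq> 0" unfolding F(2) using N by blast
      define Q where "Q = N \<inter> f -` (- {0})"
      have Q: "open Q" "emb (\<phi> x) u0 \<in> Q"
        unfolding Q_def using f N F
        by (auto intro!: continuous_open_preimage holo_on_imp_continuous_on)
      have QS: "?l q \<notin> S" if "q \<in> Q" for q
        using that F(2) f(1) N(3) by (auto simp: Q_def)
      have "open ((\<lambda>r. emb (fst r) (snd r)) -` Q)"
        unfolding emb_def
        by (intro open_vimage Q(1) continuous_on_vector_3 continuous_intros)
      moreover have "(\<phi> x, u0) \<in> (\<lambda>r. emb (fst r) (snd r)) -` Q" using Q by simp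
      ultimately obtain A B where AB0: "open A" "open B" "(\<phi> x, u0) \<in> A \<times> B"
        and AB: "A \<times> B \<subseteq> (\<lambda>r. emb (fst r) (snd r)) -` Q"
        by (rule open_prod_elim)
      obtain \<epsilon> where \<epsilon>: "\<epsilon> > 0" "ball u0 \<epsilon> \<subseteq> B" using AB0 open_contains_ball by blast
      let ?Y = "U \<inter> V \<inter> V'"
      have Y: "open ?Y" using complex_manifold_chart(1)[OF X c(1)] ic_open[OF ic] by blast
      define W where "W = \<phi> ` ?Y \<inter> A"
      have W: "open W" "\<phi> x \<in> W"
        using complex_manifold_chart_image[OF X c(1) Y] AB0 c xV by (auto simp: W_def)
      define P where "P i z = p (inv_into U \<phi> z) $ i" for i z
      have P\<phi>: "P i (\<phi> y) = p y $ i" if "y \<in> U" for i y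
        using that inj\<phi> by (simp add: P_def)
      have holP: "holo_on W (P i)" for i
      proof -
        have "holo_fun X ?Y (\<lambda>y. p y $ i)" by (rule holo_fun_subset[OF ic_holo[OF ic]]) auto
        from holo_fun_chartD[OF this c(1)] have "holo_on (\<phi> ` (U \<inter> ?Y)) (P i)"
          by (simp add: o_def P_def[abs_def])
        then show ?thesis by (rule holo_on_subset) (auto simp: W_def)
      qed
      have holh: "holo_on W (\<lambda>z. P (other k) z - u0 * P k z)"
        by (intro holo_on_intros holP)
      \<comment> \<open>If the coordinate \<open>P k z\<close> is nonzero, the graph has affine
        coordinate \<open>u = P (other k) z / P k z\<close> over \<open>z\<close>. The graph avoids
        \<open>Q\<close>, so \<open>u\<close> has distance at least \<epsilon> from
        \<open>u0\<close>; clearing the denominator gives the constant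
        \<open>1 / \<epsilon>\<close>.\<close>
      have bd: "norm (P k z) \<le> (1 / \<epsilon>) * norm (P (other k) z - u0 * P k z)" if z: "z \<in> W" for z
      proof (cases "P k z = 0")
        case True then show ?thesis using \<epsilon> by simp
      next
        case False
        obtain y where y: "y \<in> ?Y" "z = \<phi> y" "z \<in> A" using z unfolding W_def by blast
        define u where "u = P (other k) z / P k z"
        have "emb z u \<notin> Q"
        proof
          assume "emb z u \<in> Q"
          have zD: "emb z u \<in> ?D" using y by (auto simp: proj_dom_def)
          have y': "y = inv_into U \<phi> (base_pt (emb z u))" using y inj\<phi> by simp
          note r = proj_line_rep(3-5)[OF X E c(1) tE zD, where k = k, folded y']
          obtain e where e: "proj L e = y" "\<sigma> e $ 1 = 1" using ic_frame[OF ic] y by blast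
          have \<tau>e: "\<tau> (\<iota> e) = p y" using ic_eq[OF ic, of e] e y by simp
          have pk: "p y $ k \<noteq> 0" using False y P\<phi> by simp
          have u: "u = p y $ other k / p y $ k" unfolding u_def y(2) using P\<phi> y(1) by simp
          have "\<tau> (fibre_vec E \<tau> y (affine_vec k (emb z u $ 3))) = (1 / p y $ k) *s \<tau> (\<iota> e)"
            unfolding r(2) \<tau>e using pk by (simp add: vec2_eq_iff[of _ _ k] emb_def u)
          then have "?l (emb z u) = line_of E (\<iota> e)"
            unfolding r(3) by (intro line_of_eqI[OF X E tE, of _ _ "1 / p y $ k"]) (use r(1) e y pk in auto)
          moreover have "\<not> vb_is_zero E (\<iota> e)"
            using vb_is_zero_iff[OF X E tE, of "\<iota> e"] \<tau>e pk e y by auto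
          ultimately have "?l (emb z u) \<in> S" using gen unfolding generic_locus_def by blast
          then show False using QS[OF \<open>emb z u \<in> Q\<close>] by blast
        qed
        then have "(z, u) \<notin> A \<times> B" using AB by auto
        then have "u \<notin> ball u0 \<epsilon>" using y(3) \<epsilon>(2) by blast
        then have "\<epsilon> \<le> norm (u - u0)" by (simp add: dist_norm norm_minus_commute)
        then have "\<epsilon> * norm (P k z) \<le> norm (u - u0) * norm (P k z)"
          by (rule mult_right_mono) simp
        also have "\<dots> = norm (P (other k) z - u0 * P k z)"
          using False by (simp add: u_def norm_mult[symmetric] algebra_simps)
        finally show ?thesis using \<epsilon> by (simp add: field_simps)
      qed
      \<comment> \<open>Where the denominator vanishes, the bound makes \<open>p $ k\<close> vanish,
        and then the other coordinate too; this cannot happen throughout an open set.\<close>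
      have nz: "\<exists>y\<in>M. p y $ other k - u0 * p y $ k \<noteq> 0" if M: "open M" "x \<in> M" "M \<subseteq> ?Y" "\<phi> ` M \<subseteq> W" for M
      proof (rule ccontr)
        assume neg: "\<not> ?thesis"
        obtain y where y: "y \<in> M" "y \<in> nonzero_pts" using nonzero_pts_dense[of M] M by blast
        have yY: "y \<in> U" "y \<in> V" "y \<in> V'" using y M by auto
        have "p y $ other k - u0 * p y $ k = 0" using neg y by blast
        moreover then have "p y $ k = 0"
          using bd[of "\<phi> y"] y M(4) P\<phi>[OF yY(1)] by auto
        ultimately have "p y = 0" by (simp add: vec2_eq_iff[of _ _ k])
        then show False using nonzero_pts_iff[OF ic yY(2,3)] y by simp
      qed
      have nzW: "\<exists>z\<in>N. P (other k) z - u0 * P k z \<noteq> 0" if N: "open N" "\<phi> x \<in> N" "N \<subseteq> W" for N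
      proof -
        have "\<exists>y\<in>{y \<in> U. \<phi> y \<in> N} \<inter> ?Y. p y $ other k - u0 * p y $ k \<noteq> 0"
          by (rule nz) (use N c xV Y open_chart_vimage[OF X c(1) N(1)] in auto)
        then obtain y where y: "y \<in> U" "\<phi> y \<in> N" "p y $ other k - u0 * p y $ k \<noteq> 0" by blast
        then have "P (other k) (\<phi> y) - u0 * P k (\<phi> y) \<noteq> 0" using P\<phi> by simp
        then show ?thesis using y(2) by blast
      qed
      obtain N1 G where N1: "open N1" "\<phi> x \<in> N1" "N1 \<subseteq> W" and G: "holo_on N1 G"
        "\<And>z. z \<in> N1 \<Longrightarrow> P k z = G z * (P (other k) z - u0 * P k z)"
      proof (rule bounded_quotient_extension_vec[OF W holP[of k] holh])
        show "norm (P k z) \<le> (1 / \<epsilon>) * norm (P (other k) z - u0 * P k z)" if "z \<in> W" for z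
          by (rule bd[OF that])
        show "\<exists>z\<in>N. P (other k) z - u0 * P k z \<noteq> 0" if "open N" "\<phi> x \<in> N" "N \<subseteq> W" for N
          by (rule nzW[OF that])
      qed (rule that)
      define M where "M = {y \<in> U. \<phi> y \<in> N1} \<inter> ?Y"
      have M: "open M" "x \<in> M" "M \<subseteq> V \<inter> V'" "M \<subseteq> U" "\<phi> ` M \<subseteq> N1"
        unfolding M_def using open_chart_vimage[OF X c(1) N1(1)] Y N1 c xV by auto
      have hM: "holo_fun X M (\<lambda>y. p y $ i)" for i by (rule holo_fun_subset[OF ic_holo[OF ic]]) (use M in auto)
      have GM: "holo_fun X M (\<lambda>y. G (\<phi> y))"
      proof (rule holo_fun_chartI[OF X c(1) M(1,4)], rule holo_on_transform)
        show "holo_on (\<phi> ` M) G" by (rule holo_on_subset[OF G(1) M(5)])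
        show "open (\<phi> ` M)" by (rule complex_manifold_chart_image[OF X c(1) M(1,4)])
      qed (use inj\<phi> M(4) in \<open>auto simp: subset_iff\<close>)
      \<comment> \<open>With \<open>d = p $ other k - u0 * p $ k\<close> and
        \<open>p $ k = G * d\<close>, the other coordinate is \<open>(1 + u0 * G) * d\<close>, so
        \<open>d * s = p\<close>. Both coordinates of \<open>s\<close> cannot vanish at
        \<open>x\<close>, since \<open>G = 0\<close> makes the other one 1.\<close>
      define s where "s y = (\<chi> i. if i = k then G (\<phi> y) else 1 + u0 * G (\<phi> y))" for y
      have "s x = 0"
      proof (rule torsion_freeD[OF ic M(1-3), where h = "\<lambda>y. p y $ other k - u0 * p y $ k" and g = "\<lambda>_. 1"])
        show "holo_fun X M (\<lambda>y. p y $ other k - u0 * p y $ k)" by (intro holo_fun_intros hM)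
        show "holo_fun X M (\<lambda>y. s y $ i)" for i
          by (cases "i = k") (auto simp: s_def intro!: holo_fun_intros GM)
        show "holo_fun X M (\<lambda>_. 1)" by (rule holo_fun_const)
        show "(p y $ other k - u0 * p y $ k) *s s y = 1 *s p y" if y: "y \<in> M" for y
        proof -
          have yU: "y \<in> U" and "\<phi> y \<in> N1" using y M by auto
          then have 1: "(p y $ other k - u0 * p y $ k) * G (\<phi> y) = p y $ k"
            using G(2)[of "\<phi> y"] P\<phi>[OF yU] by (simp add: mult.commute)
          have "(p y $ other k - u0 * p y $ k) * (1 + u0 * G (\<phi> y)) =
              (p y $ other k - u0 * p y $ k) + u0 * ((p y $ other k - u0 * p y $ k) * G (\<phi> y))"
            by (simp add: algebra_simps)
          then have "(p y $ other k - u0 * p y $ k) * (1 + u0 * G (\<phi> y)) = p y $ other k"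
            unfolding 1 by simp
          with 1 show ?thesis by (simp add: vec2_eq_iff[of _ _ k] s_def left_diff_distrib)
        qed
        show "\<exists>y\<in>M'. p y $ other k - u0 * p y $ k \<noteq> 0" if "open M'" "x \<in> M'" "M' \<subseteq> M" for M'
        proof (rule nz)
          show "M' \<subseteq> ?Y" using that(3) unfolding M_def by blast
          show "\<phi> ` M' \<subseteq> W" using that(3) M(5) N1(3) by blast
        qed (use that in auto)
      qed (rule px)
      then have "s x $ k = 0" "s x $ other k = 0" by simp_all
      then show False by (simp add: s_def)
    qed
  qed
qed

text \<open>In a coordinate ball the zeros of \<iota> are the common zeros of two holomorphic
  functions, whose complement is connected. Being dense and open, the set inherits connectedness
  from the base.\<close>

lemma connected_nonzero_pts: "connected nonzero_pts"
proof (rule connected_dense_subset[OF conn open_nonzero_pts])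
  show "closure nonzero_pts = UNIV"
  proof -
    have "x \<in> closure nonzero_pts" for x
      unfolding closure_iff_nhds_not_empty using nonzero_pts_dense by blast
    then show ?thesis by blast
  qed
  fix x
  obtain U \<phi> where c: "(U, \<phi>) \<in> X" "x \<in> U" using complex_manifold_covered[OF X] .
  obtain V \<tau> V' \<sigma> p where ic: "iota_coords V \<tau> V' \<sigma> p" and xV: "x \<in> V" "x \<in> V'"
    by (rule iota_coords_near)
  let ?Y = "U \<inter> V \<inter> V'"
  have Y: "open ?Y" "x \<in> ?Y" "?Y \<subseteq> U"
    using complex_manifold_chart(1)[OF X c(1)] ic_open[OF ic] c xV by auto
  obtain r where r: "r > 0" "open {y \<in> U. \<phi> y \<in> ball (\<phi> x) r}" "{y \<in> U. \<phi> y \<in> ball (\<phi> x) r} \<subseteq> ?Y"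
    "\<phi> ` {y \<in> U. \<phi> y \<in> ball (\<phi> x) r} = ball (\<phi> x) r"
    by (rule chart_ball[OF X c(1) Y]) (rule that)
  let ?N = "{y \<in> U. \<phi> y \<in> ball (\<phi> x) r}"
  note ch = complex_manifold_chart[OF X c(1)]
  have hol: "holo_on (ball (\<phi> x) r) (\<lambda>z. p (inv_into U \<phi> z) $ i)" for i
  proof -
    have "holo_fun X ?N (\<lambda>y. p y $ i)" by (rule holo_fun_subset[OF ic_holo[OF ic]]) (use r(3) in blast)
    from holo_fun_chartD[OF this c(1)] have "holo_on (\<phi> ` (U \<inter> ?N)) (\<lambda>z. p (inv_into U \<phi> z) $ i)"
      by (simp add: o_def)
    moreover have "U \<inter> ?N = ?N" by blast
    ultimately show ?thesis using r(4) by simp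
  qed
  let ?C = "{z \<in> ball (\<phi> x) r. p (inv_into U \<phi> z) $ 1 \<noteq> 0 \<or> p (inv_into U \<phi> z) $ 2 \<noteq> 0}"
  have sub: "ball (\<phi> x) r \<subseteq> \<phi> ` U" using r(4) by blast
  have "continuous_on ?C (inv_into U \<phi>)"
    by (rule continuous_on_subset[of "\<phi> ` U"]) (use ch(2) sub in \<open>auto simp: homeomorphism_def\<close>)
  then have "connected (inv_into U \<phi> ` ?C)"
    by (rule connected_continuous_image[OF _ connected_common_zero_complement[OF hol hol]])
  moreover have "inv_into U \<phi> ` ?C = ?N \<inter> nonzero_pts"
  proof (intro set_eqI iffI)
    fix y assume "y \<in> inv_into U \<phi> ` ?C"
    then obtain z where z: "z \<in> ?C" "y = inv_into U \<phi> z" by blast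
    then have "y \<in> ?N" using sub inv_into_into[of z \<phi> U] f_inv_into_f[of z \<phi> U] by auto
    moreover then have "y \<in> V" "y \<in> V'" using r(3) by auto
    ultimately show "y \<in> ?N \<inter> nonzero_pts"
      using nonzero_pts_iff[OF ic, of y] z by auto
  next
    fix y assume y: "y \<in> ?N \<inter> nonzero_pts"
    then have "y \<in> V" "y \<in> V'" using r(3) by auto
    then have "p y \<noteq> 0" using nonzero_pts_iff[OF ic, of y] y by blast
    then have "p y $ 1 \<noteq> 0 \<or> p y $ 2 \<noteq> 0" by (auto simp: vec_eq_iff forall_2)
    then show "y \<in> inv_into U \<phi> ` ?C"
      using y ch(4) by (intro image_eqI[of _ _ "\<phi> y"]) auto
  qed
  ultimately show "\<exists>N. open N \<and> x \<in> N \<and> connected (N \<inter> nonzero_pts)"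
    using r(1,2) c by (intro exI[of _ ?N]) auto
qed

section \<open>Irreducibility, with the graph identified with its base\<close>

definition trace_on :: "'e set set \<Rightarrow> 'a set" where
  "trace_on S = {x. \<exists>e. proj L e = x \<and> \<not> vb_is_zero E (\<iota> e) \<and> line_of E (\<iota> e) \<in> S}"

text \<open>The equations of \<open>S\<close>, pulled back along the graph, describe the trace near
  \<open>x\<close> as a common zero set of holomorphic functions on a coordinate ball. Their
  continuity gives the first alternative and the identity theorem the second.\<close>

lemma trace_on_local:
  assumes S: "analytic_in (proj_atlas X E) S" and x: "x \<in> nonzero_pts"
  obtains N where "open N" "x \<in> N" "N \<subseteq> nonzero_pts"
    "x \<notin> trace_on S \<Longrightarrow> \<exists>M. open M \<and> x \<in> M \<and> M \<inter> trace_on S = {}"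
    "\<And>O'. open O' \<Longrightarrow> O' \<noteq> {} \<Longrightarrow> O' \<subseteq> N \<inter> trace_on S \<Longrightarrow> N \<subseteq> trace_on S"
proof -
  obtain U \<phi> where c: "(U, \<phi>) \<in> X" "x \<in> U" using complex_manifold_covered[OF X] .
  obtain V \<tau> V' \<sigma> p where ic: "iota_coords V \<tau> V' \<sigma> p" and xV: "x \<in> V" "x \<in> V'"
    by (rule iota_coords_near)
  note tE = ic_triv(1)[OF ic] and ch = complex_manifold_chart[OF X c(1)]
  obtain k where k: "p x $ k \<noteq> 0"
    using nonzero_pts_iff[OF ic xV] x by (auto simp: vec_eq_iff)
  let ?D = "proj_dom (U, \<phi>) (V, \<tau>)" and ?l = "proj_line E (U, \<phi>) (V, \<tau>) k"
  define Y where "Y = U \<inter> ((V \<inter> V') \<inter> (\<lambda>y. p y $ k) -` (- {0}))"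
  have Y: "open Y" "x \<in> Y" "Y \<subseteq> U"
  proof -
    have "open ((V \<inter> V') \<inter> (\<lambda>y. p y $ k) -` (- {0}))"
      by (intro continuous_open_preimage iota_coords_continuous[OF ic] open_Int ic_open[OF ic]) auto
    then show "open Y" using ch(1) unfolding Y_def by blast
  qed (use k c xV in \<open>auto simp: Y_def\<close>)
  \<comment> \<open>The graph in the chart with index \<open>k\<close>, for base points in
    \<open>Y\<close>, where the coordinate \<open>p $ k\<close> is nonzero.\<close>
  define Q where "Q z = (vector [z $ 1, z $ 2, p (inv_into U \<phi> z) $ other k / p (inv_into U \<phi> z) $ k] :: complex ^ 3)" for z
  have QD: "Q (\<phi> y) \<in> ?D" and Ql: "?l (Q (\<phi> y)) \<in> S \<longleftrightarrow> y \<in> trace_on S" if y: "y \<in> Y" for y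
  proof -
    have yV: "y \<in> U" "y \<in> V" "y \<in> V'" "p y $ k \<noteq> 0" using y by (auto simp: Y_def)
    have inv: "inv_into U \<phi> (\<phi> y) = y" using ch(4) yV by simp
    have b: "base_pt (Q (\<phi> y)) = \<phi> y" by (simp add: Q_def vec_eq_iff forall_2)
    show D: "Q (\<phi> y) \<in> ?D" using b yV by (auto simp: proj_dom_def)
    note r = proj_line_rep(3-5)[OF X E c(1) tE D, where k = k, unfolded b inv]
    obtain e where e: "proj L e = y" "\<sigma> e $ 1 = 1" using ic_frame[OF ic yV(3)] .
    have \<tau>e: "\<tau> (\<iota> e) = p y" using ic_eq[OF ic, of e] e yV by simp
    have "\<tau> (fibre_vec E \<tau> y (affine_vec k (Q (\<phi> y) $ 3))) = (1 / p y $ k) *s \<tau> (\<iota> e)"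
      unfolding r(2) \<tau>e using yV inv by (simp add: vec2_eq_iff[of _ _ k] Q_def)
    then have eq: "?l (Q (\<phi> y)) = line_of E (\<iota> e)"
      unfolding r(3) by (intro line_of_eqI[OF X E tE, of _ _ "1 / p y $ k"]) (use r(1) e yV in auto)
    have nz: "\<not> vb_is_zero E (\<iota> e)"
      using vb_is_zero_iff[OF X E tE, of "\<iota> e"] \<tau>e yV e by auto
    show "?l (Q (\<phi> y)) \<in> S \<longleftrightarrow> y \<in> trace_on S"
    proof
      assume "?l (Q (\<phi> y)) \<in> S"
      then show "y \<in> trace_on S" unfolding eq trace_on_def using e(1) nz by blast
    next
      assume "y \<in> trace_on S"
      then obtain e' where e': "proj L e' = y" "\<not> vb_is_zero E (\<iota> e')" "line_of E (\<iota> e') \<in> S"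
        unfolding trace_on_def by blast
      then show "?l (Q (\<phi> y)) \<in> S" unfolding eq using iota_line_eq[of e e'] nz e(1) by simp
    qed
  qed
  have holp: "holo_on (\<phi> ` Y) (\<lambda>z. p (inv_into U \<phi> z) $ i)" for i
  proof -
    have "holo_fun X Y (\<lambda>y. p y $ i)" by (rule holo_fun_subset[OF ic_holo[OF ic]]) (auto simp: Y_def)
    from holo_fun_chartD[OF this c(1)] show ?thesis
      using Y(3) by (simp add: o_def Int_absorb1)
  qed
  have holQ: "holo_on (\<phi> ` Y) (\<lambda>z. Q z $ i)" for i
  proof -
    have "holo_on (\<phi> ` Y) (\<lambda>z. p (inv_into U \<phi> z) $ other k / p (inv_into U \<phi> z) $ k)"
      by (rule holo_on_divide[OF holp holp]) (use ch(4) Y(3) in \<open>auto simp: Y_def\<close>)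
    then show ?thesis using exhaust_3[of i] by (auto simp: Q_def intro: holo_on_component)
  qed
  have "analytic_subset ?D {q \<in> ?D. ?l q \<in> S}"
    using S c tE unfolding analytic_in_proj_atlas_iff[OF X E] by blast
  then obtain N F where N: "open N" "Q (\<phi> x) \<in> N" "N \<subseteq> ?D" and F: "\<forall>f\<in>F. holo_on N f"
    "{q \<in> ?D. ?l q \<in> S} \<inter> N = {z \<in> N. \<forall>f\<in>F. f z = 0}"
    using QD[OF Y(2)] unfolding analytic_subset_def by meson
  have "continuous_on (\<phi> ` Y) Q"
    unfolding Q_def
    by (intro continuous_on_vector_3 holo_on_imp_continuous_on holo_on_divide holp holo_on_component)
      (use ch(4) Y(3) in \<open>auto simp: Y_def\<close>)
  then have "open (\<phi> ` Y \<inter> Q -` N)"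
    by (intro continuous_open_preimage complex_manifold_chart_image[OF X c(1)] Y N)
  from open_chart_vimage[OF X c(1) this] have Z: "open ({y \<in> U. \<phi> y \<in> \<phi> ` Y \<inter> Q -` N} \<inter> Y)" (is "open ?Z")
    using Y(1) by (rule open_Int)
  have Z': "x \<in> ?Z" "?Z \<subseteq> U" using c Y N by auto
  obtain r where r: "r > 0" "open {y \<in> U. \<phi> y \<in> ball (\<phi> x) r}" "{y \<in> U. \<phi> y \<in> ball (\<phi> x) r} \<subseteq> ?Z"
    "\<phi> ` {y \<in> U. \<phi> y \<in> ball (\<phi> x) r} = ball (\<phi> x) r"
    by (rule chart_ball[OF X c(1) Z Z']) (rule that)
  let ?M = "{y \<in> U. \<phi> y \<in> ball (\<phi> x) r}"
  have MY: "y \<in> Y" "Q (\<phi> y) \<in> N" if "y \<in> ?M" for y using r(3) that by auto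
  have tr: "y \<in> trace_on S \<longleftrightarrow> (\<forall>f\<in>F. f (Q (\<phi> y)) = 0)" if y: "y \<in> ?M" for y
  proof -
    have "Q (\<phi> y) \<in> {q \<in> ?D. ?l q \<in> S} \<inter> N \<longleftrightarrow> y \<in> trace_on S"
      using QD Ql MY[OF y] by blast
    then show ?thesis unfolding F(2) using MY[OF y] by blast
  qed
  have ballYN: "z \<in> \<phi> ` Y" "Q z \<in> N" if z: "z \<in> ball (\<phi> x) r" for z
  proof -
    have "z \<in> \<phi> ` ?M" unfolding r(4) by (rule z)
    then obtain y where "y \<in> ?M" "z = \<phi> y" by (rule imageE)
    then show "z \<in> \<phi> ` Y" "Q z \<in> N" using MY by simp_all
  qed
  have ballY: "ball (\<phi> x) r \<subseteq> \<phi> ` Y" using ballYN(1) by (rule subsetI)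
  have holf: "holo_on (ball (\<phi> x) r) (\<lambda>z. f (Q z))" if "f \<in> F" for f
    by (rule holo_on_compose[OF holo_on_subset[OF holQ ballY], of N]) (use F that ballYN(2) in auto)
  show ?thesis
  proof (rule that[of ?M])
    show "open ?M" by (rule r(2))
    show xM: "x \<in> ?M" using c r(1) by simp
    show "?M \<subseteq> nonzero_pts"
    proof
      fix y assume "y \<in> ?M"
      then have "y \<in> Y" using MY by blast
      then show "y \<in> nonzero_pts" using nonzero_pts_iff[OF ic, of y] by (auto simp: Y_def)
    qed
    show "\<exists>M. open M \<and> x \<in> M \<and> M \<inter> trace_on S = {}" if xT: "x \<notin> trace_on S"
    proof -
      obtain f where f: "f \<in> F" "f (Q (\<phi> x)) \<noteq> 0" using tr[OF xM] xT by blast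
      have "open (ball (\<phi> x) r \<inter> (\<lambda>z. f (Q z)) -` (- {0}))"
        by (intro continuous_open_preimage holo_on_imp_continuous_on holf f) auto
      from open_chart_vimage[OF X c(1) this]
      have "open {y \<in> U. \<phi> y \<in> ball (\<phi> x) r \<inter> (\<lambda>z. f (Q z)) -` (- {0})}" (is "open ?O") .
      moreover have "?O \<inter> trace_on S = {}"
        using tr f(1) by auto
      moreover have "x \<in> ?O" using f(2) c(2) r(1) by simp
      ultimately show ?thesis by blast
    qed
    show "?M \<subseteq> trace_on S" if O': "open O'" "O' \<noteq> {}" "O' \<subseteq> ?M \<inter> trace_on S" for O'
    proof -
      have "f (Q z) = 0" if f: "f \<in> F" and z: "z \<in> ball (\<phi> x) r" for f z
      proof (rule holo_on_ball_identity[OF holf[OF f], of "\<phi> ` O'"])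
        show "open (\<phi> ` O')" by (rule complex_manifold_chart_image[OF X c(1)]) (use O' in auto)
        show "f (Q w) = 0" if "w \<in> \<phi> ` O'" for w using that O'(3) tr f by blast
      qed (use O' z in auto)
      then show ?thesis using tr by blast
    qed
  qed
qed

text \<open>The traces of \<open>S1\<close> and \<open>S2\<close> cover the connected set
  \<open>nonzero_pts\<close>. If the second misses a point, the first contains a neighbourhood of
  it; the interior of the first is then nonempty, open and relatively closed, hence everything. An
  analytic set containing the whole graph contains the locus.\<close>

lemma sub_line_locus_irreducible: "irreducible_analytic (proj_atlas X E) (sub_line_locus X L E \<iota>)"
  unfolding irreducible_analytic_def
proof (intro conjI allI impI)
  let ?V = "sub_line_locus X L E \<iota>"
  show "analytic_in (proj_atlas X E) ?V" by (rule sub_line_locus_analytic)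
  have "nonzero_pts \<noteq> {}" using nonzero_pts_dense[of UNIV] by auto
  then have "generic_locus \<noteq> {}" unfolding nonzero_pts_def generic_locus_def by blast
  then show "?V \<noteq> {}" using generic_locus_subset by blast
  fix S1 S2 assume "analytic_in (proj_atlas X E) S1 \<and> analytic_in (proj_atlas X E) S2 \<and> ?V = S1 \<union> S2"
  then have S1: "analytic_in (proj_atlas X E) S1" and S2: "analytic_in (proj_atlas X E) S2"
    and V: "?V = S1 \<union> S2" by auto
  have full: "S = ?V" if "analytic_in (proj_atlas X E) S" "S \<subseteq> ?V" "nonzero_pts \<subseteq> trace_on S" for S
  proof -
    have "generic_locus \<subseteq> S"
    proof
      fix l assume "l \<in> generic_locus"
      then obtain e where e: "l = line_of E (\<iota> e)" "\<not> vb_is_zero E (\<iota> e)" unfolding generic_locus_def by blast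
      then have "proj L e \<in> nonzero_pts" unfolding nonzero_pts_def by blast
      then have "proj L e \<in> trace_on S" using that(3) by blast
      then obtain e' where e': "proj L e' = proj L e" "\<not> vb_is_zero E (\<iota> e')" "line_of E (\<iota> e') \<in> S"
        unfolding trace_on_def by blast
      then show "l \<in> S" using iota_line_eq[OF e'(1,2) e(2)] e(1) by simp
    qed
    then show ?thesis using analytic_superset_generic_locus that by blast
  qed
  have T: "trace_on S \<subseteq> nonzero_pts" for S unfolding trace_on_def nonzero_pts_def by blast
  have un: "nonzero_pts \<subseteq> trace_on S1 \<union> trace_on S2"
  proof
    fix x assume "x \<in> nonzero_pts"
    then obtain e where e: "proj L e = x" "\<not> vb_is_zero E (\<iota> e)" unfolding nonzero_pts_def by blast
    then have "line_of E (\<iota> e) \<in> S1 \<union> S2" using generic_locus_subset V unfolding generic_locus_def by blast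
    then show "x \<in> trace_on S1 \<union> trace_on S2" using e unfolding trace_on_def by blast
  qed
  show "S1 = ?V \<or> S2 = ?V"
  proof (cases "nonzero_pts \<subseteq> trace_on S2")
    case True
    then show ?thesis using full[OF S2] V by blast
  next
    case False
    then obtain x where x: "x \<in> nonzero_pts" "x \<notin> trace_on S2" by blast
    obtain N where N: "open N" "x \<in> N" "N \<subseteq> nonzero_pts"
      "x \<notin> trace_on S2 \<Longrightarrow> \<exists>M. open M \<and> x \<in> M \<and> M \<inter> trace_on S2 = {}"
      by (rule trace_on_local[OF S2 x(1)]) (rule that)
    obtain M where M: "open M" "x \<in> M" "M \<inter> trace_on S2 = {}" using N(4) x(2) by blast
    let ?I = "interior (trace_on S1)"
    have "x \<in> ?I" by (rule interiorI[of "M \<inter> N"]) (use M N un in auto)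
    \<comment> \<open>The interior is relatively closed: a ball about \<open>y\<close> that meets it
      lies entirely in the trace, which would make \<open>y\<close> an interior point.\<close>
    have "open (nonzero_pts - ?I)"
    proof (subst open_subopen, rule ballI)
      fix y assume y: "y \<in> nonzero_pts - ?I"
      then have yn: "y \<in> nonzero_pts" by blast
      obtain N where N: "open N" "y \<in> N" "N \<subseteq> nonzero_pts"
        "\<And>O'. open O' \<Longrightarrow> O' \<noteq> {} \<Longrightarrow> O' \<subseteq> N \<inter> trace_on S1 \<Longrightarrow> N \<subseteq> trace_on S1"
        by (rule trace_on_local[OF S1 yn]) (rule that)
      have "N \<inter> ?I = {}"
      proof (rule ccontr)
        assume ne: "N \<inter> ?I \<noteq> {}"
        have "open (N \<inter> ?I)" "N \<inter> ?I \<subseteq> N \<inter> trace_on S1"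
          using N(1) interior_subset[of "trace_on S1"] by auto
        then have "N \<subseteq> trace_on S1" using N(4) ne by blast
        then have "y \<in> ?I" using N(1,2) interiorI by blast
        then show False using y by blast
      qed
      then show "\<exists>T. open T \<and> y \<in> T \<and> T \<subseteq> nonzero_pts - ?I" using N by blast
    qed
    moreover have "?I \<subseteq> nonzero_pts" using T interior_subset by blast
    ultimately have "nonzero_pts \<subseteq> ?I"
      using connectedD[OF connected_nonzero_pts, of ?I "nonzero_pts - ?I"] \<open>x \<in> ?I\<close> x by blast
    then have "nonzero_pts \<subseteq> trace_on S1" using interior_subset by blast
    then show ?thesis using full[OF S1] V by blast
  qed
qed

end

section \<open>The eigen-variety\<close>

lemma wedge2_sum_scale:
  "wedge2 (\<Sum>j\<in>(UNIV :: 2 set). J j *s a j) b = (\<Sum>j\<in>UNIV. J j * wedge2 (a j) b)"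
  by (simp add: sum_2 wedge2_def algebra_simps)

text \<open>The derivation that \<open>A\<close> induces on the second exterior power is
  multiplication by its trace. For two independent eigenvectors it says that the eigenvalues add up
  to the trace.\<close>

lemma wedge2_trace:
  "wedge2 (A *v a) b + wedge2 a (A *v b) = trace A * wedge2 a b"
  by (simp add: wedge2_def matrix_vector_mult_def trace_def sum_2 algebra_simps)

lemma wedge2_self [simp]: "wedge2 a a = 0"
  by (simp add: wedge2_def)

lemma wedge2_swap: "wedge2 a b = - wedge2 b a"
  by (simp add: wedge2_def)

lemma eigenvector_of_wedge2:
  assumes "wedge2 (A *v w) w = 0" "w \<noteq> 0" obtains \<kappa> where "A *v w = \<kappa> *s w"
  using wedge2_eq_0_imp[of w "A *v w"] assms by (metis wedge2_swap neg_equal_0_iff_equal)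

lemma trace_free_eigenvalues:
  assumes "trace A = 0" "A *v a = \<mu> *s a" "A *v b = \<kappa> *s b" "wedge2 a b \<noteq> 0"
  shows "\<kappa> = - \<mu>"
proof -
  have "(\<mu> + \<kappa>) * wedge2 a b = 0"
    using wedge2_trace[of A a b] assms by (simp add: wedge2_scale algebra_simps)
  then show ?thesis using assms(4) by (simp add: eq_neg_iff_add_eq_0 add.commute)
qed

lemma matrix_zero_of_basis:
  assumes "A *v a = 0" "A *v b = 0" "wedge2 a b \<noteq> 0"
  shows "A = 0"
proof -
  have "A *v y = 0" for y
  proof -
    \<comment> \<open>Cramer's rule in the basis \<open>a\<close>, \<open>b\<close>.\<close>
    have y: "y = (wedge2 y b / wedge2 a b) *s a + (wedge2 a y / wedge2 a b) *s b"
      using assms(3) by (simp add: vec_eq_iff forall_2 field_simps) (simp add: wedge2_def algebra_simps)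
    show ?thesis
      by (subst y) (simp add: matrix_vector_right_distrib vec.scale assms)
  qed
  then show ?thesis by (simp add: matrix_eq)
qed

text \<open>The coordinates of a \<otimes> p + v \<otimes> b. With \<open>a = A v\<close>,
  \<open>b = A p\<close> and \<open>A p = \<mu> p\<close> this is (A v + \<mu> v) \<otimes> p, which
  for \<open>p\<close> nonzero vanishes exactly when \<open>A v = - \<mu> v\<close>; the eigenvalue
  \<mu> itself does not appear in the formula.\<close>

definition tensor_pair :: "2 \<Rightarrow> 2 \<Rightarrow> complex ^ 2 \<Rightarrow> complex ^ 2 \<Rightarrow> complex ^ 2 \<Rightarrow> complex ^ 2 \<Rightarrow> complex" where
  "tensor_pair i j a p v b = a $ i * p $ j + v $ i * b $ j"

lemma tensor_pair_matrix:
  "tensor_pair i j (g *v a) (g *v p) (g *v v) (g *v b) =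
    (\<Sum>k\<in>UNIV. \<Sum>l\<in>UNIV. g $ i $ k * g $ j $ l * tensor_pair k l a p v b)"
  by (simp add: tensor_pair_def matrix_vector_mult_def sum_2 algebra_simps)

lemma tensor_pair_sum:
  "tensor_pair i j (\<Sum>l\<in>(UNIV :: 2 set). J l *s a l) p v (\<Sum>l\<in>UNIV. J l *s b l) =
    (\<Sum>l\<in>UNIV. J l * tensor_pair i j (a l) p v (b l))"
  by (simp add: tensor_pair_def sum_2 algebra_simps)

lemma tensor_pair_scale:
  "tensor_pair i j a (c *s p) v (c *s b) = c * tensor_pair i j a p v b"
  "tensor_pair i j (c *s a) p (c *s v) b = c * tensor_pair i j a p v b"
  by (simp_all add: tensor_pair_def algebra_simps)

section \<open>The field in local coordinates\<close>

locale co_higgs_setting = sub_line_setting X E L \<iota>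
  for X :: "('a :: {t2_space, second_countable_topology}, 2) atlas"
    and E :: "('a, 'e, 2) vbundle" and L :: "('a, 'l, 1) vbundle" and \<iota> :: "'l \<Rightarrow> 'e" +
  fixes \<Phi> :: "('a, 'e) end_field"
  assumes field: "end_tangent_section X E \<Phi>" and tracefree: "trace_free X E \<Phi>"
    and nonzero: "nonzero_field X E \<Phi>" and invariant: "invariant_under X L E \<Phi> \<iota>"
begin

definition field_matrix ::
    "'a set \<Rightarrow> ('a \<Rightarrow> complex ^ 2) \<Rightarrow> 'a set \<Rightarrow> ('e \<Rightarrow> complex ^ 2) \<Rightarrow> (2 \<Rightarrow> 'a \<Rightarrow> complex ^ 2 ^ 2) \<Rightarrow> bool" where
  "field_matrix U \<phi> V \<tau> A \<longleftrightarrow> (U, \<phi>) \<in> X \<and> (V, \<tau>) \<in> trivs E \<and>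
     (\<forall>k i j. holo_fun X (U \<inter> V) (\<lambda>x. A k x $ i $ j)) \<and>
     (\<forall>k e. proj E e \<in> U \<inter> V \<longrightarrow> \<tau> (\<Phi> (U, \<phi>) k e) = A k (proj E e) *v \<tau> e)"

lemma field_bundle_map: "(U, \<phi>) \<in> X \<Longrightarrow> holo_bundle_map X E E U (\<Phi> (U, \<phi>) k)"
  using field unfolding end_tangent_section_def by fastforce

lemma proj_field: "(U, \<phi>) \<in> X \<Longrightarrow> proj E e \<in> U \<Longrightarrow> proj E (\<Phi> (U, \<phi>) k e) = proj E e"
  using field_bundle_map unfolding holo_bundle_map_def by blast

lemma field_matrix_exists:
  assumes c: "(U, \<phi>) \<in> X" and t: "(V, \<tau>) \<in> trivs E"
  obtains A where "field_matrix U \<phi> V \<tau> A"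
proof -
  have "\<exists>A :: 'a \<Rightarrow> complex ^ 2 ^ 2. (\<forall>i j. holo_fun X (U \<inter> V \<inter> V) (\<lambda>x. A x $ i $ j)) \<and>
        (\<forall>e. proj E e \<in> U \<inter> V \<inter> V \<longrightarrow> \<tau> (\<Phi> (U, \<phi>) k e) = A (proj E e) *v \<tau> e)" for k
    using field_bundle_map[OF c, of k] t unfolding holo_bundle_map_def by fast
  then have "\<forall>k. \<exists>A :: 'a \<Rightarrow> complex ^ 2 ^ 2. (\<forall>i j. holo_fun X (U \<inter> V) (\<lambda>x. A x $ i $ j)) \<and>
        (\<forall>e. proj E e \<in> U \<inter> V \<longrightarrow> \<tau> (\<Phi> (U, \<phi>) k e) = A (proj E e) *v \<tau> e)"
    by (simp add: Int_assoc)
  from choice[OF this] obtain A :: "2 \<Rightarrow> 'a \<Rightarrow> complex ^ 2 ^ 2" where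
    "\<forall>k. (\<forall>i j. holo_fun X (U \<inter> V) (\<lambda>x. A k x $ i $ j)) \<and>
        (\<forall>e. proj E e \<in> U \<inter> V \<longrightarrow> \<tau> (\<Phi> (U, \<phi>) k e) = A k (proj E e) *v \<tau> e)"
    by (elim exE)
  then show ?thesis using c t that[of A] unfolding field_matrix_def by blast
qed

text \<open>\<open>J\<close> is a row of the Jacobian matrix at \<open>x\<close>; the same
  coefficients serve all vectors of the fibre.\<close>

lemma field_change:
  assumes "(U, \<phi>) \<in> X" "(U', \<phi>') \<in> X" "(V, \<tau>) \<in> trivs E" "x \<in> U" "x \<in> U'" "x \<in> V"
  obtains J where "\<And>e. proj E e = x \<Longrightarrow> \<tau> (\<Phi> (U', \<phi>') k e) = (\<Sum>j\<in>UNIV. J j *s \<tau> (\<Phi> (U, \<phi>) j e))"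
proof
  fix e assume "proj E e = x"
  then show "\<tau> (\<Phi> (U', \<phi>') k e) = (\<Sum>j\<in>UNIV.
      partial_deriv (\<lambda>z. transition (U, \<phi>) (U', \<phi>') z $ k) j (\<phi> x) *s \<tau> (\<Phi> (U, \<phi>) j e))"
    using bspec[OF spec[OF spec[OF bspec[OF bspec[OF conjunct2[OF field[unfolded end_tangent_section_def]]
            assms(1)] assms(2)]]] assms(3), of e k] assms(4-6)
    by simp
qed

context
  fixes U \<phi> V \<tau> A assumes fm: "field_matrix U \<phi> V \<tau> A"
begin

lemma fm_chart: "(U, \<phi>) \<in> X" and fm_triv: "(V, \<tau>) \<in> trivs E"
  and fm_holo: "holo_fun X (U \<inter> V) (\<lambda>x. A k x $ i $ j)"
  and fm_eq: "proj E e \<in> U \<Longrightarrow> proj E e \<in> V \<Longrightarrow> \<tau> (\<Phi> (U, \<phi>) k e) = A k (proj E e) *v \<tau> e"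
  using fm unfolding field_matrix_def by auto

lemma fm_trace:
  assumes "x \<in> U" "x \<in> V" shows "trace (A k x) = 0"
proof -
  have "\<forall>e. proj E e = x \<longrightarrow> \<tau> (\<Phi> (U, \<phi>) k e) = A k x *v \<tau> e" using fm_eq assms by blast
  then show ?thesis
    using bspec[OF spec[OF bspec[OF tracefree[unfolded trace_free_def] fm_chart]] fm_triv] assms
    by simp
qed

text \<open>Invariance is a condition on sections. Applied to the local frame of \<open>L\<close>
  and evaluated at \<open>x\<close>, it shows that \<open>A k x\<close> maps \<open>p x\<close> to a
  multiple of itself; \<open>p x\<close> may be zero.\<close>

lemma fm_invariant:
  assumes ic: "iota_coords V \<tau> V' \<sigma> p" and x: "x \<in> U" "x \<in> V" "x \<in> V'"
  obtains \<mu> where "A k x *v p x = \<mu> *s p x"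
proof -
  note tL = ic_triv(2)[OF ic]
  let ?W = "U \<inter> V'" and ?t = "\<lambda>y. fibre_vec L \<sigma> y (vec 1)"
  have W: "open ?W" using complex_manifold_chart(1)[OF X fm_chart] ic_open[OF ic] by blast
  have "holo_section X L ?W ?t"
    by (rule holo_section_fibre_vec[OF X L tL W]) (auto intro: holo_fun_const)
  then obtain N t' where N: "x \<in> N" "holo_section X L N t'" "\<And>y. y \<in> N \<Longrightarrow> \<Phi> (U, \<phi>) k (\<iota> (?t y)) = \<iota> (t' y)"
    using invariant[unfolded invariant_under_def, rule_format, OF fm_chart, of ?W x ?t k] W x
    by auto
  have t'x: "proj L (t' x) = x" using N(1,2) unfolding holo_section_def by blast
  note tx = fibre_vec[OF X L tL x(3), of "vec 1"]
  have "\<tau> (\<iota> (?t x)) = p x" using ic_eq[OF ic, of "?t x"] tx x by simp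
  then have "A k x *v p x = \<tau> (\<Phi> (U, \<phi>) k (\<iota> (?t x)))"
    using fm_eq[of "\<iota> (?t x)" k] tx x by simp
  also have "\<dots> = \<sigma> (t' x) $ 1 *s p x"
    using N(3)[OF N(1)] ic_eq[OF ic, of "t' x"] t'x x by simp
  finally show ?thesis by (rule that)
qed

end

definition eigen :: "'e \<Rightarrow> bool" where
  "eigen v \<longleftrightarrow> (\<forall>c\<in>X. \<forall>k. \<forall>(V, \<tau>)\<in>trivs E. proj E v \<in> fst c \<inter> V \<longrightarrow> wedge2 (\<tau> (\<Phi> c k v)) (\<tau> v) = 0)"

text \<open>One chart and one trivialization decide the condition, since the components of the field
  change linearly and wedges are multiplied by a determinant.\<close>

lemma eigen_iff:
  assumes fm: "field_matrix U \<phi> V \<tau> A" and v: "proj E v \<in> U" "proj E v \<in> V"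
  shows "eigen v \<longleftrightarrow> (\<forall>k. wedge2 (A k (proj E v) *v \<tau> v) (\<tau> v) = 0)"
proof
  note c = fm_chart[OF fm] and t = fm_triv[OF fm]
  assume R: "eigen v"
  show "\<forall>k. wedge2 (A k (proj E v) *v \<tau> v) (\<tau> v) = 0"
  proof
    fix k
    have "wedge2 (\<tau> (\<Phi> (U, \<phi>) k v)) (\<tau> v) = 0" using bspec[OF spec[OF bspec[OF R[unfolded eigen_def] c]] t] v by simp
    then show "wedge2 (A k (proj E v) *v \<tau> v) (\<tau> v) = 0" using fm_eq[OF fm, of v k] v by simp
  qed
next
  note c = fm_chart[OF fm] and t = fm_triv[OF fm]
  assume 0: "\<forall>k. wedge2 (A k (proj E v) *v \<tau> v) (\<tau> v) = 0"
  have "wedge2 (\<tau>' (\<Phi> (U', \<phi>') k v)) (\<tau>' v) = 0"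
    if c': "(U', \<phi>') \<in> X" "proj E v \<in> U'" and t': "(V', \<tau>') \<in> trivs E" "proj E v \<in> V'" for U' \<phi>' V' \<tau>' k
  proof -
    obtain g where g: "\<And>e. proj E e \<in> V \<inter> V' \<Longrightarrow> \<tau>' e = g (proj E e) *v \<tau> e"
      using triv_transition[OF X E t t'(1)] by metis
    obtain J where J: "\<And>e. proj E e = proj E v \<Longrightarrow>
        \<tau> (\<Phi> (U', \<phi>') k e) = (\<Sum>j\<in>UNIV. J j *s \<tau> (\<Phi> (U, \<phi>) j e))"
      using field_change[OF c c'(1) t v(1) c'(2) v(2), of k] by blast
    have "wedge2 (\<tau> (\<Phi> (U', \<phi>') k v)) (\<tau> v) = 0"
      using J[of v] 0 fm_eq[OF fm, of v] v by (simp add: wedge2_sum_scale)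
    then show ?thesis
      using g[of v] g[of "\<Phi> (U', \<phi>') k v"] proj_field[OF c', of k] v t' by (simp add: wedge2_matrix_vector_mult)
  qed
  then show "eigen v" unfolding eigen_def by auto
qed

lemma eigen_variety_eq: "eigen_variety X E \<Phi> = {line_of E v | v. \<not> vb_is_zero E v \<and> eigen v}"
  unfolding eigen_variety_def eigen_def ..

lemma field_matrix_near:
  obtains U \<phi> V \<tau> A V' \<sigma> p where "field_matrix U \<phi> V \<tau> A" "iota_coords V \<tau> V' \<sigma> p" "x \<in> U" "x \<in> V" "x \<in> V'"
proof -
  obtain U \<phi> where c: "(U, \<phi>) \<in> X" "x \<in> U" using complex_manifold_covered[OF X] .
  obtain V \<tau> V' \<sigma> p where ic: "iota_coords V \<tau> V' \<sigma> p" "x \<in> V" "x \<in> V'" by (rule iota_coords_near)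
  obtain A where "field_matrix U \<phi> V \<tau> A" using field_matrix_exists[OF c(1) ic_triv(1)[OF ic(1)]] .
  then show ?thesis using that ic c by blast
qed

lemma eigen_scale:
  assumes v: "eigen v" shows "eigen (vb_scale E c v)"
proof -
  obtain U \<phi> V \<tau> A V' \<sigma> p where fm: "field_matrix U \<phi> V \<tau> A" "iota_coords V \<tau> V' \<sigma> p"
    and x: "proj E v \<in> U" "proj E v \<in> V" "proj E v \<in> V'" by (rule field_matrix_near)
  show ?thesis
    using v eigen_iff[OF fm(1)] x vb_scale(1)[OF X E] vb_scale(2)[OF X E fm_triv[OF fm(1)] x(2), of c]
    by (simp add: vec.scale wedge2_scale)
qed

lemma eigen_variety_analytic: "analytic_in (proj_atlas X E) (eigen_variety X E \<Phi>)"
  unfolding eigen_variety_eq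
proof (rule analytic_in_lines[OF X E])
  fix U \<phi> V \<tau> x assume c: "(U, \<phi>) \<in> X" "x \<in> U" and t: "(V, \<tau>) \<in> trivs E" "x \<in> V"
  obtain A where fm: "field_matrix U \<phi> V \<tau> A" using field_matrix_exists[OF c(1) t(1)] .
  let ?F = "range (\<lambda>k x w. wedge2 (A k x *v w) w)"
  have "fibrewise_holo X (U \<inter> V) (\<lambda>x w. wedge2 (A k x *v w) w)" for k
    unfolding wedge2_def matrix_vector_mult_def sum_2 vec_lambda_beta
    by (intro fibrewise_holo_intros fm_holo[OF fm])
  moreover have "open (U \<inter> V)"
    using triv_open[OF X E t(1)] complex_manifold_chart(1)[OF X c(1)] by blast
  ultimately show "\<exists>N F. open N \<and> x \<in> N \<and> N \<subseteq> U \<inter> V \<and> finite F \<and> (\<forall>f\<in>F. fibrewise_holo X N f) \<and>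
        (\<forall>v. proj E v \<in> N \<longrightarrow> \<not> vb_is_zero E v \<longrightarrow> eigen v \<longleftrightarrow> (\<forall>f\<in>F. f (proj E v) (\<tau> v) = 0))"
    using eigen_iff[OF fm] c t by (intro exI[of _ "U \<inter> V"] exI[of _ ?F]) auto
qed (rule eigen_scale)

text \<open>On the graph the inclusion is invariance. The eigen-variety is analytic, so it also
  contains the fibres over the zeros of \<iota>, where invariance gives no information.\<close>

lemma sub_line_locus_subset_eigen: "sub_line_locus X L E \<iota> \<subseteq> eigen_variety X E \<Phi>"
proof (rule analytic_superset_generic_locus[OF eigen_variety_analytic])
  have "eigen (\<iota> e)" for e
  proof -
    obtain U \<phi> V \<tau> A V' \<sigma> p where fm: "field_matrix U \<phi> V \<tau> A" and ic: "iota_coords V \<tau> V' \<sigma> p"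
      and x: "proj L e \<in> U" "proj L e \<in> V" "proj L e \<in> V'" by (rule field_matrix_near)
    have "wedge2 (A k (proj L e) *v \<tau> (\<iota> e)) (\<tau> (\<iota> e)) = 0" for k
    proof -
      obtain \<mu> where "A k (proj L e) *v p (proj L e) = \<mu> *s p (proj L e)" using fm_invariant[OF fm ic x] .
      then show ?thesis using ic_eq[OF ic x(2,3)] by (simp add: vec.scale wedge2_scale)
    qed
    then show ?thesis using eigen_iff[OF fm, of "\<iota> e"] x by simp
  qed
  then show "generic_locus \<subseteq> eigen_variety X E \<Phi>" unfolding generic_locus_def eigen_variety_eq by blast
qed

text \<open>
  Where \<open>\<iota>\<close> does not vanish and \<open>\<lambda>\<^sub>k\<close> is the eigenvalue of \<open>\<Phi>\<^sub>k\<close> on the image of \<open>\<iota>\<close>,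
  the condition says \<open>\<Phi>\<^sub>k v = - \<lambda>\<^sub>k v\<close> for all \<open>k\<close>.  Multiplying by \<open>\<iota>\<close> makes it meaningful,
  and vacuous, at the zeros of \<open>\<iota>\<close>.
\<close>

definition opposite_eigen :: "'e \<Rightarrow> bool" where
  "opposite_eigen v \<longleftrightarrow> (\<forall>e U \<phi> V \<tau> i j k. proj L e = proj E v \<and> (U, \<phi>) \<in> X \<and> (V, \<tau>) \<in> trivs E \<and>
     proj E v \<in> U \<inter> V \<longrightarrow>
     tensor_pair i j (\<tau> (\<Phi> (U, \<phi>) k v)) (\<tau> (\<iota> e)) (\<tau> v) (\<tau> (\<Phi> (U, \<phi>) k (\<iota> e))) = 0)"

lemma opposite_eigen_iff:
  assumes fm: "field_matrix U \<phi> V \<tau> A" and ic: "iota_coords V \<tau> V' \<sigma> p"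
    and v: "proj E v \<in> U" "proj E v \<in> V" "proj E v \<in> V'"
  defines "x \<equiv> proj E v"
  shows "opposite_eigen v \<longleftrightarrow>
    (\<forall>i j k. tensor_pair i j (A k x *v \<tau> v) (p x) (\<tau> v) (A k x *v p x) = 0)"
proof
  note c = fm_chart[OF fm] and t = fm_triv[OF fm]
  assume R: "opposite_eigen v"
  obtain e where e: "proj L e = proj E v" "\<sigma> e $ 1 = 1" using ic_frame[OF ic v(3)] .
  have \<tau>e: "\<tau> (\<iota> e) = p x" using ic_eq[OF ic, of e] e v by (simp add: x_def)
  show "\<forall>i j k. tensor_pair i j (A k x *v \<tau> v) (p x) (\<tau> v) (A k x *v p x) = 0"
  proof (intro allI)
    fix i j k
    have "tensor_pair i j (\<tau> (\<Phi> (U, \<phi>) k v)) (\<tau> (\<iota> e)) (\<tau> v) (\<tau> (\<Phi> (U, \<phi>) k (\<iota> e))) = 0"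
      using R c t v e(1) unfolding opposite_eigen_def by blast
    then show "tensor_pair i j (A k x *v \<tau> v) (p x) (\<tau> v) (A k x *v p x) = 0"
      using fm_eq[OF fm, of v k] fm_eq[OF fm, of "\<iota> e" k] v e(1) \<tau>e by (simp add: x_def)
  qed
next
  note c = fm_chart[OF fm] and t = fm_triv[OF fm]
  assume 0: "\<forall>i j k. tensor_pair i j (A k x *v \<tau> v) (p x) (\<tau> v) (A k x *v p x) = 0"
  show "opposite_eigen v"
    unfolding opposite_eigen_def
  proof (intro allI impI, elim conjE)
    fix e U' \<phi>' V1 \<tau>' i j k
    assume e: "proj L e = proj E v" and c': "(U', \<phi>') \<in> X" and t': "(V1, \<tau>') \<in> trivs E"
      and v': "proj E v \<in> U' \<inter> V1"
    obtain g where g: "\<And>e. proj E e \<in> V \<inter> V1 \<Longrightarrow> \<tau>' e = g (proj E e) *v \<tau> e"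
      using triv_transition[OF X E t t'] by metis
    obtain J where J: "\<And>e. proj E e = proj E v \<Longrightarrow>
        \<tau> (\<Phi> (U', \<phi>') k e) = (\<Sum>j\<in>UNIV. J j *s \<tau> (\<Phi> (U, \<phi>) j e))"
      using field_change[OF c c' t v(1) _ v(2), of k] v' by blast
    have vV: "proj E v \<in> V \<inter> V1" and vU: "proj E v \<in> U'" using v v' by auto
    have \<tau>e: "\<tau> (\<iota> e) = \<sigma> e $ 1 *s p x" using ic_eq[OF ic, of e] e v by (simp add: x_def)
    have "tensor_pair i j (\<tau> (\<Phi> (U, \<phi>) l v)) (\<tau> (\<iota> e)) (\<tau> v) (\<tau> (\<Phi> (U, \<phi>) l (\<iota> e))) = 0" for i j l
      using fm_eq[OF fm, of v l] fm_eq[OF fm, of "\<iota> e" l] v e \<tau>e 0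
      by (simp add: x_def vec.scale tensor_pair_scale)
    then have "tensor_pair i j (\<tau> (\<Phi> (U', \<phi>') k v)) (\<tau> (\<iota> e)) (\<tau> v) (\<tau> (\<Phi> (U', \<phi>') k (\<iota> e))) = 0" for i j
      using J[of v] J[of "\<iota> e"] e by (simp add: tensor_pair_sum)
    then show "tensor_pair i j (\<tau>' (\<Phi> (U', \<phi>') k v)) (\<tau>' (\<iota> e)) (\<tau>' v) (\<tau>' (\<Phi> (U', \<phi>') k (\<iota> e))) = 0"
      using g[of v] g[of "\<iota> e"] g[of "\<Phi> (U', \<phi>') k v"] g[of "\<Phi> (U', \<phi>') k (\<iota> e)"] e vV
        proj_field[OF c', of v k] proj_field[OF c', of "\<iota> e" k] vU
      by (simp add: tensor_pair_matrix)
  qed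
qed

lemma opposite_eigen_scale:
  assumes v: "opposite_eigen v" shows "opposite_eigen (vb_scale E c v)"
proof -
  obtain U \<phi> V \<tau> A V' \<sigma> p where fm: "field_matrix U \<phi> V \<tau> A" and ic: "iota_coords V \<tau> V' \<sigma> p"
    and x: "proj E v \<in> U" "proj E v \<in> V" "proj E v \<in> V'" by (rule field_matrix_near)
  show ?thesis
    using v opposite_eigen_iff[OF fm ic] x vb_scale(1)[OF X E] vb_scale(2)[OF X E fm_triv[OF fm] x(2), of c]
    by (simp add: vec.scale tensor_pair_scale)
qed

lemma opposite_eigen_analytic:
  "analytic_in (proj_atlas X E) {line_of E v | v. \<not> vb_is_zero E v \<and> opposite_eigen v}"
proof (rule analytic_in_lines[OF X E])
  fix U \<phi> V \<tau> x assume c: "(U, \<phi>) \<in> X" "x \<in> U" and t: "(V, \<tau>) \<in> trivs E" "x \<in> V"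
  obtain A where fm: "field_matrix U \<phi> V \<tau> A" using field_matrix_exists[OF c(1) t(1)] .
  obtain V' \<sigma> where t': "(V', \<sigma>) \<in> trivs L" "x \<in> V'" using triv_covered[OF X L] .
  obtain p where ic: "iota_coords V \<tau> V' \<sigma> p" using iota_coords_exist[OF t(1) t'(1)] .
  let ?N = "U \<inter> V \<inter> V'"
  let ?F = "range (\<lambda>(i, j, k) x w. tensor_pair i j (A k x *v w) (p x) w (A k x *v p x))"
  have "fibrewise_holo X ?N (\<lambda>x w. tensor_pair i j (A k x *v w) (p x) w (A k x *v p x))" for i j k
  proof -
    have "holo_fun X ?N (\<lambda>x. A k x $ i $ j)" for i j by (rule holo_fun_subset[OF fm_holo[OF fm]]) auto
    moreover have "holo_fun X ?N (\<lambda>x. p x $ i)" for i by (rule holo_fun_subset[OF ic_holo[OF ic]]) auto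
    ultimately show ?thesis
      unfolding tensor_pair_def matrix_vector_mult_def sum_2 vec_lambda_beta
      by (intro fibrewise_holo_intros)
  qed
  moreover have "open ?N"
    using triv_open[OF X E t(1)] triv_open[OF X L t'(1)] complex_manifold_chart(1)[OF X c(1)] by blast
  ultimately show "\<exists>N F. open N \<and> x \<in> N \<and> N \<subseteq> U \<inter> V \<and> finite F \<and> (\<forall>f\<in>F. fibrewise_holo X N f) \<and>
        (\<forall>v. proj E v \<in> N \<longrightarrow> \<not> vb_is_zero E v \<longrightarrow> opposite_eigen v \<longleftrightarrow> (\<forall>f\<in>F. f (proj E v) (\<tau> v) = 0))"
    using opposite_eigen_iff[OF fm ic] c t t' by (intro exI[of _ ?N] exI[of _ ?F]) auto
qed (rule opposite_eigen_scale)

section \<open>The lines over the zeros of the field, and the residual set\<close>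

definition field_zero :: "'e \<Rightarrow> bool" where
  "field_zero v \<longleftrightarrow> (\<forall>U \<phi> k e. (U, \<phi>) \<in> X \<and> proj E v \<in> U \<and> proj E e = proj E v \<longrightarrow> vb_is_zero E (\<Phi> (U, \<phi>) k e))"

lemma field_zero_iff:
  assumes fm: "field_matrix U \<phi> V \<tau> A" and v: "proj E v \<in> U" "proj E v \<in> V"
  shows "field_zero v \<longleftrightarrow> (\<forall>k. A k (proj E v) = 0)"
proof
  note c = fm_chart[OF fm] and t = fm_triv[OF fm]
  assume R: "field_zero v"
  show "\<forall>k. A k (proj E v) = 0"
  proof
    fix k
    have "A k (proj E v) *v w = 0" for w
    proof -
      define e where "e = fibre_vec E \<tau> (proj E v) w"
      have e: "proj E e = proj E v" "\<tau> e = w" unfolding e_def using fibre_vec[OF X E t v(2)] by auto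
      have "vb_is_zero E (\<Phi> (U, \<phi>) k e)" using R c v e unfolding field_zero_def by blast
      then have "\<tau> (\<Phi> (U, \<phi>) k e) = 0"
        using vb_is_zero_iff[OF X E t, of "\<Phi> (U, \<phi>) k e"] proj_field[OF c, of e k] e v by simp
      then show ?thesis using fm_eq[OF fm, of e k] e v by simp
    qed
    then show "A k (proj E v) = 0" by (simp add: matrix_eq)
  qed
next
  note c = fm_chart[OF fm] and t = fm_triv[OF fm]
  assume 0: "\<forall>k. A k (proj E v) = 0"
  show "field_zero v"
    unfolding field_zero_def
  proof (intro allI impI, elim conjE)
    fix U' \<phi>' k e assume c': "(U', \<phi>') \<in> X" and vU: "proj E v \<in> U'" and e: "proj E e = proj E v"
    obtain J where J: "\<And>e. proj E e = proj E v \<Longrightarrow>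
        \<tau> (\<Phi> (U', \<phi>') k e) = (\<Sum>j\<in>UNIV. J j *s \<tau> (\<Phi> (U, \<phi>) j e))"
      using field_change[OF c c' t v(1) vU v(2), of k] by blast
    have "\<tau> (\<Phi> (U', \<phi>') k e) = 0"
      using J[OF e] fm_eq[OF fm, of e] e v 0 by simp
    then show "vb_is_zero E (\<Phi> (U', \<phi>') k e)"
      using vb_is_zero_iff[OF X E t, of "\<Phi> (U', \<phi>') k e"] proj_field[OF c', of e k] vU e v by simp
  qed
qed

lemma field_zero_analytic:
  "analytic_in (proj_atlas X E) {line_of E v | v. \<not> vb_is_zero E v \<and> field_zero v}"
proof (rule analytic_in_lines[OF X E])
  show "field_zero v \<Longrightarrow> field_zero (vb_scale E c v)" for v c
    unfolding field_zero_def vb_scale(1)[OF X E] .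
  fix U \<phi> V \<tau> x assume c: "(U, \<phi>) \<in> X" "x \<in> U" and t: "(V, \<tau>) \<in> trivs E" "x \<in> V"
  obtain A where fm: "field_matrix U \<phi> V \<tau> A" using field_matrix_exists[OF c(1) t(1)] .
  let ?F = "range (\<lambda>(i, j, k) x (w :: complex ^ 2). A k x $ i $ j)"
  have "fibrewise_holo X (U \<inter> V) (\<lambda>x w. A k x $ i $ j)" for i j k
    by (intro fibrewise_holo_intros fm_holo[OF fm])
  moreover have "open (U \<inter> V)"
    using triv_open[OF X E t(1)] complex_manifold_chart(1)[OF X c(1)] by blast
  moreover have "field_zero v \<longleftrightarrow> (\<forall>i j k. A k (proj E v) $ i $ j = 0)" if "proj E v \<in> U \<inter> V" for v
    using field_zero_iff[OF fm] that by (auto simp: vec_eq_iff)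
  ultimately show "\<exists>N F. open N \<and> x \<in> N \<and> N \<subseteq> U \<inter> V \<and> finite F \<and> (\<forall>f\<in>F. fibrewise_holo X N f) \<and>
        (\<forall>v. proj E v \<in> N \<longrightarrow> \<not> vb_is_zero E v \<longrightarrow> field_zero v \<longleftrightarrow> (\<forall>f\<in>F. f (proj E v) (\<tau> v) = 0))"
    using c t by (intro exI[of _ "U \<inter> V"] exI[of _ ?F]) auto
qed

text \<open>Off the locus \<open>p x\<close> and \<open>\<tau> v\<close> form a basis of common
  eigenvectors of the components, with opposite eigenvalues because the trace is zero. If the field
  kills the image of \<iota>, all these eigenvalues are zero and the matrices vanish.\<close>

lemma eigen_cases:
  assumes v: "\<not> vb_is_zero E v" "eigen v" "\<not> parallel v"
  shows "opposite_eigen v"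
    and "(\<And>U \<phi> k e. (U, \<phi>) \<in> X \<Longrightarrow> proj L e \<in> U \<Longrightarrow> vb_is_zero E (\<Phi> (U, \<phi>) k (\<iota> e))) \<Longrightarrow> field_zero v"
proof -
  define x where "x = proj E v"
  obtain U \<phi> V \<tau> A V' \<sigma> p where fm: "field_matrix U \<phi> V \<tau> A" and ic: "iota_coords V \<tau> V' \<sigma> p"
    and x: "x \<in> U" "x \<in> V" "x \<in> V'" by (rule field_matrix_near)
  have indep: "wedge2 (p x) (\<tau> v) \<noteq> 0"
    using v(3) parallel_iff[OF ic] x by (simp add: x_def)
  have \<tau>v: "\<tau> v \<noteq> 0" using v(1) vb_is_zero_iff[OF X E fm_triv[OF fm], of v] x by (simp add: x_def)
  have ev: "\<exists>\<mu>. A k x *v p x = \<mu> *s p x \<and> A k x *v \<tau> v = (- \<mu>) *s \<tau> v" for k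
  proof -
    obtain \<mu> where \<mu>: "A k x *v p x = \<mu> *s p x" using fm_invariant[OF fm ic x] .
    have "wedge2 (A k x *v \<tau> v) (\<tau> v) = 0" using v(2) eigen_iff[OF fm] x by (simp add: x_def)
    then obtain \<kappa> where \<kappa>: "A k x *v \<tau> v = \<kappa> *s \<tau> v" using eigenvector_of_wedge2 \<tau>v by blast
    have "\<kappa> = - \<mu>" by (rule trace_free_eigenvalues[OF fm_trace[OF fm x(1,2)] \<mu> \<kappa> indep])
    then show ?thesis using \<mu> \<kappa> by blast
  qed
  have "tensor_pair i j (A k x *v \<tau> v) (p x) (\<tau> v) (A k x *v p x) = 0" for i j k
  proof -
    obtain \<mu> where "A k x *v p x = \<mu> *s p x" "A k x *v \<tau> v = (- \<mu>) *s \<tau> v" using ev by blast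
    then show ?thesis by (simp add: tensor_pair_def)
  qed
  then show "opposite_eigen v" using opposite_eigen_iff[OF fm ic] x by (simp add: x_def)
  assume 0: "\<And>U \<phi> k e. (U, \<phi>) \<in> X \<Longrightarrow> proj L e \<in> U \<Longrightarrow> vb_is_zero E (\<Phi> (U, \<phi>) k (\<iota> e))"
  have "A k x = 0" for k
  proof -
    obtain \<mu> where \<mu>: "A k x *v p x = \<mu> *s p x" "A k x *v \<tau> v = (- \<mu>) *s \<tau> v" using ev by blast
    obtain e where e: "proj L e = x" "\<sigma> e $ 1 = 1" using ic_frame[OF ic x(3)] .
    have "\<tau> (\<Phi> (U, \<phi>) k (\<iota> e)) = 0"
      using 0[OF fm_chart[OF fm], of e k] vb_is_zero_iff[OF X E fm_triv[OF fm], of "\<Phi> (U, \<phi>) k (\<iota> e)"]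
        proj_field[OF fm_chart[OF fm], of "\<iota> e" k] e x by simp
    then have Ap: "A k x *v p x = 0"
      using fm_eq[OF fm, of "\<iota> e" k] ic_eq[OF ic, of e] e x by simp
    have "p x \<noteq> 0" using indep by (auto simp: wedge2_def)
    then have "\<mu> = 0" using Ap \<mu>(1) by simp
    then have "A k x *v \<tau> v = 0" using \<mu>(2) by simp
    then show ?thesis by (rule matrix_zero_of_basis[OF Ap _ indep])
  qed
  then show "field_zero v" using field_zero_iff[OF fm] x by (simp add: x_def)
qed

text \<open>A line of the locus outside \<open>M\<close> is exhibited in each case: over a point
  where \<Phi> is nonzero if \<Phi> kills the image of \<iota>, and otherwise the line of a vector
  \<iota>(e) with a nonzero eigenvalue, which differs from its opposite.\<close>

lemma residual_component:
  obtains M where "analytic_in (proj_atlas X E) M"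
    "eigen_variety X E \<Phi> \<subseteq> sub_line_locus X L E \<iota> \<union> M" "\<not> sub_line_locus X L E \<iota> \<subseteq> M"
proof (cases "\<forall>U \<phi> k e. (U, \<phi>) \<in> X \<longrightarrow> proj L e \<in> U \<longrightarrow> vb_is_zero E (\<Phi> (U, \<phi>) k (\<iota> e))")
  case True
  let ?M = "{line_of E v | v. \<not> vb_is_zero E v \<and> field_zero v}"
  show ?thesis
  proof (rule that[of ?M])
    show "analytic_in (proj_atlas X E) ?M" by (rule field_zero_analytic)
    show "eigen_variety X E \<Phi> \<subseteq> sub_line_locus X L E \<iota> \<union> ?M"
      unfolding eigen_variety_eq sub_line_locus_eq using eigen_cases(2) True by blast
    obtain U0 \<phi>0 k0 e0 where e0: "(U0, \<phi>0) \<in> X" "proj E e0 \<in> U0" "\<not> vb_is_zero E (\<Phi> (U0, \<phi>0) k0 e0)"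
      using nonzero unfolding nonzero_field_def by fastforce
    define x where "x = proj E e0"
    obtain V \<tau> V' \<sigma> p where ic: "iota_coords V \<tau> V' \<sigma> p" and x: "x \<in> V" "x \<in> V'" by (rule iota_coords_near)
    note t = ic_triv(1)[OF ic]
    \<comment> \<open>The locus has a line over every point; over a zero of \<iota> any nonzero
      vector will do, and the first axis is an arbitrary choice.\<close>
    define w where "w = (if p x = 0 then axis 1 1 else p x)"
    define v where "v = fibre_vec E \<tau> x w"
    have v: "proj E v = x" "\<tau> v = w" unfolding v_def using fibre_vec[OF X E t x(1)] by auto
    have "w \<noteq> 0" by (auto simp: w_def vec_eq_iff axis_def)
    then have "\<not> vb_is_zero E v" using vb_is_zero_iff[OF X E t, of v] v x by simp
    moreover have "parallel v"
      using parallel_iff[OF ic, of v] v x by (auto simp: w_def wedge2_def)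
    ultimately have "line_of E v \<in> sub_line_locus X L E \<iota>" unfolding sub_line_locus_eq by blast
    moreover have "line_of E v \<notin> ?M"
    proof
      assume "line_of E v \<in> ?M"
      then obtain v' where v': "line_of E v' = line_of E v" "field_zero v'" by force
      obtain d where "v = vb_scale E d v'" using line_of_eqD[OF X E v'(1)] .
      then have "proj E v' = x" using vb_scale(1)[OF X E] v(1) by simp
      then show False using v'(2) e0 unfolding field_zero_def x_def by metis
    qed
    ultimately show "\<not> sub_line_locus X L E \<iota> \<subseteq> ?M" by blast
  qed
next
  case False
  let ?M = "{line_of E v | v. \<not> vb_is_zero E v \<and> opposite_eigen v}"
  show ?thesis
  proof (rule that[of ?M])
    show "analytic_in (proj_atlas X E) ?M" by (rule opposite_eigen_analytic)
    show "eigen_variety X E \<Phi> \<subseteq> sub_line_locus X L E \<iota> \<union> ?M"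
      unfolding eigen_variety_eq sub_line_locus_eq using eigen_cases(1) by blast
    obtain U \<phi> k e where c: "(U, \<phi>) \<in> X" "proj L e \<in> U" and nz: "\<not> vb_is_zero E (\<Phi> (U, \<phi>) k (\<iota> e))"
      using False by blast
    define x where "x = proj L e"
    obtain V \<tau> V' \<sigma> p where ic: "iota_coords V \<tau> V' \<sigma> p" and x: "x \<in> V" "x \<in> V'" by (rule iota_coords_near)
    note t = ic_triv(1)[OF ic]
    obtain A where fm: "field_matrix U \<phi> V \<tau> A" using field_matrix_exists[OF c(1) t] .
    have xU: "x \<in> U" using c by (simp add: x_def)
    obtain \<mu> where \<mu>: "A k x *v p x = \<mu> *s p x" using fm_invariant[OF fm ic xU x] .
    have \<tau>e: "\<tau> (\<iota> e) = \<sigma> e $ 1 *s p x" using ic_eq[OF ic, of e] x by (simp add: x_def)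
    have \<tau>\<Phi>: "\<tau> (\<Phi> (U, \<phi>) k (\<iota> e)) = (\<sigma> e $ 1 * \<mu>) *s p x"
      using fm_eq[OF fm, of "\<iota> e" k] \<tau>e \<mu> x xU by (simp add: x_def vec.scale)
    have "(\<sigma> e $ 1 * \<mu>) *s p x \<noteq> 0"
      using nz vb_is_zero_iff[OF X E t, of "\<Phi> (U, \<phi>) k (\<iota> e)"] proj_field[OF c(1), of "\<iota> e" k] \<tau>\<Phi> x xU
      by (simp add: x_def)
    then have ne: "\<sigma> e $ 1 \<noteq> 0" "\<mu> \<noteq> 0" "p x \<noteq> 0" by auto
    have ie: "\<not> vb_is_zero E (\<iota> e)"
      using vb_is_zero_iff[OF X E t, of "\<iota> e"] \<tau>e ne x by (simp add: x_def)
    then have "line_of E (\<iota> e) \<in> sub_line_locus X L E \<iota>"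
      using generic_locus_subset unfolding generic_locus_def by blast
    moreover have "line_of E (\<iota> e) \<notin> ?M"
    proof
      assume "line_of E (\<iota> e) \<in> ?M"
      then obtain v' where v': "line_of E v' = line_of E (\<iota> e)" "opposite_eigen v'" by force
      obtain d where "\<iota> e = vb_scale E d v'" using line_of_eqD[OF X E v'(1)] .
      then have "opposite_eigen (\<iota> e)" using opposite_eigen_scale v'(2) by simp
      \<comment> \<open>The diagonal coordinates suffice: they are nonzero multiples of the squares
        of the coordinates of \<open>p x\<close>.\<close>
      then have "tensor_pair i i (A k x *v \<tau> (\<iota> e)) (p x) (\<tau> (\<iota> e)) (A k x *v p x) = 0" for i
        using opposite_eigen_iff[OF fm ic, of "\<iota> e"] x xU by (simp add: x_def)
      then have "2 * \<sigma> e $ 1 * \<mu> * (p x $ i * p x $ i) = 0" for i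
        unfolding \<tau>e vec.scale \<mu> by (simp add: tensor_pair_def algebra_simps)
      then have "p x $ i = 0" for i using ne by simp
      then show False using ne(3) by (simp add: vec_eq_iff)
    qed
    ultimately show "\<not> sub_line_locus X L E \<iota> \<subseteq> ?M" by blast
  qed
qed

text \<open>An irreducible \<open>Z\<close> between the locus and the eigen-variety is the union of
  the locus and the analytic set \<open>Z \<inter> M\<close>, so it equals one of them. It is not
  contained in \<open>M\<close>, because the locus is not.\<close>

lemma sub_line_locus_irreducible_component:
  "irreducible_component (proj_atlas X E) (eigen_variety X E \<Phi>) (sub_line_locus X L E \<iota>)"
  unfolding irreducible_component_def
proof (intro conjI allI impI)
  let ?V = "sub_line_locus X L E \<iota>"
  fix Z assume Z: "irreducible_analytic (proj_atlas X E) Z \<and> ?V \<subseteq> Z \<and> Z \<subseteq> eigen_variety X E \<Phi>"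
  obtain M where M: "analytic_in (proj_atlas X E) M" "eigen_variety X E \<Phi> \<subseteq> ?V \<union> M" "\<not> ?V \<subseteq> M"
    by (rule residual_component)
  have "Z = ?V \<union> (Z \<inter> M)" using Z M(2) by blast
  moreover have "analytic_in (proj_atlas X E) (Z \<inter> M)"
    using Z M(1) analytic_in_Int[OF X E] unfolding irreducible_analytic_def by blast
  ultimately have "?V = Z \<or> Z \<inter> M = Z"
    using Z sub_line_locus_analytic unfolding irreducible_analytic_def by blast
  then show "Z = ?V" using M(3) Z by blast
qed (rule eigen_variety_analytic sub_line_locus_irreducible sub_line_locus_subset_eigen)+

end

lemma hopf_surface_connected:
  fixes X :: "('a :: {t2_space, second_countable_topology}, 2) atlas"
  assumes "hopf_surface X" shows "connected (UNIV :: 'a set)"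
proof -
  have "connected (sphere (0 :: real ^ 2) 1 \<times> sphere (0 :: real ^ 4) 1)"
    by (intro connected_Times connected_sphere) simp_all
  then show ?thesis
    using assms homeomorphic_connectedness unfolding hopf_surface_def by blast
qed

theorem proposition7p2:
  fixes X :: "('a :: {t2_space, second_countable_topology}, 2) atlas"
    and E :: "('a, 'e, 2) vbundle"
    and L :: "('a, 'l, 1) vbundle"
    and \<Phi> :: "('a, 'e) end_field"
    and \<iota> :: "'l \<Rightarrow> 'e"
  assumes "hopf_surface X"
    and "holo_vector_bundle X E"
    and "co_higgs_field X E \<Phi>"
    and "trace_free X E \<Phi>"
    and "nonzero_field X E \<Phi>"
    and "sub_line_bundle X L E \<iota>"
    and "invariant_under X L E \<Phi> \<iota>"
    and "torsion_free_cokernel X L E \<iota>"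
  shows "irreducible_component (proj_atlas X E) (eigen_variety X E \<Phi>) (sub_line_locus X L E \<iota>)"
proof -
  interpret co_higgs_setting X E L \<iota> \<Phi>
  proof
    show "complex_manifold X" using assms(1) unfolding hopf_surface_def by blast
    show "connected (UNIV :: 'a set)" by (rule hopf_surface_connected[OF assms(1)])
    show "end_tangent_section X E \<Phi>" using assms(3) unfolding co_higgs_field_def by blast
  qed (fact assms)+
  show ?thesis by (rule sub_line_locus_irreducible_component)
qed

end
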